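(* Let $\phi\colon\mathbb{R}\to\mathbb{R}$ be an increasing homeomorphism with $\phi(0)=0$, $f,q\colon\mathbb{R}\to\mathbb{R}$ continuous, $a\in L^\infty(0,T)$ with $a(t)\ge0$ a.e. and $\bar a:=\frac1T\int_0^Ta>0$, and $e\in L^1(0,T)$ with $\frac1T\int_0^Te=0$. Assume the limits $\omega_\pm:=\lim_{u\to\pm\infty}q(u)\in[-\infty,+\infty]$ exist. Consider $$(\phi(u'))'+f(u)u'+a(t)q(u)=s+e(t).\qquad(\mathscr{W\!E}_s)$$ Assume there exists $D>0$ such that $q(u)<\omega_-$ for $u\le-D$ and $q(u)<\omega_+$ for $u\ge D$, and that $\min\{\omega_-,\omega_+\}<+\infty$. Then there exists $s_0\in\,]-\infty,\bar a\omega_-[$ such that: for $s<s_0$, $(\mathscr{W\!E}_s)$ has no $T$-periodic solutions; for $s=s_0$, at least one; for $s_0<s<\bar a\omega_-$, at least one; for $s_0<s<\bar a\min\{\omega_-,\omega_+\}$, at least two $T$-periodic solutions.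
   Context: A $T$-periodic solution is $u\in\mathcal{C}^1([0,T])$ with $u(0)=u(T)$, $u'(0)=u'(T)$, $\phi(u')$ absolutely continuous, satisfying the equation a.e. Products such as $\bar a\cdot(+\infty)$ are $+\infty$. *)

theory Defs
  imports "HOL-Analysis.Analysis"
begin

definition abs_cont_on :: "real \<Rightarrow> real \<Rightarrow> (real \<Rightarrow> real) \<Rightarrow> bool" where
  "abs_cont_on a b g \<longleftrightarrow>
     (\<forall>\<epsilon>>0. \<exists>\<delta>>0. \<forall>(n::nat) (x::nat \<Rightarrow> real) (y::nat \<Rightarrow> real).
        (\<forall>i<n. a \<le> x i \<and> x i \<le> y i \<and> y i \<le> b) \<and>
        (\<forall>i<n. \<forall>j<n. i \<noteq> j \<longrightarrow> y i \<le> x j \<or> y j \<le> x i) \<and>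
        (\<Sum>i<n. y i - x i) < \<delta>
        \<longrightarrow> (\<Sum>i<n. \<bar>g (y i) - g (x i)\<bar>) < \<epsilon>)"

definition avg :: "real \<Rightarrow> (real \<Rightarrow> real) \<Rightarrow> real" where
  "avg T g = integral\<^sup>L (lebesgue_on {0..T}) g / T"

definition periodic_sol ::
  "(real \<Rightarrow> real) \<Rightarrow> (real \<Rightarrow> real) \<Rightarrow> (real \<Rightarrow> real) \<Rightarrow> (real \<Rightarrow> real) \<Rightarrow>
   (real \<Rightarrow> real) \<Rightarrow> real \<Rightarrow> real \<Rightarrow> (real \<Rightarrow> real) \<Rightarrow> bool" where
  "periodic_sol \<phi> f a q e T s u \<longleftrightarrow>
     (\<exists>u'. (\<forall>t\<in>{0..T}. (u has_real_derivative u' t) (at t within {0..T})) \<and>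
           continuous_on {0..T} u' \<and>
           u 0 = u T \<and> u' 0 = u' T \<and>
           abs_cont_on 0 T (\<lambda>t. \<phi> (u' t)) \<and>
           (AE t in lebesgue_on {0..T}.
              \<exists>w. ((\<lambda>\<tau>. \<phi> (u' \<tau>)) has_real_derivative w) (at t within {0..T}) \<and>
                  w + f (u t) * u' t + a t * q (u t) = s + e t))"

end

theory Submission
  imports Defs "HOL-Complex_Analysis.Great_Picard"
begin

text \<open>With \<open>F' = f\<close> and \<open>\<psi> = \<phi>\<inverse>\<close> the equation reads \<open>u' = \<psi> (W - F u)\<close>, where
  \<open>W t = c + \<integral>\<^sub>0\<^sup>t (s + e - a q(u))\<close>. A solution whose normalisation
  \<open>\<mu> = max (u - u\<^sub>0)\<close> satisfies \<open>\<mu> = clamp (\<mu> - (s - s*))\<close> for a clamp to \<open>[0, X]\<close> is produced by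
  Brouwer's theorem applied to the triple \<open>(u 0, c, s)\<close> of a delayed equation, followed by
  Arzela-Ascoli. Take \<open>u\<^sub>0\<close> to be a solution for the least parameter \<open>s\<^sub>0\<close>, and \<open>s* > s\<^sub>0\<close>. At \<open>\<mu> = 0\<close>
  the functions touch, which a comparison argument forbids for \<open>s > s\<^sub>0\<close>; at \<open>\<mu> = X\<close> the solution is so
  large that its parameter exceeds \<open>s*\<close>. Hence \<open>0 < \<mu> < X\<close>, and the clamp equation gives \<open>s = s*\<close>. The
  mirrored argument with \<open>-\<mu>\<close> yields a solution below \<open>u\<^sub>0\<close>. The infimum \<open>s\<^sub>0\<close> is attained because
  slopes of solutions are bounded a priori.\<close>

section \<open>Integration on the real line\<close>

text \<open>\<open>f\<close>, \<open>q\<close> and \<psi> are merely continuous, so initial value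
  problems need not have unique solutions and there is no shooting map. The delay removes this
  obstacle: a delayed solution is an explicit iteration of integrals, hence continuous in the three
  numbers \<open>(p, c, s)\<close>, and a finite-dimensional fixed point theorem replaces degree
  theory in a function space. Making \<open>s\<close> an unknown keeps the problem solvable: the
  mean of the equation determines \<open>s\<close>, and the freedom so gained is spent on
  prescribing how far \<open>u\<close> lies from \<open>u0\<close>. Brouwer's theorem needs bounded
  data, so \<open>F\<close> and \<open>q\<close> are truncated; this is harmless because the
  oscillation of a solution is bounded in terms of a lower bound of \<open>q\<close> and an upper
  bound of \<open>s\<close> alone, so the truncation radius can be fixed afterwards. The limits of
  \<open>q\<close> enter through the mean: if \<open>q (u t) \<ge> r\<close> throughout, then
  \<open>s \<ge> abar * r\<close>. The integration theory is there because solutions are given with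
  \<open>\<phi> (u')\<close> absolutely continuous and have to be converted to the integral form and
  back.\<close>

lemma integral_increment:
  fixes h :: "real \<Rightarrow> real"
  assumes "h integrable_on {a..b}" "a \<le> x" "x \<le> y" "y \<le> b"
  shows "integral {a..y} h - integral {a..x} h = integral {x..y} h"
proof -
  have "h integrable_on {a..y}"
    using assms integrable_subinterval_real[of h a b a y] by auto
  then show ?thesis
    using Henstock_Kurzweil_Integration.integral_combine[of a x y h] assms by auto
qed

text \<open>A bad point \<open>t\<close> and a suitable nearby \<open>y\<close> bound an interval,
  tagged at \<open>t\<close>, whose Riemann term misses the integral by at least \<open>c\<close>
  times its length. Henstock's lemma keeps the total miss of disjoint fine intervals below
  \<open>c * e\<close>, so their total length is at most \<open>e\<close>; Vitali's theorem covers
  the bad set by such intervals up to a null set.\<close>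

lemma negligible_not_derivative_indefinite_integral:
  fixes h :: "real \<Rightarrow> real"
  assumes h: "h integrable_on {a..b}" and c: "c > 0"
  shows "negligible {t\<in>{a<..<b}. \<forall>d>0. \<exists>y\<in>{a..b}. y \<noteq> t \<and> \<bar>y - t\<bar> < d \<and>
           c * \<bar>y - t\<bar> \<le> \<bar>integral {a..y} h - integral {a..t} h - h t * (y - t)\<bar>}"
    (is "negligible ?B")
  unfolding negligible_outer_le
proof (intro allI impI)
  fix e :: real assume e: "e > 0"
  have hc: "h integrable_on cbox a b" using h by simp
  obtain \<gamma> where \<gamma>: "gauge \<gamma>"
    and fine: "\<And>p. \<lbrakk>p tagged_partial_division_of (cbox a b); \<gamma> fine p\<rbrakk> \<Longrightarrow>
             sum (\<lambda>(x,k). norm(measure lborel k *\<^sub>R h x - integral k h)) p < c * e"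
    using Henstock_lemma[OF hc, of "c * e"] c e by auto
  define K where "K = {(t,y). t \<in> ?B \<and> y \<in> {a..b} \<and> y \<noteq> t \<and> {min t y..max t y} \<subseteq> \<gamma> t \<and>
      c * \<bar>y - t\<bar> \<le> \<bar>integral {a..y} h - integral {a..t} h - h t * (y - t)\<bar>}"
  \<comment> \<open>The covering theorem speaks of balls; centre and radius encode the interval
    between \<open>t\<close> and \<open>y\<close>, which may lie on either side of the tag.\<close>
  define m :: "real \<times> real \<Rightarrow> real" where "m = (\<lambda>(t,y). (t + y) / 2)"
  define r :: "real \<times> real \<Rightarrow> real" where "r = (\<lambda>(t,y). \<bar>y - t\<bar> / 2)"
  have cb: "cball (m i) (r i) = {min (fst i) (snd i)..max (fst i) (snd i)}" for i
    by (cases i) (auto simp: m_def r_def cball_eq_atLeastAtMost min_def max_def field_simps abs_if)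
  obtain C where C: "countable C" "C \<subseteq> K"
     "pairwise (\<lambda>i j. disjnt (cball (m i) (r i)) (cball (m j) (r j))) C"
     and negl: "negligible(?B - (\<Union>i \<in> C. cball (m i) (r i)))"
  proof (rule Vitali_covering_theorem_cballs[of K r ?B m])
    show "0 < r i" if "i \<in> K" for i using that by (auto simp: K_def r_def)
    show "\<exists>i. i \<in> K \<and> t \<in> cball (m i) (r i) \<and> r i < d" if t: "t \<in> ?B" and d: "0 < d" for t d
    proof -
      have "open (\<gamma> t)" "t \<in> \<gamma> t" using \<gamma> by (auto simp: gauge_def)
      then obtain \<rho> where \<rho>: "\<rho> > 0" "ball t \<rho> \<subseteq> \<gamma> t" by (meson openE)
      have "min \<rho> d > 0" using \<rho> d by auto
      then obtain y where y: "y\<in>{a..b}" "y \<noteq> t" "\<bar>y - t\<bar> < min \<rho> d"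
         "c * \<bar>y - t\<bar> \<le> \<bar>integral {a..y} h - integral {a..t} h - h t * (y - t)\<bar>"
        using t by blast
      have "{min t y..max t y} \<subseteq> ball t \<rho>" using y by (auto simp: dist_real_def)
      then have "(t,y) \<in> K" using y t \<rho> unfolding K_def by blast
      moreover have "t \<in> cball (m (t,y)) (r (t,y))" unfolding cb by auto
      moreover have "r (t,y) < d" using y d by (auto simp: r_def)
      ultimately show ?thesis by blast
    qed
  qed
  let ?I = "\<lambda>i. cball (m i) (r i)"
  have sub: "?I i \<subseteq> {a..b}" if "i \<in> K" for i
    using that unfolding cb by (auto simp: K_def)
  have ne: "?I i \<noteq> {}" if "i \<in> K" for i using that unfolding cb by auto
  have fin: "measure lebesgue (\<Union>D') \<le> e" if D': "D' \<subseteq> ?I ` C" "finite D'" for D'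
  proof -
    obtain C' where C': "C' \<subseteq> C" "finite C'" "D' = ?I ` C'"
      using finite_subset_image[OF D'(2,1)] by auto
    have C'K: "C' \<subseteq> K" using C C' by auto
    let ?p = "(\<lambda>i. (fst i, ?I i)) ` C'"
    have disj: "disjnt (?I i) (?I j)" if "i \<in> C'" "j \<in> C'" "i \<noteq> j" for i j
      using C(3) that C'(1) by (auto simp: pairwise_def)
    have inj: "inj_on ?I C'"
    proof (rule inj_onI, rule ccontr)
      fix i j assume ij: "i \<in> C'" "j \<in> C'" "?I i = ?I j" "i \<noteq> j"
      then have "disjnt (?I i) (?I i)" using disj by metis
      then show False using ne[of i] ij C'K unfolding disjnt_def by blast
    qed
    have inj2: "inj_on (\<lambda>i. (fst i, ?I i)) C'" using inj by (auto simp: inj_on_def)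
    have "?p tagged_partial_division_of (cbox a b)"
      unfolding tagged_partial_division_of_def
    proof (intro conjI allI impI)
      show "finite ?p" using C' by auto
      fix x k assume "(x,k) \<in> ?p"
      then obtain i where i: "i \<in> C'" "x = fst i" "k = ?I i" by auto
      show "x \<in> k" using i unfolding cb by auto
      have "i \<in> K" using i C'K by blast
      then show "k \<subseteq> cbox a b" using sub[of i] i(3) by simp
      show "\<exists>a b. k = cbox a b" using i unfolding cb by (metis box_real(2))
    next
      fix x1 k1 x2 k2 assume "(x1,k1) \<in> ?p \<and> (x2,k2) \<in> ?p \<and> (x1,k1) \<noteq> (x2,k2)"
      then obtain i j where ij: "i \<in> C'" "j \<in> C'" "i \<noteq> j" "k1 = ?I i" "k2 = ?I j" by auto
      then have "k1 \<inter> k2 = {}" using disj by (auto simp: disjnt_def)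
      then show "interior k1 \<inter> interior k2 = {}" using interior_subset by blast
    qed
    moreover have "\<gamma> fine ?p"
    proof -
      have g: "?I i \<subseteq> \<gamma> (fst i)" if "i \<in> K" for i
        using that unfolding cb K_def case_prod_beta mem_Collect_eq by (elim conjE)
      show ?thesis
      proof (rule fineI)
        fix x k assume xk: "(x,k) \<in> ?p"
        show "k \<subseteq> \<gamma> x"
        proof (rule imageE[OF xk])
          fix i assume i: "(x,k) = (fst i, ?I i)" "i \<in> C'"
          show ?thesis using g[OF subsetD[OF C'K i(2)]] i(1) unfolding prod.inject by (elim conjE) (simp only:)
        qed
      qed
    qed
    ultimately have *: "(\<Sum>i\<in>C'. norm (measure lborel (?I i) *\<^sub>R h (fst i) - integral (?I i) h)) < c * e"
      using fine[of ?p] by (simp add: sum.reindex[OF inj2])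
    have ge: "c * measure lborel (?I i) \<le> norm (measure lborel (?I i) *\<^sub>R h (fst i) - integral (?I i) h)"
      if "i \<in> C'" for i
    proof -
      obtain t y where i: "i = (t,y)" by (cases i)
      have iK: "t \<in> {a..b}" "y \<in> {a..b}" "y \<noteq> t"
         "c * \<bar>y - t\<bar> \<le> \<bar>integral {a..y} h - integral {a..t} h - h t * (y - t)\<bar>"
        using that C'K i by (auto simp: K_def)
      show ?thesis
      proof (cases "t < y")
        case True
        then have I: "?I i = {t..y}" unfolding cb i by auto
        show ?thesis unfolding I using True iK integral_increment[OF h, of t y] i
          by (auto simp: algebra_simps abs_minus_commute)
      next
        case False
        then have yt: "y < t" using iK by auto
        then have I: "?I i = {y..t}" unfolding cb i by auto
        have "integral {a..y} h - integral {a..t} h - h t * (y - t) = (t - y) * h t - integral {y..t} h"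
          using integral_increment[OF h, of y t] iK yt by (auto simp: algebra_simps)
        then show ?thesis unfolding I using yt iK i by (auto simp: algebra_simps)
      qed
    qed
    have "measure lebesgue (\<Union>D') \<le> (\<Sum>i\<in>C'. measure lebesgue (?I i))"
      unfolding C' by (rule measure_UNION_le) (use C' in auto)
    moreover have "c * (\<Sum>i\<in>C'. measure lebesgue (?I i)) \<le> c * e"
    proof -
      have "c * (\<Sum>i\<in>C'. measure lebesgue (?I i)) = (\<Sum>i\<in>C'. c * measure lborel (?I i))"
        by (simp add: sum_distrib_left measure_completion)
      also have "\<dots> \<le> (\<Sum>i\<in>C'. norm (measure lborel (?I i) *\<^sub>R h (fst i) - integral (?I i) h))"
        by (rule sum_mono) (rule ge)
      also have "\<dots> \<le> c * e" using * by (rule less_imp_le)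
      finally show ?thesis .
    qed
    ultimately show ?thesis using c by auto
  qed
  let ?U = "\<Union>(?I ` C)"
  have "?U \<in> sets lebesgue" using C(1) by (intro sets.countable_UN'') auto
  moreover have "bounded ?U"
    by (rule bounded_subset[of "{a..b}"]) (use sub C in auto)
  ultimately have U: "?U \<in> lmeasurable" by (simp add: bounded_set_imp_lmeasurable)
  \<comment> \<open>The bound for finite subfamilies passes to the countable union with an
    arbitrarily small loss.\<close>
  have Ue: "measure lebesgue ?U \<le> e"
  proof (rule field_le_epsilon)
    fix d :: real assume "d > 0"
    obtain D' where "D' \<subseteq> ?I ` C" "finite D'" "measure lebesgue ?U - d < measure lebesgue (\<Union>D')"
    proof (rule measure_countable_Union_approachable[of "?I ` C" d e])
      show "\<And>D'. D' \<subseteq> ?I ` C \<Longrightarrow> finite D' \<Longrightarrow> measure lebesgue (\<Union>D') \<le> e" using fin by blast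
    qed (use C \<open>d > 0\<close> in auto)
    then show "measure lebesgue ?U \<le> e + d" using fin[of D'] by linarith
  qed
  show "\<exists>T. ?B \<subseteq> T \<and> T \<in> lmeasurable \<and> measure lebesgue T \<le> e"
  proof (intro exI conjI)
    let ?N = "?B - (\<Union>i \<in> C. ?I i)"
    show "?B \<subseteq> ?U \<union> ?N" by auto
    show "?U \<union> ?N \<in> lmeasurable" using U negl negligible_imp_measurable by blast
    have "measure lebesgue (?U \<union> ?N) \<le> measure lebesgue ?U + measure lebesgue ?N"
      by (rule measure_Un_le) (use U negl negligible_imp_sets in \<open>auto intro: fmeasurableD\<close>)
    then show "measure lebesgue (?U \<union> ?N) \<le> e" using Ue negl
      by (simp add: negligible_imp_measure0)
  qed
qed

text \<open>Lebesgue's differentiation theorem for the gauge integral. The exceptional set is the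
  union of the bad sets for the thresholds \<open>1 / (k + 1)\<close>; the endpoints are added
  because those sets lie in the open interval.\<close>

lemma indefinite_integral_has_derivative_AE:
  fixes h :: "real \<Rightarrow> real"
  assumes h: "h integrable_on {a..b}"
  obtains N where "negligible N"
    "\<And>t. t \<in> {a..b} - N \<Longrightarrow> ((\<lambda>x. integral {a..x} h) has_real_derivative h t) (at t within {a..b})"
proof
  let ?B = "\<lambda>k. {t\<in>{a<..<b}. \<forall>d>0. \<exists>y\<in>{a..b}. y \<noteq> t \<and> \<bar>y - t\<bar> < d \<and>
           inverse (real (Suc k)) * \<bar>y - t\<bar> \<le> \<bar>integral {a..y} h - integral {a..t} h - h t * (y - t)\<bar>}"
  let ?N = "{a,b} \<union> (\<Union>k. ?B k)"
  show "negligible ?N"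
    using negligible_not_derivative_indefinite_integral[OF h]
    by (intro negligible_Un negligible_Union_nat) auto
  fix t assume t: "t \<in> {a..b} - ?N"
  show "((\<lambda>x. integral {a..x} h) has_real_derivative h t) (at t within {a..b})"
    unfolding has_field_derivative_iff
  proof (rule Lim_withinI)
    fix e :: real assume "e > 0"
    then obtain k where k: "inverse (real (Suc k)) < e" using reals_Archimedean by blast
    from t have "t \<notin> ?B k" "t \<in> {a<..<b}" by auto
    then obtain d where d: "d > 0" "\<And>y. y \<in> {a..b} \<Longrightarrow> y \<noteq> t \<Longrightarrow> \<bar>y - t\<bar> < d \<Longrightarrow>
       \<bar>integral {a..y} h - integral {a..t} h - h t * (y - t)\<bar> < inverse (real (Suc k)) * \<bar>y - t\<bar>"
      by force
    show "\<exists>d>0. \<forall>y\<in>{a..b}. 0 < dist y t \<and> dist y t < d \<longrightarrow>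
         dist ((integral {a..y} h - integral {a..t} h) / (y - t)) (h t) \<le> e"
    proof (intro exI conjI ballI impI)
      fix y assume y: "y \<in> {a..b}" "0 < dist y t \<and> dist y t < d"
      then have yt: "y \<noteq> t" "\<bar>y - t\<bar> < d" by (auto simp: dist_real_def)
      have "(integral {a..y} h - integral {a..t} h) / (y - t) - h t
          = (integral {a..y} h - integral {a..t} h - h t * (y - t)) / (y - t)"
        using yt by (simp add: field_simps)
      also have "\<bar>\<dots>\<bar> \<le> inverse (real (Suc k))"
        using d(2)[OF y(1) yt] yt by (simp add: abs_divide divide_le_eq)
      finally show "dist ((integral {a..y} h - integral {a..t} h) / (y - t)) (h t) \<le> e"
        using k by (simp add: dist_real_def)
    qed (use d in auto)
  qed
qed

section \<open>Absolutely continuous functions as integrals of their derivatives\<close>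

lemma sum_integral_nonoverlapping_le:
  fixes g :: "real \<Rightarrow> real"
  assumes g: "g integrable_on {a..b}" and pos: "\<And>t. t \<in> {a..b} \<Longrightarrow> 0 \<le> g t"
    and xy: "\<And>i::nat. i < n \<Longrightarrow> a \<le> x i \<and> x i \<le> y i \<and> y i \<le> b"
    and disj: "\<And>i j. i < n \<Longrightarrow> j < n \<Longrightarrow> i \<noteq> j \<Longrightarrow> y i \<le> x j \<or> y j \<le> x i"
  shows "(\<Sum>i<n. integral {x i..y i} g) \<le> integral {a..b} g"
proof -
  \<comment> \<open>Without their endpoints the intervals are disjoint, so at each \<open>t\<close>
    at most one summand is nonzero, and it equals \<open>g t\<close>.\<close>
  let ?F = "\<lambda>i t. if t \<in> {x i<..<y i} then g t else 0"
  have F: "(?F i has_integral integral {x i..y i} g) {a..b}" if "i < n" for i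
  proof -
    have "g integrable_on {x i..y i}"
      using integrable_subinterval_real[OF g] xy[OF that] by auto
    then have "(g has_integral integral {x i..y i} g) {x i..y i}" by (rule integrable_integral)
    then have "(g has_integral integral {x i..y i} g) {x i<..<y i}"
      by (metis has_integral_Icc_iff_Ioo)
    moreover have "{x i<..<y i} \<subseteq> {a..b}" using xy[OF that] by auto
    ultimately show ?thesis
      using has_integral_restrict[of "{x i<..<y i}" "{a..b}" g] by blast
  qed
  have "((\<lambda>t. \<Sum>i<n. ?F i t) has_integral (\<Sum>i<n. integral {x i..y i} g)) {a..b}"
    by (rule has_integral_sum) (use F in auto)
  then show ?thesis
  proof (rule has_integral_le)
    show "(g has_integral integral {a..b} g) {a..b}" using g by (rule integrable_integral)
    fix t assume t: "t \<in> {a..b}"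
    show "(\<Sum>i<n. ?F i t) \<le> g t"
    proof (cases "\<exists>i<n. t \<in> {x i<..<y i}")
      case True
      then obtain i where i: "i < n" "t \<in> {x i<..<y i}" by auto
      have "(\<Sum>j<n. ?F j t) = (\<Sum>j\<in>{i}. ?F j t)"
      proof (rule sum.mono_neutral_right)
        show "\<forall>j\<in>{..<n} - {i}. ?F j t = 0"
        proof
          fix j assume "j \<in> {..<n} - {i}"
          then show "?F j t = 0" using disj[of i j] i by auto
        qed
      qed (use i in auto)
      then show ?thesis using i by simp
    next
      case False
      then have "(\<Sum>j<n. ?F j t) = 0" by (intro sum.neutral) auto
      then show ?thesis using pos[OF t] by simp
    qed
  qed
qed

text \<open>The integrand is cut at height \<open>N\<close>: by dominated convergence the excess
  over \<open>N\<close> has integral below \<epsilon>/2, and the rest contributes at most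
  \<open>N\<close> times the total length of the intervals.\<close>

lemma abs_cont_on_indefinite_integral:
  fixes h :: "real \<Rightarrow> real"
  assumes h: "h absolutely_integrable_on {a..b}"
  shows "abs_cont_on a b (\<lambda>t. integral {a..t} h)"
  unfolding abs_cont_on_def
proof (intro allI impI)
  fix \<epsilon> :: real assume \<epsilon>: "\<epsilon> > 0"
  have hi: "h integrable_on {a..b}" using h set_lebesgue_integral_eq_integral(1) by blast
  have ha: "(\<lambda>t. \<bar>h t\<bar>) integrable_on {a..b}"
    using h unfolding absolutely_integrable_on_def by simp
  have habs: "(\<lambda>t. \<bar>h t\<bar>) absolutely_integrable_on {a..b}"
    using h absolutely_integrable_abs_iff set_integrable_abs by blast
  have gi: "(\<lambda>t. \<bar>h t\<bar> - min \<bar>h t\<bar> (real N)) integrable_on {a..b}" for N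
  proof -
    have "(\<lambda>t. min \<bar>h t\<bar> (real N)) absolutely_integrable_on {a..b}"
      by (rule absolutely_integrable_min_1[OF habs]) (auto simp: absolutely_integrable_on_const)
    then show ?thesis
      by (intro integrable_diff ha) (use set_lebesgue_integral_eq_integral(1) in blast)
  qed
  have "(\<lambda>N. integral {a..b} (\<lambda>t. \<bar>h t\<bar> - min \<bar>h t\<bar> (real N))) \<longlonglongrightarrow> integral {a..b} (\<lambda>t. 0)"
  proof (rule dominated_convergence(2)[OF gi ha])
    show "norm (\<bar>h t\<bar> - min \<bar>h t\<bar> (real N)) \<le> \<bar>h t\<bar>" for N t by auto
    show "(\<lambda>N. \<bar>h t\<bar> - min \<bar>h t\<bar> (real N)) \<longlonglongrightarrow> 0" for t
    proof (rule tendsto_eventually)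
      obtain N0 where N0: "\<bar>h t\<bar> \<le> real N0" using real_arch_simple by blast
      show "\<forall>\<^sub>F N in sequentially. \<bar>h t\<bar> - min \<bar>h t\<bar> (real N) = 0"
      proof (rule eventually_sequentiallyI[of N0])
        fix N assume "N0 \<le> N"
        then have "real N0 \<le> real N" by simp
        then show "\<bar>h t\<bar> - min \<bar>h t\<bar> (real N) = 0" using N0 by linarith
      qed
    qed
  qed
  then have "\<forall>\<^sub>F N in sequentially. integral {a..b} (\<lambda>t. \<bar>h t\<bar> - min \<bar>h t\<bar> (real N)) < \<epsilon>/2"
    using \<epsilon> by (intro order_tendstoD) auto
  then obtain N where N: "integral {a..b} (\<lambda>t. \<bar>h t\<bar> - min \<bar>h t\<bar> (real N)) < \<epsilon>/2"
    unfolding eventually_sequentially by blast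
  show "\<exists>\<delta>>0. \<forall>(n::nat) (x::nat \<Rightarrow> real) (y::nat \<Rightarrow> real).
        (\<forall>i<n. a \<le> x i \<and> x i \<le> y i \<and> y i \<le> b) \<and>
        (\<forall>i<n. \<forall>j<n. i \<noteq> j \<longrightarrow> y i \<le> x j \<or> y j \<le> x i) \<and> (\<Sum>i<n. y i - x i) < \<delta> \<longrightarrow>
        (\<Sum>i<n. \<bar>integral {a..y i} h - integral {a..x i} h\<bar>) < \<epsilon>"
  proof (intro exI conjI allI impI)
    \<comment> \<open>\<open>N + 1\<close> in place of \<open>N\<close> covers the case
      \<open>N = 0\<close>.\<close>
    show "\<epsilon> / (2 * (real N + 1)) > 0" using \<epsilon> by simp
    fix n :: nat and x y :: "nat \<Rightarrow> real"
    assume A: "(\<forall>i<n. a \<le> x i \<and> x i \<le> y i \<and> y i \<le> b) \<and>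
        (\<forall>i<n. \<forall>j<n. i \<noteq> j \<longrightarrow> y i \<le> x j \<or> y j \<le> x i) \<and>
        (\<Sum>i<n. y i - x i) < \<epsilon> / (2 * (real N + 1))"
    then have xy: "\<forall>i<n. a \<le> x i \<and> x i \<le> y i \<and> y i \<le> b"
      and disj: "\<forall>i<n. \<forall>j<n. i \<noteq> j \<longrightarrow> y i \<le> x j \<or> y j \<le> x i"
      and small: "(\<Sum>i<n. y i - x i) < \<epsilon> / (2 * (real N + 1))" by auto
    let ?g = "\<lambda>t. \<bar>h t\<bar> - min \<bar>h t\<bar> (real N)"
    have each: "\<bar>integral {a..y i} h - integral {a..x i} h\<bar> \<le> integral {x i..y i} ?g + real N * (y i - x i)"
      if i: "i < n" for i
    proof -
      have sub: "{x i..y i} \<subseteq> {a..b}" using xy i by auto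
      have 1: "integral {a..y i} h - integral {a..x i} h = integral {x i..y i} h"
        using integral_increment[OF hi] xy i by auto
      have gi': "?g integrable_on {x i..y i}" using integrable_subinterval_real[OF gi sub] .
      have "norm (integral {x i..y i} h) \<le> integral {x i..y i} (\<lambda>t. ?g t + real N)"
        by (rule integral_norm_bound_integral)
          (use integrable_subinterval_real[OF hi sub] gi' in \<open>auto intro!: integrable_add\<close>)
      also have "\<dots> = integral {x i..y i} ?g + real N * (y i - x i)"
        using gi' xy i by (subst integral_add) auto
      finally show ?thesis unfolding 1 by simp
    qed
    have "(\<Sum>i<n. \<bar>integral {a..y i} h - integral {a..x i} h\<bar>)
       \<le> (\<Sum>i<n. integral {x i..y i} ?g + real N * (y i - x i))"
      by (rule sum_mono) (use each in auto)
    also have "\<dots> = (\<Sum>i<n. integral {x i..y i} ?g) + real N * (\<Sum>i<n. y i - x i)"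
      by (simp add: sum.distrib sum_distrib_left)
    also have "(\<Sum>i<n. integral {x i..y i} ?g) \<le> integral {a..b} ?g"
      by (rule sum_integral_nonoverlapping_le[OF gi]) (use xy disj in auto)
    also have "real N * (\<Sum>i<n. y i - x i) \<le> \<epsilon>/2"
    proof -
      have "0 \<le> (\<Sum>i<n. y i - x i)" by (rule sum_nonneg) (use xy in auto)
      then have "real N * (\<Sum>i<n. y i - x i) \<le> (real N + 1) * (\<Sum>i<n. y i - x i)"
        by (simp add: mult_right_mono)
      also have "\<dots> \<le> (real N + 1) * (\<epsilon> / (2 * (real N + 1)))"
        using small by (intro mult_left_mono) auto
      also have "\<dots> = \<epsilon>/2" by (simp add: field_simps)
      finally show ?thesis .
    qed
    finally show "(\<Sum>i<n. \<bar>integral {a..y i} h - integral {a..x i} h\<bar>) < \<epsilon>" using N by linarith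
  qed
qed

text \<open>A bridge from the sets of tagged intervals of gauge integration to the finite sequences
  in \<open>abs_cont_on\<close>. Degenerate intervals are discarded, because a point inside another
  interval would violate the ordering of endpoints; \<open>F c c = 0\<close> makes their omission
  invisible to the sums.\<close>

lemma tagged_partial_division_enumerate:
  fixes a b :: real
  assumes p: "p tagged_partial_division_of {a..b}"
  obtains n :: nat and x y :: "nat \<Rightarrow> real" where
    "\<forall>i<n. a \<le> x i \<and> x i \<le> y i \<and> y i \<le> b"
    "\<forall>i<n. \<forall>j<n. i \<noteq> j \<longrightarrow> y i \<le> x j \<or> y j \<le> x i"
    "\<forall>i<n. \<exists>t. (t, {x i..y i}) \<in> p"
    "\<forall>F :: real \<Rightarrow> real \<Rightarrow> real. (\<forall>c. F c c = 0) \<longrightarrow>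
        (\<Sum>(t,K)\<in>p. F (Inf K) (Sup K)) = (\<Sum>i<n. F (x i) (y i))"
proof -
  note pD = tagged_partial_division_ofD[OF p]
  define p' where "p' = {(t,K)\<in>p. Inf K < Sup K}"
  have fin: "finite p'" using pD(1) unfolding p'_def by (rule finite_subset[rotated]) auto
  obtain f where f: "bij_betw f {0..<card p'} p'" using ex_bij_betw_nat_finite[OF fin] by blast
  define x where "x i = Inf (snd (f i))" for i
  define y where "y i = Sup (snd (f i))" for i
  have fi: "f i \<in> p'" if "i < card p'" for i using f that by (auto simp: bij_betw_def)
  have Kform: "K = {Inf K..Sup K} \<and> Inf K \<le> Sup K" if tK: "(t,K) \<in> p" for t K
  proof -
    obtain c d where "K = cbox c d" using pD(4)[OF tK] by blast
    moreover have "t \<in> K" using pD(2)[OF tK] .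
    ultimately show ?thesis by auto
  qed
  have fK: "f i = (fst (f i), {x i..y i}) \<and> x i < y i \<and> f i \<in> p" if "i < card p'" for i
  proof -
    have "f i \<in> p" "Inf (snd (f i)) < Sup (snd (f i))" using fi[OF that] by (auto simp: p'_def)
    then show ?thesis using Kform[of "fst (f i)" "snd (f i)"] unfolding x_def y_def
      by (metis prod.collapse)
  qed
  show thesis
  proof (rule that[of "card p'" x y]; intro allI impI)
    fix i assume i: "i < card p'"
    show "\<exists>t. (t, {x i..y i}) \<in> p" using fK[OF i] by metis
    then obtain t where "(t, {x i..y i}) \<in> p" by blast
    then have "{x i..y i} \<subseteq> {a..b}" using pD(3) by blast
    then show "a \<le> x i \<and> x i \<le> y i \<and> y i \<le> b" using fK[OF i] by auto
  next
    fix i j assume ij: "i < card p'" "j < card p'" "i \<noteq> j"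
    have "f i \<noteq> f j" using f ij by (auto simp: bij_betw_def inj_on_def)
    then have "interior {x i..y i} \<inter> interior {x j..y j} = {}"
      using pD(5) fK[OF ij(1)] fK[OF ij(2)] by metis
    then have "{x i<..<y i} \<inter> {x j<..<y j} = {}" by (simp add: interior_atLeastAtMost_real)
    then have "{max (x i) (x j)<..<min (y i) (y j)} = {}" by auto
    then have "min (y i) (y j) \<le> max (x i) (x j)" by simp
    then show "y i \<le> x j \<or> y j \<le> x i" using fK[OF ij(1)] fK[OF ij(2)] by linarith
  next
    fix F :: "real \<Rightarrow> real \<Rightarrow> real" assume F: "\<forall>c. F c c = 0"
    have "(\<Sum>(t,K)\<in>p. F (Inf K) (Sup K)) = (\<Sum>(t,K)\<in>p'. F (Inf K) (Sup K))"
    proof (rule sum.mono_neutral_right)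
      show "\<forall>i\<in>p - p'. (case i of (t, K) \<Rightarrow> F (Inf K) (Sup K)) = 0"
      proof safe
        fix t K assume tK: "(t,K) \<in> p" "(t,K) \<notin> p'"
        then have "Inf K = Sup K" using Kform[OF tK(1)] by (auto simp: p'_def)
        then show "F (Inf K) (Sup K) = 0" using F by simp
      qed
    qed (use pD(1) in \<open>auto simp: p'_def\<close>)
    also have "\<dots> = (\<Sum>i\<in>{0..<card p'}. F (x i) (y i))"
      using sum.reindex_bij_betw[OF f, of "\<lambda>(t,K). F (Inf K) (Sup K)"]
      by (simp add: x_def y_def case_prod_beta)
    finally show "(\<Sum>(t,K)\<in>p. F (Inf K) (Sup K)) = (\<Sum>i<card p'. F (x i) (y i))"
      by (simp add: atLeast0LessThan)
  qed
qed

text \<open>The gauge treats \<open>N\<close> separately. Intervals tagged in \<open>N\<close> lie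
  in an open set of measure below the \<delta> of absolute continuity, so their increments add up to
  little; at all other tags the derivative bounds the error by \<open>e'\<close> times the
  length.\<close>

lemma abs_cont_on_has_integral:
  fixes g h :: "real \<Rightarrow> real"
  assumes ac: "abs_cont_on a b g" and ab: "a \<le> b" and N: "negligible N"
    and der: "\<And>t. t \<in> {a..b} - N \<Longrightarrow> (g has_real_derivative h t) (at t within {a..b})"
  shows "(h has_integral g b - g a) {a..b}"
proof -
  \<comment> \<open>With the value 0 on \<open>N\<close>, the Riemann terms tagged there vanish and
    only the increments of \<open>g\<close> remain to be estimated.\<close>
  define k where "k t = (if t \<in> N then 0 else h t)" for t
  have "(k has_integral g b - g a) {a..b}"
    unfolding has_integral_real
  proof (intro allI impI)
    fix e :: real assume e: "e > 0"
    \<comment> \<open>The summand 1 keeps the denominator positive when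
      \<open>a = b\<close>.\<close>
    define e' where "e' = e / (2 * (b - a + 1))"
    have e': "e' > 0" using e ab by (simp add: e'_def)
    obtain \<delta> where \<delta>: "\<delta> > 0" and ac\<delta>: "\<And>(n::nat) x y.
        (\<forall>i<n. a \<le> x i \<and> x i \<le> y i \<and> y i \<le> b) \<and>
        (\<forall>i<n. \<forall>j<n. i \<noteq> j \<longrightarrow> y i \<le> x j \<or> y j \<le> x i) \<and>
        (\<Sum>i<n. y i - x i) < \<delta>
        \<Longrightarrow> (\<Sum>i<n. \<bar>g (y i) - g (x i)\<bar>) < e / 2"
      using ac[unfolded abs_cont_on_def, rule_format, of "e/2"] e by auto
    obtain U where U: "open U" "N \<subseteq> U" "U \<in> lmeasurable" "measure lebesgue U < \<delta>"
    proof -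
      obtain U where U: "open U" "N \<subseteq> U" "U - N \<in> lmeasurable" "emeasure lebesgue (U - N) < ennreal \<delta>"
        using sets_lebesgue_outer_open[OF negligible_imp_sets[OF N] \<delta>] by metis
      have eq: "(U - N) \<union> N = U" using U(2) by auto
      have Nm: "N \<in> lmeasurable" "measure lebesgue N = 0"
        using N negligible_imp_measurable negligible_imp_measure0 by auto
      have "U \<in> lmeasurable" using fmeasurable.Un[OF U(3) Nm(1)] unfolding eq .
      moreover have "measure lebesgue (U - N) < \<delta>"
        using U(3,4) \<delta> by (simp add: emeasure_eq_measure2 ennreal_less_iff)
      then have "measure lebesgue U < \<delta>"
        using measure_Un_le[OF fmeasurableD[OF U(3)] fmeasurableD[OF Nm(1)]] Nm(2) unfolding eq by linarith
      ultimately show thesis using that[OF U(1,2)] by blast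
    qed
    have "\<exists>d>0. \<forall>y\<in>{a..b}. \<bar>y - t\<bar> < d \<longrightarrow> \<bar>g y - g t - h t * (y - t)\<bar> \<le> e' * \<bar>y - t\<bar>"
      if t: "t \<in> {a..b} - N" for t
    proof -
      have "(g has_derivative (\<lambda>z. h t * z)) (at t within {a..b})"
        using der[OF t] by (simp add: has_field_derivative_def)
      then show ?thesis
        unfolding has_derivative_within_alt using e' by (auto simp: real_norm_def)
    qed
    then obtain d where d: "\<And>t. t \<in> {a..b} - N \<Longrightarrow> d t > 0"
       "\<And>t y. t \<in> {a..b} - N \<Longrightarrow> y\<in>{a..b} \<Longrightarrow> \<bar>y - t\<bar> < d t \<Longrightarrow>
           \<bar>g y - g t - h t * (y - t)\<bar> \<le> e' * \<bar>y - t\<bar>"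
      by metis
    define \<gamma> where "\<gamma> t = (if t \<in> N then U else if t \<in> {a..b} then ball t (d t) else ball t 1)" for t
    have "gauge \<gamma>" unfolding gauge_def \<gamma>_def using U d by auto
    moreover have "norm ((\<Sum>(x,K)\<in>p. measure lborel K *\<^sub>R k x) - (g b - g a)) < e"
      if p: "p tagged_division_of {a..b}" and fine: "\<gamma> fine p" for p
    proof -
      have pp: "p tagged_partial_division_of {a..b}" using p by (auto simp: tagged_division_of_def)
      note pD = tagged_partial_division_ofD[OF pp]
      define pN where "pN = {(x,K)\<in>p. x \<in> N}"
      have sub: "pN \<subseteq> p" by (auto simp: pN_def)
      have pNp: "pN tagged_partial_division_of {a..b}"
        using tagged_partial_division_subset[OF pp sub] .
      have K: "\<exists>c d. K = {c..d} \<and> c \<le> x \<and> x \<le> d \<and> a \<le> c \<and> d \<le> b" if xK: "(x,K) \<in> p" for x K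
      proof -
        obtain c d where cd: "K = cbox c d" using pD(4)[OF xK] by blast
        moreover have "x \<in> K" "K \<subseteq> {a..b}" using pD(2,3)[OF xK] by auto
        ultimately show ?thesis by (intro exI[of _ c] exI[of _ d]) auto
      qed
      have bad: "(\<Sum>(x,K)\<in>pN. \<bar>g (Sup K) - g (Inf K)\<bar>) < e/2"
      proof -
        obtain n :: nat and x y :: "nat \<Rightarrow> real" where xy:
          "\<forall>i<n. a \<le> x i \<and> x i \<le> y i \<and> y i \<le> b"
          "\<forall>i<n. \<forall>j<n. i \<noteq> j \<longrightarrow> y i \<le> x j \<or> y j \<le> x i"
          "\<forall>i<n. \<exists>t. (t, {x i..y i}) \<in> pN"
          "\<forall>F :: real \<Rightarrow> real \<Rightarrow> real. (\<forall>c. F c c = 0) \<longrightarrow>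
              (\<Sum>(t,K)\<in>pN. F (Inf K) (Sup K)) = (\<Sum>i<n. F (x i) (y i))"
          by (rule tagged_partial_division_enumerate[OF pNp])
        have subU: "{x i..y i} \<subseteq> U" if i: "i < n" for i
        proof -
          obtain t where t: "(t, {x i..y i}) \<in> p" "t \<in> N" using xy(3) i by (auto simp: pN_def)
          then show ?thesis using fineD[OF fine t(1)] by (simp add: \<gamma>_def)
        qed
        have Ui: "indicat_real U integrable_on {a..b}"
        proof (rule integrable_on_subinterval[of _ UNIV])
          show "indicat_real U integrable_on UNIV" using U(3) measurable_integrable by blast
        qed simp
        have "(\<Sum>i<n. y i - x i) = (\<Sum>i<n. integral {x i..y i} (indicat_real U))"
        proof (rule sum.cong)
          fix i assume "i \<in> {..<n}"
          then have i: "i < n" by simp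
          have "integral {x i..y i} (indicat_real U) = integral {x i..y i} (\<lambda>_. 1)"
            by (rule integral_cong) (use subU[OF i] in \<open>auto simp: indicator_def\<close>)
          then show "y i - x i = integral {x i..y i} (indicat_real U)" using xy(1) i by simp
        qed simp
        also have "\<dots> \<le> integral {a..b} (indicat_real U)"
          using xy(1,2) by (intro sum_integral_nonoverlapping_le[OF Ui]) auto
        also have "\<dots> \<le> integral UNIV (indicat_real U)"
          by (rule integral_subset_le) (use Ui U(3) measurable_integrable in auto)
        also have "\<dots> = measure lebesgue U" using lmeasure_integral_UNIV[OF U(3)] by simp
        finally have "(\<Sum>i<n. y i - x i) < \<delta>" using U(4) by linarith
        then have "(\<Sum>i<n. \<bar>g (y i) - g (x i)\<bar>) < e/2"
          using xy(1,2) by (intro ac\<delta>) auto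
        then show ?thesis using xy(4)[rule_format, of "\<lambda>c d. \<bar>g d - g c\<bar>"] by simp
      qed
      have good: "\<bar>measure lborel K *\<^sub>R k x - (g (Sup K) - g (Inf K))\<bar> \<le> e' * measure lborel K"
        if xK: "(x,K) \<in> p - pN" for x K
      proof -
        obtain c z where cz: "K = {c..z}" "c \<le> x" "x \<le> z" "a \<le> c" "z \<le> b" using K xK by blast
        have x: "x \<in> {a..b} - N" using cz xK by (auto simp: pN_def)
        have "(x,K) \<in> p" using xK by blast
        from fineD[OF fine this] have "K \<subseteq> ball x (d x)" using x by (simp add: \<gamma>_def)
        moreover have "c \<in> K" "z \<in> K" using cz by auto
        ultimately have "c \<in> ball x (d x)" "z \<in> ball x (d x)" by blast+
        then have cd: "\<bar>c - x\<bar> < d x" "\<bar>z - x\<bar> < d x" by (auto simp: dist_real_def)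
        have "c \<in> {a..b}" "z \<in> {a..b}" using cz by auto
        note d(2)[OF x this(1) cd(1)] d(2)[OF x this(2) cd(2)]
        moreover have "(z - c) * h x - (g z - g c) = (g c - g x - h x * (c - x)) - (g z - g x - h x * (z - x))"
          by (simp add: algebra_simps)
        ultimately have "\<bar>(z - c) * h x - (g z - g c)\<bar> \<le> e' * \<bar>c - x\<bar> + e' * \<bar>z - x\<bar>"
          using abs_triangle_ineq4[of "g c - g x - h x * (c - x)" "g z - g x - h x * (z - x)"] by linarith
        also have "\<dots> = e' * (\<bar>c - x\<bar> + \<bar>z - x\<bar>)" by (simp add: distrib_left)
        also have "\<bar>c - x\<bar> + \<bar>z - x\<bar> = z - c" using cz by linarith
        finally show ?thesis using cz(1,2,3) x by (simp add: k_def)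
      qed
      have "(\<Sum>(x,K)\<in>p. measure lborel K *\<^sub>R k x) - (g b - g a)
         = (\<Sum>(x,K)\<in>p. measure lborel K *\<^sub>R k x - (g (Sup K) - g (Inf K)))"
        using additive_tagged_division_1[OF ab p, of g] by (simp add: sum_subtractf case_prod_beta)
      also have "\<dots> = (\<Sum>(x,K)\<in>p - pN. measure lborel K *\<^sub>R k x - (g (Sup K) - g (Inf K)))
          + (\<Sum>(x,K)\<in>pN. measure lborel K *\<^sub>R k x - (g (Sup K) - g (Inf K)))"
        by (rule sum.subset_diff[OF sub pD(1)])
      also have "\<bar>\<dots>\<bar> \<le> (\<Sum>(x,K)\<in>p - pN. e' * measure lborel K) + (\<Sum>(x,K)\<in>pN. \<bar>g (Sup K) - g (Inf K)\<bar>)"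
      proof (intro order_trans[OF abs_triangle_ineq] add_mono order_trans[OF sum_abs] sum_mono)
        fix i assume "i \<in> p - pN"
        then show "\<bar>case i of (x, K) \<Rightarrow> measure lborel K *\<^sub>R k x - (g (Sup K) - g (Inf K))\<bar>
           \<le> (case i of (x, K) \<Rightarrow> e' * measure lborel K)"
          using good[of "fst i" "snd i"] by (simp add: case_prod_beta)
      next
        fix i assume "i \<in> pN"
        then show "\<bar>case i of (x, K) \<Rightarrow> measure lborel K *\<^sub>R k x - (g (Sup K) - g (Inf K))\<bar>
           \<le> (case i of (x, K) \<Rightarrow> \<bar>g (Sup K) - g (Inf K)\<bar>)"
          by (auto simp: pN_def k_def)
      qed
      finally have main: "\<bar>(\<Sum>(x,K)\<in>p. measure lborel K *\<^sub>R k x) - (g b - g a)\<bar>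
          \<le> (\<Sum>(x,K)\<in>p - pN. e' * measure lborel K) + (\<Sum>(x,K)\<in>pN. \<bar>g (Sup K) - g (Inf K)\<bar>)" .
      have "(\<Sum>(x,K)\<in>p - pN. e' * measure lborel K) \<le> (\<Sum>(x,K)\<in>p. e' * measure lborel K)"
        by (rule sum_mono2) (use pD(1) e' in auto)
      also have "\<dots> = (\<Sum>(x,K)\<in>p. e' * (Sup K - Inf K))"
      proof (rule sum.cong)
        fix i assume "i \<in> p"
        then show "(case i of (x, K) \<Rightarrow> e' * measure lborel K) = (case i of (x, K) \<Rightarrow> e' * (Sup K - Inf K))"
          using K[of "fst i" "snd i"] by (auto simp: case_prod_beta)
      qed simp
      also have "\<dots> = e' * (\<Sum>(x,K)\<in>p. Sup K - Inf K)"
        by (simp add: sum_distrib_left case_prod_beta)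
      also have "\<dots> = e' * (b - a)" using additive_tagged_division_1[OF ab p, of "\<lambda>x. x"] by simp
      also have "\<dots> \<le> e' * (b - a + 1)" using e' by (intro mult_left_mono) auto
      also have "\<dots> = e / 2" using ab by (simp add: e'_def field_simps)
      finally show ?thesis using bad main unfolding real_norm_def by linarith
    qed
    ultimately show "\<exists>\<gamma>. gauge \<gamma> \<and> (\<forall>\<D>. \<D> tagged_division_of {a..b} \<and> \<gamma> fine \<D> \<longrightarrow>
        norm ((\<Sum>(x,K)\<in>\<D>. measure lborel K *\<^sub>R k x) - (g b - g a)) < e)"
      by (intro exI[of _ \<gamma>] conjI allI impI) (simp_all only:)
  qed
  then show ?thesis
    by (rule has_integral_spike[OF N, rotated]) (auto simp: k_def)
qed

section \<open>The integral form of the equation\<close>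

text \<open>\<psi> stands for the inverse of \<phi>. The bounds on \<open>a\<close> are required at
  every point; for a weight bounded only almost everywhere this is arranged by a change on a null
  set.\<close>

locale wave_equation =
  fixes \<psi> a e :: "real \<Rightarrow> real" and T M :: real
  assumes T: "T > 0"
    and psi_cont: "continuous_on UNIV \<psi>" and psi_mono: "strict_mono \<psi>" and psi0: "\<psi> 0 = 0"
    and a_meas: "a \<in> borel_measurable (lebesgue_on {0..T})"
    and a_nonneg: "0 \<le> a t" and a_le: "a t \<le> M"
    and e_int: "e absolutely_integrable_on {0..T}"
    and e_mean: "integral {0..T} e = 0"
    and a_pos: "integral {0..T} a > 0"
begin

text \<open>\<open>W\<close> is the first integral \<open>\<phi> (u') + F u\<close>; in \<open>sol\<close> the last equation says that it is periodic.\<close>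

definition W :: "(real \<Rightarrow> real) \<Rightarrow> real \<Rightarrow> real \<Rightarrow> (real \<Rightarrow> real) \<Rightarrow> real \<Rightarrow> real" where
  "W q c s v t = c + s * t + integral {0..t} e - integral {0..t} (\<lambda>r. a r * q (v r))"

definition V :: "(real \<Rightarrow> real) \<Rightarrow> (real \<Rightarrow> real) \<Rightarrow> real \<Rightarrow> real \<Rightarrow> (real \<Rightarrow> real) \<Rightarrow> real \<Rightarrow> real" where
  "V F q c s v t = integral {0..t} (\<lambda>r. \<psi> (W q c s v r - F (v r)))"

definition sol :: "(real \<Rightarrow> real) \<Rightarrow> (real \<Rightarrow> real) \<Rightarrow> real \<Rightarrow> real \<Rightarrow> (real \<Rightarrow> real) \<Rightarrow> bool" where
  "sol F q s c u \<longleftrightarrow> continuous_on {0..T} u \<and> (\<forall>t\<in>{0..T}. u t = u 0 + V F q c s u t) \<and>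
     u T = u 0 \<and> W q c s u T = c"

definition E :: real where "E = integral {0..T} (\<lambda>t. \<bar>e t\<bar>)"

lemma M_nonneg: "0 \<le> M"
  using a_nonneg[of 0] a_le[of 0] by linarith

lemma aq_abs_integrable:
  fixes q v :: "real \<Rightarrow> real"
  assumes "continuous_on UNIV q" "continuous_on {0..T} v"
  shows "(\<lambda>r. a r * q (v r)) absolutely_integrable_on {0..T}"
proof (rule absolutely_integrable_bounded_measurable_product_real[OF a_meas])
  show "bounded (a ` {0..T})"
    unfolding bounded_iff using a_nonneg a_le by (intro exI[of _ M]) auto
  have "continuous_on {0..T} (\<lambda>r. q (v r))"
    using assms by (intro continuous_on_compose2[OF assms(1,2)]) auto
  then show "(\<lambda>r. q (v r)) absolutely_integrable_on {0..T}"
    by (rule absolutely_integrable_continuous_real)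
qed simp

lemma aq_integrable:
  fixes q v :: "real \<Rightarrow> real"
  assumes "continuous_on UNIV q" "continuous_on {0..T} v"
  shows "(\<lambda>r. a r * q (v r)) integrable_on {0..T}"
  using aq_abs_integrable[OF assms] set_lebesgue_integral_eq_integral(1) by blast

lemma e_integrable: "e integrable_on {0..T}"
  using e_int set_lebesgue_integral_eq_integral(1) by blast

lemma abs_e_integrable: "(\<lambda>t. \<bar>e t\<bar>) integrable_on {0..T}"
  using e_int unfolding absolutely_integrable_on_def by simp

lemma a_integrable: "a integrable_on {0..T}"
  using aq_integrable[of "\<lambda>_. 1" "\<lambda>_. 0"] by simp

lemma integrable_initial:
  fixes g :: "real \<Rightarrow> real"
  assumes "g integrable_on {0..T}" "t \<le> T"
  shows "g integrable_on {0..t}"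
  using integrable_subinterval_real[OF assms(1)] assms(2) by auto

lemma W_cont:
  assumes "continuous_on UNIV q" "continuous_on {0..T} v"
  shows "continuous_on {0..T} (W q c s v)"
  unfolding W_def
  by (intro continuous_intros indefinite_integral_continuous_1 e_integrable aq_integrable assms)

lemma rhs_cont:
  assumes "continuous_on UNIV F" "continuous_on UNIV q" "continuous_on {0..T} v"
  shows "continuous_on {0..T} (\<lambda>r. \<psi> (W q c s v r - F (v r)))"
proof -
  have "continuous_on {0..T} (\<lambda>r. W q c s v r - F (v r))"
    by (intro continuous_intros W_cont assms continuous_on_compose2[OF assms(1,3)]) auto
  then show ?thesis by (rule continuous_on_compose2[OF psi_cont]) auto
qed

lemma V_deriv:
  assumes "continuous_on UNIV F" "continuous_on UNIV q" "continuous_on {0..T} v" "t \<in> {0..T}"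
  shows "(V F q c s v has_real_derivative \<psi> (W q c s v t - F (v t))) (at t within {0..T})"
  using integral_has_real_derivative[OF rhs_cont[OF assms(1-3)] assms(4)]
  by (simp add: V_def[abs_def])

lemma V_cont:
  assumes "continuous_on UNIV F" "continuous_on UNIV q" "continuous_on {0..T} v"
  shows "continuous_on {0..T} (V F q c s v)"
  by (rule DERIV_continuous_on) (rule V_deriv[OF assms])

lemma V_0 [simp]: "V F q c s v 0 = 0"
  by (simp add: V_def)

lemma abs_integral_aq_le:
  fixes q v :: "real \<Rightarrow> real"
  assumes q: "continuous_on UNIV q" "continuous_on {0..T} v" and Q: "\<And>z. \<bar>q z\<bar> \<le> Q" and t: "t \<in> {0..T}"
  shows "\<bar>integral {0..t} (\<lambda>r. a r * q (v r))\<bar> \<le> M * Q * T"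
proof -
  have Q0: "0 \<le> Q" using Q[of 0] by linarith
  have "norm (integral {0..t} (\<lambda>r. a r * q (v r))) \<le> integral {0..t} (\<lambda>r. M * Q)"
  proof (rule integral_norm_bound_integral)
    show "(\<lambda>r. a r * q (v r)) integrable_on {0..t}"
      using integrable_initial[OF aq_integrable[OF q]] t by auto
    show "norm (a r * q (v r)) \<le> M * Q" for r
      unfolding real_norm_def abs_mult using a_nonneg[of r] a_le[of r] Q[of "v r"] M_nonneg
      by (intro mult_mono) auto
  qed (rule integrable_const_ivl)
  also have "\<dots> = t * (M * Q)" using t by simp
  also have "\<dots> \<le> T * (M * Q)" using t Q0 M_nonneg by (intro mult_right_mono) auto
  finally show ?thesis by (simp add: mult_ac)
qed

lemma abs_integral_e_le:
  assumes t: "t \<in> {0..T}"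
  shows "\<bar>integral {0..t} e\<bar> \<le> E"
proof -
  have "norm (integral {0..t} e) \<le> integral {0..t} (\<lambda>t. \<bar>e t\<bar>)"
    by (rule integral_norm_bound_integral)
      (use integrable_initial[OF e_integrable] integrable_initial[OF abs_e_integrable] t in auto)
  also have "\<dots> \<le> E" unfolding E_def
    by (rule integral_subset_le)
      (use integrable_initial[OF abs_e_integrable] abs_e_integrable t in auto)
  finally show ?thesis by simp
qed

lemma W_bound:
  assumes q: "continuous_on UNIV q" "continuous_on {0..T} v" and Q: "\<And>z. \<bar>q z\<bar> \<le> Q" and t: "t \<in> {0..T}"
  shows "\<bar>W q c s v t - c\<bar> \<le> \<bar>s\<bar> * T + E + M * Q * T"
proof -
  have "\<bar>s * t\<bar> \<le> \<bar>s\<bar> * T" using t by (simp add: abs_mult mult_left_mono)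
  then show ?thesis
    unfolding W_def using abs_integral_aq_le[OF q Q t] abs_integral_e_le[OF t] by linarith
qed

section \<open>Continuous dependence of the two integrals on the data\<close>

lemma W_tendsto:
  assumes q: "continuous_on UNIV q" and Q: "\<And>z. \<bar>q z\<bar> \<le> Q"
    and v: "\<And>j. continuous_on {0..T} (v j)" "\<And>t. t \<in> {0..T} \<Longrightarrow> (\<lambda>j. v j t) \<longlonglongrightarrow> w t"
    and cs: "c \<longlonglongrightarrow> c'" "s \<longlonglongrightarrow> s'" and t: "t \<in> {0..T}"
  shows "(\<lambda>j. W q (c j) (s j) (v j) t) \<longlonglongrightarrow> W q c' s' w t"
proof -
  have "(\<lambda>j. integral {0..t} (\<lambda>r. a r * q (v j r))) \<longlonglongrightarrow> integral {0..t} (\<lambda>r. a r * q (w r))"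
  proof (rule dominated_convergence(2)[where h = "\<lambda>_. M * Q"])
    show "(\<lambda>r. a r * q (v j r)) integrable_on {0..t}" for j
      using integrable_initial[OF aq_integrable[OF q v(1)]] t by auto
    show "norm (a r * q (v j r)) \<le> M * Q" for r j
      unfolding real_norm_def abs_mult using a_nonneg[of r] a_le[of r] Q[of "v j r"] M_nonneg
      by (intro mult_mono) auto
    show "(\<lambda>j. a r * q (v j r)) \<longlonglongrightarrow> a r * q (w r)" if "r \<in> {0..t}" for r
    proof -
      have "(\<lambda>j. v j r) \<longlonglongrightarrow> w r" using that t v(2) by auto
      then have "(\<lambda>j. q (v j r)) \<longlonglongrightarrow> q (w r)"
        using continuous_on_tendsto_compose[OF q] by auto
      then show ?thesis by (intro tendsto_intros)
    qed
  qed (rule integrable_const_ivl)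
  then show ?thesis unfolding W_def by (intro tendsto_intros cs)
qed

lemma psi_abs_le:
  assumes "\<bar>z\<bar> \<le> K"
  shows "\<bar>\<psi> z\<bar> \<le> max (\<psi> K) (- \<psi> (- K))"
proof -
  have "\<psi> z \<le> \<psi> K" "\<psi> (- K) \<le> \<psi> z"
    using psi_mono assms strict_mono_less_eq by (metis abs_le_iff, metis abs_le_iff minus_le_iff)
  then show ?thesis by linarith
qed

text \<open>Pointwise convergence of \<open>v\<close> already gives an estimate uniform in
  \<open>t\<close>: the difference at \<open>t\<close> is at most the integral over the whole period
  of the absolute difference of the integrands, and this tends to 0 by dominated convergence.
  \<open>B\<close> and \<open>Q\<close> supply the dominating constant.\<close>

lemma V_tendsto:
  assumes F: "continuous_on UNIV F" and B: "\<And>z. \<bar>F z\<bar> \<le> B"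
    and q: "continuous_on UNIV q" and Q: "\<And>z. \<bar>q z\<bar> \<le> Q"
    and v: "\<And>j. continuous_on {0..T} (v j)" "\<And>t. t \<in> {0..T} \<Longrightarrow> (\<lambda>j. v j t) \<longlonglongrightarrow> w t"
    and w: "continuous_on {0..T} w"
    and cs: "c \<longlonglongrightarrow> c'" "s \<longlonglongrightarrow> s'"
  obtains d where "d \<longlonglongrightarrow> 0" "\<forall>j. \<forall>t\<in>{0..T}. \<bar>V F q (c j) (s j) (v j) t - V F q c' s' w t\<bar> \<le> d j"
proof -
  let ?g = "\<lambda>j r. \<psi> (W q (c j) (s j) (v j) r - F (v j r))"
  let ?h = "\<lambda>r. \<psi> (W q c' s' w r - F (w r))"
  define d where "d j = integral {0..T} (\<lambda>r. \<bar>?g j r - ?h r\<bar>)" for j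
  have gc: "continuous_on {0..T} (?g j)" for j by (rule rhs_cont[OF F q v(1)])
  have hc: "continuous_on {0..T} ?h" by (rule rhs_cont[OF F q w])
  have dc: "continuous_on {0..T} (\<lambda>r. \<bar>?g j r - ?h r\<bar>)" for j
    by (intro continuous_intros gc hc)
  obtain C where C: "\<And>j. \<bar>c j\<bar> \<le> C"
    using convergent_imp_Bseq[of c] cs(1) by (auto simp: convergent_def Bseq_def)
  obtain S where S: "\<And>j. \<bar>s j\<bar> \<le> S"
    using convergent_imp_Bseq[of s] cs(2) by (auto simp: convergent_def Bseq_def)
  have C': "\<bar>c'\<bar> \<le> C" using Lim_bounded[OF tendsto_rabs[OF cs(1)]] C by blast
  have S': "\<bar>s'\<bar> \<le> S" using Lim_bounded[OF tendsto_rabs[OF cs(2)]] S by blast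
  define K where "K = C + S * T + E + M * Q * T + B"
  define L where "L = max (\<psi> K) (- \<psi> (- K))"
  have arg: "\<bar>W q x y z r - F (z r)\<bar> \<le> K" if "continuous_on {0..T} z" "\<bar>x\<bar> \<le> C" "\<bar>y\<bar> \<le> S" "r \<in> {0..T}" for x y z r
  proof -
    have "\<bar>y\<bar> * T \<le> S * T" using that T by (intro mult_right_mono) auto
    then show ?thesis using W_bound[OF q that(1) Q that(4), of x y] B[of "z r"] that(2) unfolding K_def by linarith
  qed
  have gL: "\<bar>?g j r\<bar> \<le> L" if "r \<in> {0..T}" for j r
    unfolding L_def by (rule psi_abs_le, rule arg) (use v C S that in auto)
  have hL: "\<bar>?h r\<bar> \<le> L" if "r \<in> {0..T}" for r
    unfolding L_def by (rule psi_abs_le, rule arg) (use w C' S' that in auto)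
  have "d \<longlonglongrightarrow> integral {0..T} (\<lambda>r. 0)"
    unfolding d_def
  proof (rule dominated_convergence(2)[where h = "\<lambda>_. 2 * L"])
    show "(\<lambda>r. \<bar>?g j r - ?h r\<bar>) integrable_on {0..T}" for j
      by (rule integrable_continuous_real[OF dc])
    show "norm \<bar>?g j r - ?h r\<bar> \<le> 2 * L" if "r \<in> {0..T}" for j r
      using gL[OF that, of j] hL[OF that] unfolding real_norm_def by linarith
    show "(\<lambda>j. \<bar>?g j r - ?h r\<bar>) \<longlonglongrightarrow> 0" if r: "r \<in> {0..T}" for r
    proof -
      have "(\<lambda>j. F (v j r)) \<longlonglongrightarrow> F (w r)"
        using continuous_on_tendsto_compose[OF F v(2)[OF r]] by auto
      then have "(\<lambda>j. W q (c j) (s j) (v j) r - F (v j r)) \<longlonglongrightarrow> W q c' s' w r - F (w r)"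
        by (intro tendsto_diff W_tendsto[OF q Q v cs r])
      then have "(\<lambda>j. ?g j r) \<longlonglongrightarrow> ?h r"
        using continuous_on_tendsto_compose[OF psi_cont] by auto
      then show ?thesis by (intro tendsto_rabs_zero) (simp add: LIM_zero_iff)
    qed
  qed (rule integrable_const_ivl)
  then have "d \<longlonglongrightarrow> 0" by simp
  moreover have "\<bar>V F q (c j) (s j) (v j) t - V F q c' s' w t\<bar> \<le> d j" if t: "t \<in> {0..T}" for j t
  proof -
    have sub: "{0..t} \<subseteq> {0..T}" using t by auto
    have gi: "?g j integrable_on {0..t}" by (rule integrable_continuous_real[OF continuous_on_subset[OF gc sub]])
    have hi: "?h integrable_on {0..t}" by (rule integrable_continuous_real[OF continuous_on_subset[OF hc sub]])
    have di: "(\<lambda>r. \<bar>?g j r - ?h r\<bar>) integrable_on {0..t}" by (rule integrable_continuous_real[OF continuous_on_subset[OF dc sub]])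
    have eq: "V F q (c j) (s j) (v j) t - V F q c' s' w t = integral {0..t} (\<lambda>r. ?g j r - ?h r)"
      unfolding V_def by (rule Henstock_Kurzweil_Integration.integral_diff[symmetric, OF gi hi])
    have "norm (integral {0..t} (\<lambda>r. ?g j r - ?h r)) \<le> integral {0..t} (\<lambda>r. \<bar>?g j r - ?h r\<bar>)"
      by (rule integral_norm_bound_integral[OF integrable_diff[OF gi hi] di]) simp
    then have 1: "\<bar>V F q (c j) (s j) (v j) t - V F q c' s' w t\<bar> \<le> integral {0..t} (\<lambda>r. \<bar>?g j r - ?h r\<bar>)"
      unfolding eq real_norm_def .
    have 2: "integral {0..t} (\<lambda>r. \<bar>?g j r - ?h r\<bar>) \<le> d j"
      unfolding d_def by (rule integral_subset_le[OF sub di integrable_continuous_real[OF dc]]) auto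
    show ?thesis using 1 2 by linarith
  qed
  ultimately show thesis by (intro that[of d]) auto
qed

lemma V_lipschitz:
  assumes F: "continuous_on UNIV F" and q: "continuous_on UNIV q" and v: "continuous_on {0..T} v"
    and L: "\<And>r. r \<in> {0..T} \<Longrightarrow> \<bar>\<psi> (W q c s v r - F (v r))\<bar> \<le> L"
    and "t \<in> {0..T}" "t' \<in> {0..T}"
  shows "\<bar>V F q c s v t - V F q c s v t'\<bar> \<le> L * \<bar>t - t'\<bar>"
proof -
  have "norm (V F q c s v t - V F q c s v t') \<le> L * norm (t - t')"
    by (rule field_differentiable_bound[of "{0..T}"]) (use V_deriv[OF F q v] L assms(5,6) in auto)
  then show ?thesis by simp
qed

end

section \<open>The delayed equation\<close>

context wave_equation
begin

section \<open>The maximum over a period\<close>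

definition mx :: "(real \<Rightarrow> real) \<Rightarrow> real" where
  "mx g = Sup (g ` {0..T})"

lemma mx_upper:
  assumes "continuous_on {0..T} g" "t \<in> {0..T}"
  shows "g t \<le> mx g"
proof -
  have "bdd_above (g ` {0..T})"
    using compact_continuous_image[OF assms(1)] by (intro bounded_imp_bdd_above compact_imp_bounded) auto
  then show ?thesis unfolding mx_def by (intro cSup_upper) (use assms in auto)
qed

lemma mx_attained:
  assumes "continuous_on {0..T} g"
  obtains t where "t \<in> {0..T}" "mx g = g t"
proof -
  obtain t where t: "t \<in> {0..T}" "\<forall>y\<in>{0..T}. g y \<le> g t"
    using continuous_attains_sup[of "{0..T}" g] assms T by auto
  have "mx g \<le> g t" unfolding mx_def by (rule cSup_least) (use t T in auto)
  then show thesis using that[OF t(1)] mx_upper[OF assms t(1)] by linarith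
qed

lemma mx_diff_le:
  assumes "continuous_on {0..T} g" "continuous_on {0..T} h"
    and "\<And>t. t \<in> {0..T} \<Longrightarrow> \<bar>g t - h t\<bar> \<le> d"
  shows "\<bar>mx g - mx h\<bar> \<le> d"
proof -
  obtain t where t: "t \<in> {0..T}" "mx g = g t" using mx_attained[OF assms(1)] .
  obtain r where r: "r \<in> {0..T}" "mx h = h r" using mx_attained[OF assms(2)] .
  show ?thesis
    using mx_upper[OF assms(1) r(1)] mx_upper[OF assms(2) t(1)] assms(3)[OF t(1)] assms(3)[OF r(1)] t r
    by linarith
qed

text \<open>For \<open>k * \<delta> \<ge> T\<close> the iteration is stationary on \<open>[0, T]\<close> and solves the equation in which \<open>u r\<close> is
  replaced by \<open>u (r - \<delta>)\<close> on the right-hand side.\<close>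

primrec delayed :: "(real \<Rightarrow> real) \<Rightarrow> (real \<Rightarrow> real) \<Rightarrow> real \<Rightarrow> real \<Rightarrow> real \<Rightarrow> real \<Rightarrow> nat \<Rightarrow> real \<Rightarrow> real" where
  "delayed F q \<delta> p c s 0 = (\<lambda>t. p)"
| "delayed F q \<delta> p c s (Suc k) = (\<lambda>t. p + V F q c s (\<lambda>r. delayed F q \<delta> p c s k (max 0 (r - \<delta>))) t)"

lemma continuous_on_delay:
  assumes "continuous_on {0..T} g" "\<delta> \<ge> 0"
  shows "continuous_on {0..T} (\<lambda>r. g (max 0 (r - \<delta>)))"
  by (rule continuous_on_compose2[OF assms(1)]) (use assms(2) in \<open>auto intro!: continuous_intros\<close>)

lemma delayed_cont:
  assumes F: "continuous_on UNIV F" and q: "continuous_on UNIV q" and \<delta>: "\<delta> \<ge> 0"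
  shows "continuous_on {0..T} (delayed F q \<delta> p c s k)"
proof (induction k)
  case (Suc k)
  show ?case unfolding delayed.simps
    by (intro continuous_intros V_cont F q continuous_on_delay Suc \<delta>)
qed simp

text \<open>This is what the delay buys: each iterate is an explicit integral of the previous one,
  so continuity in \<open>(p, c, s)\<close> follows by induction and involves no uniqueness of
  solutions.\<close>

lemma delayed_tendsto:
  assumes F: "continuous_on UNIV F" and B: "\<And>z. \<bar>F z\<bar> \<le> B"
    and q: "continuous_on UNIV q" and Q: "\<And>z. \<bar>q z\<bar> \<le> Q" and \<delta>: "\<delta> \<ge> 0"
    and pcs: "p \<longlonglongrightarrow> p'" "c \<longlonglongrightarrow> c'" "s \<longlonglongrightarrow> s'"
  shows "\<exists>d. d \<longlonglongrightarrow> 0 \<and> (\<forall>j. \<forall>t\<in>{0..T}.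
     \<bar>delayed F q \<delta> (p j) (c j) (s j) k t - delayed F q \<delta> p' c' s' k t\<bar> \<le> d j)"
proof (induction k)
  case 0
  have "(\<lambda>j. \<bar>p j - p'\<bar>) \<longlonglongrightarrow> 0" using pcs(1) by (intro tendsto_rabs_zero) (simp add: LIM_zero_iff)
  then show ?case by (intro exI[of _ "\<lambda>j. \<bar>p j - p'\<bar>"]) auto
next
  case (Suc k)
  let ?u = "\<lambda>j. delayed F q \<delta> (p j) (c j) (s j) k" and ?w = "delayed F q \<delta> p' c' s' k"
  obtain d0 where d0: "d0 \<longlonglongrightarrow> 0" "\<And>j t. t \<in> {0..T} \<Longrightarrow> \<bar>?u j t - ?w t\<bar> \<le> d0 j"
    using Suc by blast
  have lim: "(\<lambda>j. ?u j t) \<longlonglongrightarrow> ?w t" if "t \<in> {0..T}" for t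
    by (rule LIM_zero_cancel, rule Lim_null_comparison[OF _ d0(1)]) (use d0(2)[OF that] in auto)
  obtain d where d: "d \<longlonglongrightarrow> 0" "\<forall>j. \<forall>t\<in>{0..T}.
      \<bar>V F q (c j) (s j) (\<lambda>r. ?u j (max 0 (r - \<delta>))) t - V F q c' s' (\<lambda>r. ?w (max 0 (r - \<delta>))) t\<bar> \<le> d j"
  proof (rule V_tendsto[OF F B q Q _ _ _ pcs(2,3)])
    show "continuous_on {0..T} (\<lambda>r. ?u j (max 0 (r - \<delta>)))" for j
      by (intro continuous_on_delay delayed_cont F q \<delta>)
    show "continuous_on {0..T} (\<lambda>r. ?w (max 0 (r - \<delta>)))"
      by (intro continuous_on_delay delayed_cont F q \<delta>)
    show "(\<lambda>j. ?u j (max 0 (t - \<delta>))) \<longlonglongrightarrow> ?w (max 0 (t - \<delta>))" if "t \<in> {0..T}" for t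
      by (rule lim) (use that \<delta> in auto)
  qed (rule that)
  show ?case
  proof (intro exI conjI allI ballI)
    have "(\<lambda>j. \<bar>p j - p'\<bar>) \<longlonglongrightarrow> 0" using pcs(1) by (intro tendsto_rabs_zero) (simp add: LIM_zero_iff)
    then show "(\<lambda>j. \<bar>p j - p'\<bar> + d j) \<longlonglongrightarrow> 0" using tendsto_add[OF _ d(1)] by fastforce
    fix j t assume t: "t \<in> {0..T}"
    show "\<bar>delayed F q \<delta> (p j) (c j) (s j) (Suc k) t - delayed F q \<delta> p' c' s' (Suc k) t\<bar> \<le> \<bar>p j - p'\<bar> + d j"
      unfolding delayed.simps using d(2)[rule_format, OF t, of j] by linarith
  qed
qed

lemma V_cong:
  assumes "\<And>r. r \<in> {0..t} \<Longrightarrow> v r = w r"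
  shows "V F q c s v t = V F q c s w t"
  unfolding V_def
proof (rule Henstock_Kurzweil_Integration.integral_cong)
  fix r assume r: "r \<in> {0..t}"
  have "integral {0..r} (\<lambda>x. a x * q (v x)) = integral {0..r} (\<lambda>x. a x * q (w x))"
    by (rule Henstock_Kurzweil_Integration.integral_cong) (use r assms in auto)
  then have "W q c s v r = W q c s w r" unfolding W_def by simp
  then show "\<psi> (W q c s v r - F (v r)) = \<psi> (W q c s w r - F (w r))" using assms[OF r] by simp
qed

text \<open>An iterate at time \<open>t\<close> uses its predecessor only up to
  \<open>t - \<delta>\<close>, so every iteration settles one more interval of length
  \<delta>.\<close>

lemma delayed_stable:
  assumes \<delta>: "\<delta> \<ge> 0" and "t \<ge> 0" "t \<le> real k * \<delta>"
  shows "delayed F q \<delta> p c s (Suc k) t = delayed F q \<delta> p c s k t"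
  using assms(2,3)
proof (induction k arbitrary: t)
  case 0
  then have "t = 0" by simp
  then show ?case by simp
next
  case (Suc k)
  have step: "delayed F q \<delta> p c s (Suc j) r = p + V F q c s (\<lambda>r. delayed F q \<delta> p c s j (max 0 (r - \<delta>))) r" for j r
    by simp
  have "V F q c s (\<lambda>r. delayed F q \<delta> p c s (Suc k) (max 0 (r - \<delta>))) t
      = V F q c s (\<lambda>r. delayed F q \<delta> p c s k (max 0 (r - \<delta>))) t"
  proof (rule V_cong)
    fix r assume "r \<in> {0..t}"
    then have "r - \<delta> \<le> real k * \<delta>" using Suc.prems by (simp add: algebra_simps)
    moreover have "0 \<le> real k * \<delta>" using \<delta> by simp
    ultimately show "delayed F q \<delta> p c s (Suc k) (max 0 (r - \<delta>)) = delayed F q \<delta> p c s k (max 0 (r - \<delta>))"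
      by (intro Suc.IH) auto
  qed
  then show ?case using step[of "Suc k" t] step[of k t] by metis
qed

text \<open>Brouwer's theorem is applied to \<open>(p, c, s)\<close>. At a fixed point the clamp on \<open>c\<close> is inactive, since at
  either end the right-hand side has constant sign; the clamp on \<open>sg * mx (u - u0)\<close> stays in the
  conclusion.\<close>

lemma approximate_solution:
  assumes F: "continuous_on UNIV F" and B: "\<And>z. \<bar>F z\<bar> \<le> B"
    and q: "continuous_on UNIV q" and Q: "\<And>z. \<bar>q z\<bar> \<le> Q"
    and X: "X \<ge> 0" and sg: "sg \<in> {1,-1}" and u0: "continuous_on {0..T} u0"
  obtains R L where "\<forall>n::nat. n > 0 \<longrightarrow> (\<exists>p c s u.
      \<bar>p\<bar> \<le> R \<and> \<bar>c\<bar> \<le> R \<and> \<bar>s\<bar> \<le> R \<and> continuous_on {0..T} u \<and>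
      (\<forall>t\<in>{0..T}. \<forall>t'\<in>{0..T}. \<bar>u t - u t'\<bar> \<le> L * \<bar>t - t'\<bar>) \<and>
      (\<forall>t\<in>{0..T}. u t = p + V F q c s (\<lambda>r. u (max 0 (r - T / real n))) t) \<and>
      u T = p \<and> W q c s (\<lambda>r. u (max 0 (r - T / real n))) T = c \<and>
      sg * mx (\<lambda>t. u t - u0 t) = max 0 (min X (sg * mx (\<lambda>t. u t - u0 t) - (s - s0))))"
proof -
  \<comment> \<open>Bounds all values of \<open>G3\<close>, a mean of \<open>a\<close> times values
    of \<open>q\<close>.\<close>
  define S where "S = M * Q"
  \<comment> \<open>\<open>C - 1\<close> bounds the drift of \<open>W\<close> away from
    \<open>c\<close> together with \<open>F\<close>, so at \<open>c = C\<close> and at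
    \<open>c = - C\<close> the argument of \<psi> has the sign of \<open>c\<close>.\<close>
  define C where "C = S * T + E + M * Q * T + B + 1"
  \<comment> \<open>For \<open>c\<close> within \<open>C\<close> the argument of \<psi> is at most
    \<open>2 * C\<close> in absolute value; \<open>L\<close> bounds the resulting slopes.\<close>
  define L where "L = max (\<psi> (2 * C)) (- \<psi> (- (2 * C)))"
  obtain B0 where B0: "\<And>t. t \<in> {0..T} \<Longrightarrow> \<bar>u0 t\<bar> \<le> B0"
  proof -
    have "bounded (u0 ` {0..T})" using compact_continuous_image[OF u0] by (intro compact_imp_bounded) auto
    then obtain b where "\<forall>y\<in>u0 ` {0..T}. norm y \<le> b" unfolding bounded_iff by blast
    then show thesis by (intro that[of b]) simp
  qed
  \<comment> \<open>The clamp contributes at most \<open>X\<close>, and the maximum of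
    \<open>u - u0\<close> differs from the initial value \<open>p\<close> by at most
    \<open>L * T + B0\<close>; hence \<open>G1\<close> stays within \<open>P\<close>.\<close>
  define P where "P = X + L * T + B0"
  have Q0: "0 \<le> Q" and Bp: "0 \<le> B" using Q[of 0] B[of 0] by linarith+
  have S0: "0 \<le> S" using Q0 M_nonneg by (simp add: S_def)
  have E0: "0 \<le> E" unfolding E_def by (rule integral_nonneg[OF abs_e_integrable]) simp
  have T0: "0 \<in> {0..T}" "T \<in> {0..T}" using T by auto
  have "0 \<le> S * T" "0 \<le> M * Q * T" using S0 T by (simp_all add: S_def)
  then have C0: "1 \<le> C" unfolding C_def using E0 Bp by linarith
  have L0: "0 \<le> L"
  proof -
    have "\<psi> 0 \<le> \<psi> (2 * C)" using psi_mono C0 by (simp add: strict_mono_less_eq)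
    then show ?thesis unfolding L_def psi0 by linarith
  qed
  have B00: "0 \<le> B0" using B0[OF T0(1)] by linarith
  have LT: "0 \<le> L * T" using L0 T by simp
  have P0: "0 \<le> P" unfolding P_def using X LT B00 by linarith
  let ?K = "cbox (- P, - C, - S) (P, C, S)"
  have K: "(p, c, s) \<in> ?K \<longleftrightarrow> \<bar>p\<bar> \<le> P \<and> \<bar>c\<bar> \<le> C \<and> \<bar>s\<bar> \<le> S" for p c s :: real
    by (auto simp: cbox_Pair_eq abs_le_iff)
  show thesis
  proof (rule that[of "max P (max C S)" L], intro allI impI)
    fix n :: nat assume n: "n > 0"
    define \<delta> where "\<delta> = T / real n"
    have \<delta>: "\<delta> \<ge> 0" "real n * \<delta> = T" using n T by (simp_all add: \<delta>_def)
    define u where "u p c s = delayed F q \<delta> p c s n" for p c s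
    define v where "v p c s = (\<lambda>r. u p c s (max 0 (r - \<delta>)))" for p c s
    have uc: "continuous_on {0..T} (u p c s)" for p c s unfolding u_def by (rule delayed_cont[OF F q \<delta>(1)])
    have vc: "continuous_on {0..T} (v p c s)" for p c s unfolding v_def by (rule continuous_on_delay[OF uc \<delta>(1)])
    have ueq: "u p c s t = p + V F q c s (v p c s) t" if "t \<in> {0..T}" for p c s t
    proof -
      have "u p c s t = delayed F q \<delta> p c s (Suc n) t"
        unfolding u_def by (rule delayed_stable[symmetric]) (use that \<delta> in auto)
      then show ?thesis unfolding v_def u_def by simp
    qed
    define m where "m p c s = mx (\<lambda>t. u p c s t - u0 t)" for p c s
    \<comment> \<open>At a fixed point \<open>p\<close> cancels and \<open>m\<close> equals
      \<open>sg\<close> times the clamp; subtracting \<open>m - p\<close> instead of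
      \<open>m\<close> keeps the map bounded independently of \<open>p\<close>. \<open>G2\<close> is
      stationary in the interior of its range exactly when \<open>u T = p\<close>. \<open>G3\<close>
      is stationary when \<open>s\<close> is the mean of the \<open>q\<close> term, which makes
      \<open>W\<close> periodic as \<open>e\<close> has mean zero.\<close>
    define G1 where "G1 p c s = sg * max 0 (min X (sg * m p c s - (s - s0))) - (m p c s - p)" for p c s
    define G2 where "G2 p c s = max (- C) (min C (c - (u p c s T - p)))" for p c s
    define G3 where "G3 p c s = integral {0..T} (\<lambda>r. a r * q (v p c s r)) / T" for p c s
    define G where "G = (\<lambda>(p, c, s). (G1 p c s, G2 p c s, G3 p c s))"
    have arg: "\<bar>W q c s (v p c s) r - c\<bar> + \<bar>F (v p c s r)\<bar> \<le> C - 1" if "\<bar>s\<bar> \<le> S" "r \<in> {0..T}" for p c s r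
    proof -
      have "\<bar>s\<bar> * T \<le> S * T" using that T by (intro mult_right_mono) auto
      then show ?thesis using W_bound[OF q vc Q that(2), of c s p c s] B[of "v p c s r"]
        unfolding C_def by linarith
    qed
    have psiL: "\<bar>\<psi> (W q c s (v p c s) r - F (v p c s r))\<bar> \<le> L"
      if "\<bar>c\<bar> \<le> C" "\<bar>s\<bar> \<le> S" "r \<in> {0..T}" for p c s r
      unfolding L_def by (rule psi_abs_le) (use arg[OF that(2,3), of c p] that(1) in linarith)
    have uL: "\<bar>u p c s t - u p c s t'\<bar> \<le> L * \<bar>t - t'\<bar>"
      if "\<bar>c\<bar> \<le> C" "\<bar>s\<bar> \<le> S" "t \<in> {0..T}" "t' \<in> {0..T}" for p c s t t'
      using V_lipschitz[OF F q vc psiL[OF that(1,2)] that(3,4)] unfolding ueq[OF that(3)] ueq[OF that(4)]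
      by simp
    have u_0: "u p c s 0 = p" for p c s using ueq[OF T0(1)] by simp
    have mp: "\<bar>m p c s - p\<bar> \<le> L * T + B0" if "\<bar>c\<bar> \<le> C" "\<bar>s\<bar> \<le> S" for p c s
    proof -
      have cc: "continuous_on {0..T} (\<lambda>t. u p c s t - u0 t)" by (intro continuous_intros uc u0)
      obtain t where t: "t \<in> {0..T}" "m p c s = u p c s t - u0 t"
        using mx_attained[OF cc] unfolding m_def by metis
      have "\<bar>u p c s t - u p c s 0\<bar> \<le> L * \<bar>t - 0\<bar>" by (rule uL[OF that t(1) T0(1)])
      also have "\<dots> \<le> L * T" using t L0 by (intro mult_left_mono) auto
      finally show ?thesis unfolding t(2) using B0[OF t(1)] u_0[of p c s] by linarith
    qed
    have "\<exists>x\<in>?K. G x = x"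
    proof (rule brouwer)
      show "\<exists>x\<in>?K. G x = x" if "x \<in> ?K" "G x = x" for x using that by blast
      show "?K \<noteq> {}" using K[of 0 0 0] P0 C0 S0 by force
      show "G \<in> ?K \<rightarrow> ?K"
      proof
        fix x assume x: "x \<in> ?K"
        obtain p c s where xe: "x = (p, c, s)" by (cases x)
        have b: "\<bar>p\<bar> \<le> P" "\<bar>c\<bar> \<le> C" "\<bar>s\<bar> \<le> S" using x K unfolding xe by auto
        have "\<bar>sg * max 0 (min X (sg * m p c s - (s - s0)))\<bar> \<le> X"
          using sg X by auto
        then have 1: "\<bar>G1 p c s\<bar> \<le> P" using mp[OF b(2,3), of p] unfolding G1_def P_def by linarith
        have 2: "\<bar>G2 p c s\<bar> \<le> C" using C0 unfolding G2_def by auto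
        have "\<bar>integral {0..T} (\<lambda>r. a r * q (v p c s r))\<bar> \<le> S * T"
          using abs_integral_aq_le[OF q vc Q T0(2)] unfolding S_def .
        then have 3: "\<bar>G3 p c s\<bar> \<le> S" using T unfolding G3_def by (simp add: divide_le_eq)
        show "G x \<in> ?K" unfolding xe G_def using 1 2 3 by (simp only: split_conv K)
      qed
      show "continuous_on ?K G"
        unfolding continuous_on_sequentially
      proof (intro allI ballI impI, elim conjE)
        fix x :: "nat \<Rightarrow> real \<times> real \<times> real" and y assume lim: "x \<longlonglongrightarrow> y"
        obtain p' c' s' where ye: "y = (p', c', s')" by (cases y)
        define p c s where "p j = fst (x j)" and "c j = fst (snd (x j))" and "s j = snd (snd (x j))" for j
        have pcs: "p \<longlonglongrightarrow> p'" "c \<longlonglongrightarrow> c'" "s \<longlonglongrightarrow> s'"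
          using tendsto_fst[OF lim] tendsto_fst[OF tendsto_snd[OF lim]] tendsto_snd[OF tendsto_snd[OF lim]]
          unfolding p_def c_def s_def ye by auto
        obtain d where d: "d \<longlonglongrightarrow> 0"
          "\<And>j t. t \<in> {0..T} \<Longrightarrow> \<bar>u (p j) (c j) (s j) t - u p' c' s' t\<bar> \<le> d j"
          using delayed_tendsto[OF F B q Q \<delta>(1) pcs, of n] unfolding u_def by blast
        have ulim: "(\<lambda>j. u (p j) (c j) (s j) t) \<longlonglongrightarrow> u p' c' s' t" if "t \<in> {0..T}" for t
          by (rule LIM_zero_cancel, rule Lim_null_comparison[OF _ d(1)]) (use d(2)[OF that] in auto)
        have "\<bar>m (p j) (c j) (s j) - m p' c' s'\<bar> \<le> d j" for j
          unfolding m_def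
        proof (rule mx_diff_le)
          fix t assume "t \<in> {0..T}"
          then show "\<bar>u (p j) (c j) (s j) t - u0 t - (u p' c' s' t - u0 t)\<bar> \<le> d j" using d(2) by simp
        qed (intro continuous_intros uc u0)+
        then have mlim: "(\<lambda>j. m (p j) (c j) (s j)) \<longlonglongrightarrow> m p' c' s'"
          by (intro LIM_zero_cancel[OF Lim_null_comparison[OF _ d(1)]]) auto
        have "(\<lambda>j. G1 (p j) (c j) (s j)) \<longlonglongrightarrow> G1 p' c' s'"
          unfolding G1_def by (intro tendsto_intros mlim pcs)
        moreover have "(\<lambda>j. G2 (p j) (c j) (s j)) \<longlonglongrightarrow> G2 p' c' s'"
          unfolding G2_def by (intro tendsto_intros ulim T0 pcs)
        \<comment> \<open>With \<open>c\<close> and \<open>s\<close> zero and \<open>e\<close> of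
          mean zero, \<open>W\<close> at \<open>T\<close> is minus the integral in
          \<open>G3\<close>, so the convergence result for \<open>W\<close> applies to
          \<open>G3\<close>.\<close>
        moreover have "(\<lambda>j. W q 0 0 (v (p j) (c j) (s j)) T) \<longlonglongrightarrow> W q 0 0 (v p' c' s') T"
        proof (rule W_tendsto[OF q Q vc])
          show "(\<lambda>j. v (p j) (c j) (s j) t) \<longlonglongrightarrow> v p' c' s' t" if "t \<in> {0..T}" for t
            unfolding v_def by (rule ulim) (use that \<delta> in auto)
        qed (use T0 in auto)
        then have "(\<lambda>j. G3 (p j) (c j) (s j)) \<longlonglongrightarrow> G3 p' c' s'"
          unfolding G3_def W_def using T by (intro tendsto_divide tendsto_const) (auto simp: e_mean tendsto_minus_cancel_left)
        ultimately have "(\<lambda>j. (G1 (p j) (c j) (s j), G2 (p j) (c j) (s j), G3 (p j) (c j) (s j)))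
            \<longlonglongrightarrow> (G1 p' c' s', G2 p' c' s', G3 p' c' s')"
          by (intro tendsto_Pair)
        then show "(G \<circ> x) \<longlonglongrightarrow> G y"
          unfolding G_def ye comp_def p_def c_def s_def by (simp add: case_prod_beta)
      qed
    qed simp_all
    then obtain x where x: "x \<in> ?K" "G x = x" by blast
    obtain p c s where xe: "x = (p, c, s)" by (cases x)
    have b: "\<bar>p\<bar> \<le> P" "\<bar>c\<bar> \<le> C" "\<bar>s\<bar> \<le> S"
      using x(1) unfolding xe K by simp_all
    have fp: "G1 p c s = p" "G2 p c s = c" "G3 p c s = s"
      using x(2) unfolding xe G_def by simp_all
    have Wc: "W q c s (v p c s) T = c"
      using fp(3) T unfolding W_def G3_def e_mean by (simp add: field_simps)
    have V0: "V F q c s (v p c s) T = 0"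
    proof (rule ccontr)
      assume ne: "V F q c s (v p c s) T \<noteq> 0"
      have rc: "(\<lambda>r. \<psi> (W q c s (v p c s) r - F (v p c s r))) integrable_on {0..T}"
        by (rule integrable_continuous_real[OF rhs_cont[OF F q vc]])
      have uT: "u p c s T - p = V F q c s (v p c s) T" using ueq[OF T0(2), of p c s] by simp
      consider "V F q c s (v p c s) T > 0" | "V F q c s (v p c s) T < 0" using ne by linarith
      then show False
      proof cases
        case 1
        then have "c = - C" using fp(2) C0 unfolding G2_def uT by linarith
        then have "\<psi> (W q c s (v p c s) r - F (v p c s r)) \<le> \<psi> 0" if "r \<in> {0..T}" for r
          unfolding strict_mono_less_eq[OF psi_mono] using arg[OF b(3) that, of c p] by linarith
        then have "V F q c s (v p c s) T \<le> integral {0..T} (\<lambda>r. 0)"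
          unfolding V_def psi0 by (intro integral_le rc) auto
        then show False using 1 by simp
      next
        case 2
        then have "c = C" using fp(2) C0 unfolding G2_def uT by linarith
        then have "\<psi> 0 \<le> \<psi> (W q c s (v p c s) r - F (v p c s r))" if "r \<in> {0..T}" for r
          unfolding strict_mono_less_eq[OF psi_mono] using arg[OF b(3) that, of c p] by linarith
        then have "integral {0..T} (\<lambda>r. 0) \<le> V F q c s (v p c s) T"
          unfolding V_def psi0 by (intro integral_le rc) auto
        then show False using 2 by simp
      qed
    qed
    have mfp: "m p c s = sg * max 0 (min X (sg * m p c s - (s - s0)))"
      using fp(1) unfolding G1_def by linarith
    have sg2: "sg * (sg * z) = z" for z using sg by auto
    have mfp': "sg * m p c s = max 0 (min X (sg * m p c s - (s - s0)))"
      using arg_cong[OF mfp, of "\<lambda>z. sg * z"] unfolding sg2 .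
    show "\<exists>p c s u. \<bar>p\<bar> \<le> max P (max C S) \<and> \<bar>c\<bar> \<le> max P (max C S) \<and> \<bar>s\<bar> \<le> max P (max C S) \<and> continuous_on {0..T} u \<and>
      (\<forall>t\<in>{0..T}. \<forall>t'\<in>{0..T}. \<bar>u t - u t'\<bar> \<le> L * \<bar>t - t'\<bar>) \<and>
      (\<forall>t\<in>{0..T}. u t = p + V F q c s (\<lambda>r. u (max 0 (r - T / real n))) t) \<and>
      u T = p \<and> W q c s (\<lambda>r. u (max 0 (r - T / real n))) T = c \<and>
      sg * mx (\<lambda>t. u t - u0 t) = max 0 (min X (sg * mx (\<lambda>t. u t - u0 t) - (s - s0)))"
    proof (rule exI[of _ p], rule exI[of _ c], rule exI[of _ s], rule exI[of _ "u p c s"], intro conjI ballI)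
      show "\<bar>u p c s t - u p c s t'\<bar> \<le> L * \<bar>t - t'\<bar>" if "t \<in> {0..T}" "t' \<in> {0..T}" for t t'
        by (rule uL[OF b(2,3) that])
      show "u p c s t = p + V F q c s (\<lambda>r. u p c s (max 0 (r - T / real n))) t" if "t \<in> {0..T}" for t
        using ueq[OF that, of p c s] unfolding v_def \<delta>_def .
      show "u p c s T = p" using ueq[OF T0(2), of p c s] V0 by simp
      show "W q c s (\<lambda>r. u p c s (max 0 (r - T / real n))) T = c" using Wc unfolding v_def \<delta>_def .
      show "sg * mx (\<lambda>t. u p c s t - u0 t) = max 0 (min X (sg * mx (\<lambda>t. u p c s t - u0 t) - (s - s0)))"
        using mfp' unfolding m_def .
    qed (use b uc in auto)
  qed
qed


text \<open>The argument \<open>v\<close> is kept separate from \<open>u\<close> so that the lemma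
  serves twice: for delayed approximations, where \<open>v\<close> is the shifted \<open>u\<close>,
  and for sequences of exact solutions, where \<open>v = u\<close> and \<epsilon> is 0. In both
  cases the limit satisfies the equation without delay.\<close>

lemma compactness:
  assumes F: "continuous_on UNIV F" and B: "\<And>z. \<bar>F z\<bar> \<le> B"
    and q: "continuous_on UNIV q" and Q: "\<And>z. \<bar>q z\<bar> \<le> Q"
    and R: "\<And>j::nat. \<bar>p j\<bar> \<le> R \<and> \<bar>c j\<bar> \<le> R \<and> \<bar>s j\<bar> \<le> R"
    and L: "\<And>j t t'. t \<in> {0..T} \<Longrightarrow> t' \<in> {0..T} \<Longrightarrow> \<bar>u j t - u j t'\<bar> \<le> L * \<bar>t - t'\<bar>"
    and v: "\<And>j. continuous_on {0..T} (v j)"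
    and ueq: "\<And>j t. t \<in> {0..T} \<Longrightarrow> u j t = p j + V F q (c j) (s j) (v j) t"
    and vu: "\<And>j t. t \<in> {0..T} \<Longrightarrow> \<bar>v j t - u j t\<bar> \<le> \<epsilon> j" and \<epsilon>: "\<epsilon> \<longlonglongrightarrow> 0"
  obtains k p' c' s' w d where "strict_mono (k :: nat \<Rightarrow> nat)"
    "(\<lambda>j. p (k j)) \<longlonglongrightarrow> p'" "(\<lambda>j. c (k j)) \<longlonglongrightarrow> c'" "(\<lambda>j. s (k j)) \<longlonglongrightarrow> s'"
    "continuous_on {0..T} w" "d \<longlonglongrightarrow> 0" "\<forall>j. \<forall>t\<in>{0..T}. \<bar>u (k j) t - w t\<bar> \<le> d j"
    "\<forall>t\<in>{0..T}. w t = p' + V F q c' s' w t"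
    "\<forall>t\<in>{0..T}. (\<lambda>j. W q (c (k j)) (s (k j)) (v (k j)) t) \<longlonglongrightarrow> W q c' s' w t"
proof -
  have "\<bar>u 0 0 - u 0 T\<bar> \<le> L * \<bar>0 - T\<bar>" by (rule L) (use T in auto)
  then have "0 \<le> L * T" using T by simp
  then have L0: "0 \<le> L" using T by (simp add: zero_le_mult_iff)
  have uc: "continuous_on {0..T} (u j)" for j
  proof -
    have "continuous_on {0..T} (\<lambda>t. p j + V F q (c j) (s j) (v j) t)"
      by (intro continuous_intros V_cont F q v)
    then show ?thesis by (rule continuous_on_eq) (simp add: ueq)
  qed
  obtain w k0 where w: "continuous_on {0..T} w" and k0: "strict_mono (k0 :: nat \<Rightarrow> nat)"
    and uw: "\<And>e. 0 < e \<Longrightarrow> \<exists>N. \<forall>n x. n \<ge> N \<and> x \<in> {0..T} \<longrightarrow> norm (u (k0 n) x - w x) < e"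
  proof (rule Arzela_Ascoli[of "{0..T}" u "R + L * T"])
    show "norm (u n x) \<le> R + L * T" if x: "x \<in> {0..T}" for n x
    proof -
      have "\<bar>u n x - u n 0\<bar> \<le> L * \<bar>x - 0\<bar>" by (rule L) (use x T in auto)
      also have "\<dots> \<le> L * T" using x L0 by (intro mult_left_mono) auto
      finally have "\<bar>u n x - u n 0\<bar> \<le> L * T" .
      moreover have "u n 0 = p n" using ueq[of 0 n] T by simp
      ultimately show ?thesis using R[of n] unfolding real_norm_def by linarith
    qed
    show "\<exists>d>0. \<forall>n y. y \<in> {0..T} \<and> norm (x - y) < d \<longrightarrow> norm (u n x - u n y) < e"
      if x: "x \<in> {0..T}" and e: "0 < e" for x e
    proof (intro exI conjI allI impI)
      show "0 < e / (L + 1)" using e L0 by simp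
      fix n y assume y: "y \<in> {0..T} \<and> norm (x - y) < e / (L + 1)"
      have "\<bar>u n x - u n y\<bar> \<le> L * \<bar>x - y\<bar>" by (rule L) (use x y in auto)
      also have "\<dots> \<le> (L + 1) * \<bar>x - y\<bar>" by (simp add: distrib_right)
      also have "\<dots> < e" using y L0 by (simp add: pos_less_divide_eq mult.commute)
      finally show "norm (u n x - u n y) < e" by simp
    qed
  qed (simp, rule that)
  \<comment> \<open>A second extraction makes the three parameters converge as well.\<close>
  let ?K = "cbox (- R, - R, - R) (R, R, R)"
  have "(p (k0 n), c (k0 n), s (k0 n)) \<in> ?K" for n
  proof -
    have "- R \<le> p (k0 n)" "p (k0 n) \<le> R" "- R \<le> c (k0 n)" "c (k0 n) \<le> R" "- R \<le> s (k0 n)" "s (k0 n) \<le> R"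
      using R[of "k0 n"] by linarith+
    then show ?thesis by (simp add: cbox_Pair_eq)
  qed
  then have inK: "\<forall>n. (p (k0 n), c (k0 n), s (k0 n)) \<in> ?K" by (rule allI)
  have "seq_compact ?K" by (rule compact_imp_seq_compact[OF compact_cbox])
  then obtain l r where "l \<in> ?K" and l: "strict_mono (r :: nat \<Rightarrow> nat)"
      "((\<lambda>n. (p (k0 n), c (k0 n), s (k0 n))) \<circ> r) \<longlonglongrightarrow> l"
    by (rule seq_compactE[OF _ inK])
  obtain p' c' s' where le: "l = (p', c', s')" by (cases l)
  define k where "k = k0 \<circ> r"
  have k: "strict_mono k" unfolding k_def by (rule strict_mono_o[OF k0 l(1)])
  have lim: "(\<lambda>j. (p (k j), c (k j), s (k j))) \<longlonglongrightarrow> (p', c', s')"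
    using l(2) unfolding k_def le comp_def .
  have plim: "(\<lambda>j. p (k j)) \<longlonglongrightarrow> p'" using tendsto_fst[OF lim] by simp
  have clim: "(\<lambda>j. c (k j)) \<longlonglongrightarrow> c'" using tendsto_fst[OF tendsto_snd[OF lim]] by simp
  have slim: "(\<lambda>j. s (k j)) \<longlonglongrightarrow> s'" using tendsto_snd[OF tendsto_snd[OF lim]] by simp
  define d where "d j = mx (\<lambda>t. \<bar>u (k j) t - w t\<bar>)" for j
  have dc: "continuous_on {0..T} (\<lambda>t. \<bar>u (k j) t - w t\<bar>)" for j
    by (intro continuous_intros uc w)
  have d_up: "\<bar>u (k j) t - w t\<bar> \<le> d j" if "t \<in> {0..T}" for j t
    unfolding d_def using mx_upper[OF dc that] .
  have d_lim: "d \<longlonglongrightarrow> 0"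
  proof (rule LIMSEQ_I)
    fix e :: real assume "0 < e"
    then obtain N where N: "\<And>n x. n \<ge> N \<Longrightarrow> x \<in> {0..T} \<Longrightarrow> norm (u (k0 n) x - w x) < e"
      using uw by blast
    have "norm (d n - 0) < e" if n: "n \<ge> N" for n
    proof -
      obtain t where t: "t \<in> {0..T}" "d n = \<bar>u (k n) t - w t\<bar>"
        using mx_attained[OF dc] unfolding d_def by metis
      have "r n \<ge> N" using seq_suble[OF l(1), of n] n by linarith
      then show ?thesis using N[OF _ t(1), of "r n"] unfolding t(2) k_def by simp
    qed
    then show "\<exists>no. \<forall>n\<ge>no. norm (d n - 0) < e" by blast
  qed
  have \<epsilon>k: "(\<lambda>j. \<epsilon> (k j)) \<longlonglongrightarrow> 0" using LIMSEQ_subseq_LIMSEQ[OF \<epsilon> k] by (simp add: comp_def)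
  have vlim: "(\<lambda>j. v (k j) t) \<longlonglongrightarrow> w t" if t: "t \<in> {0..T}" for t
  proof (rule LIM_zero_cancel, rule Lim_null_comparison)
    show "(\<lambda>j. \<epsilon> (k j) + d j) \<longlonglongrightarrow> 0" using tendsto_add[OF \<epsilon>k d_lim] by simp
    have "norm (v (k j) t - w t) \<le> \<epsilon> (k j) + d j" for j
      using vu[OF t, of "k j"] d_up[OF t, of j] unfolding real_norm_def by linarith
    then show "\<forall>\<^sub>F j in sequentially. norm (v (k j) t - w t) \<le> \<epsilon> (k j) + d j" by simp
  qed
  have Wlim: "(\<lambda>j. W q (c (k j)) (s (k j)) (v (k j)) t) \<longlonglongrightarrow> W q c' s' w t" if "t \<in> {0..T}" for t
    by (rule W_tendsto[OF q Q v vlim clim slim that])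
  obtain d' where d': "d' \<longlonglongrightarrow> 0"
    "\<forall>j. \<forall>t\<in>{0..T}. \<bar>V F q (c (k j)) (s (k j)) (v (k j)) t - V F q c' s' w t\<bar> \<le> d' j"
    by (rule V_tendsto[OF F B q Q v vlim w clim slim])
  have weq: "w t = p' + V F q c' s' w t" if t: "t \<in> {0..T}" for t
  proof (rule LIMSEQ_unique)
    show "(\<lambda>j. u (k j) t) \<longlonglongrightarrow> w t"
      by (rule LIM_zero_cancel, rule Lim_null_comparison[OF _ d_lim]) (use d_up[OF t] in auto)
    have "(\<lambda>j. V F q (c (k j)) (s (k j)) (v (k j)) t) \<longlonglongrightarrow> V F q c' s' w t"
      by (rule LIM_zero_cancel, rule Lim_null_comparison[OF _ d'(1)]) (use d'(2) t in auto)
    then show "(\<lambda>j. u (k j) t) \<longlonglongrightarrow> p' + V F q c' s' w t"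
      unfolding ueq[OF t] by (intro tendsto_add plim)
  qed
  show thesis
    by (rule that[OF k plim clim slim w d_lim]) (use d_up weq Wlim in blast)+
qed

text \<open>Here \<open>s0\<close> is the target parameter and \<open>u0\<close> any continuous
  reference function. The clamp equation survives the limit of vanishing delay. It equates \<mu>,
  the signed maximum, with the clamp of \<open>\<mu> - (s - s0)\<close>: if \<open>s - s0\<close> is
  positive this is possible only at the lower end 0, if it is negative only at the upper end
  \<open>X\<close>.\<close>

lemma existence:
  assumes F: "continuous_on UNIV F" and B: "\<And>z. \<bar>F z\<bar> \<le> B"
    and q: "continuous_on UNIV q" and Q: "\<And>z. \<bar>q z\<bar> \<le> Q"
    and X: "X \<ge> 0" and sg: "sg \<in> {1,-1}" and u0: "continuous_on {0..T} u0"
  obtains c s u where "sol F q s c u"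
    "0 \<le> sg * mx (\<lambda>t. u t - u0 t)" "sg * mx (\<lambda>t. u t - u0 t) \<le> X"
    "s0 < s \<Longrightarrow> mx (\<lambda>t. u t - u0 t) = 0" "s < s0 \<Longrightarrow> sg * mx (\<lambda>t. u t - u0 t) = X"
proof -
  obtain R L where app: "\<forall>n::nat. n > 0 \<longrightarrow> (\<exists>p c s u.
      \<bar>p\<bar> \<le> R \<and> \<bar>c\<bar> \<le> R \<and> \<bar>s\<bar> \<le> R \<and> continuous_on {0..T} u \<and>
      (\<forall>t\<in>{0..T}. \<forall>t'\<in>{0..T}. \<bar>u t - u t'\<bar> \<le> L * \<bar>t - t'\<bar>) \<and>
      (\<forall>t\<in>{0..T}. u t = p + V F q c s (\<lambda>r. u (max 0 (r - T / real n))) t) \<and>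
      u T = p \<and> W q c s (\<lambda>r. u (max 0 (r - T / real n))) T = c \<and>
      sg * mx (\<lambda>t. u t - u0 t) = max 0 (min X (sg * mx (\<lambda>t. u t - u0 t) - (s - s0))))"
    by (rule approximate_solution[OF F B q Q X sg u0, of s0])
  have "\<forall>j::nat. \<exists>p c s u.
      \<bar>p\<bar> \<le> R \<and> \<bar>c\<bar> \<le> R \<and> \<bar>s\<bar> \<le> R \<and> continuous_on {0..T} u \<and>
      (\<forall>t\<in>{0..T}. \<forall>t'\<in>{0..T}. \<bar>u t - u t'\<bar> \<le> L * \<bar>t - t'\<bar>) \<and>
      (\<forall>t\<in>{0..T}. u t = p + V F q c s (\<lambda>r. u (max 0 (r - T / real (Suc j)))) t) \<and>
      u T = p \<and> W q c s (\<lambda>r. u (max 0 (r - T / real (Suc j)))) T = c \<and>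
      sg * mx (\<lambda>t. u t - u0 t) = max 0 (min X (sg * mx (\<lambda>t. u t - u0 t) - (s - s0)))"
    by (intro allI app[rule_format]) simp
  then obtain p c s u where
    all: "\<And>j::nat. \<bar>p j\<bar> \<le> R \<and> \<bar>c j\<bar> \<le> R \<and> \<bar>s j\<bar> \<le> R \<and> continuous_on {0..T} (u j) \<and>
      (\<forall>t\<in>{0..T}. \<forall>t'\<in>{0..T}. \<bar>u j t - u j t'\<bar> \<le> L * \<bar>t - t'\<bar>) \<and>
      (\<forall>t\<in>{0..T}. u j t = p j + V F q (c j) (s j) (\<lambda>r. u j (max 0 (r - T / real (Suc j)))) t) \<and>
      u j T = p j \<and> W q (c j) (s j) (\<lambda>r. u j (max 0 (r - T / real (Suc j)))) T = c j \<and>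
      sg * mx (\<lambda>t. u j t - u0 t) = max 0 (min X (sg * mx (\<lambda>t. u j t - u0 t) - (s j - s0)))"
    unfolding choice_iff by blast
  define v where "v j = (\<lambda>r. u j (max 0 (r - T / real (Suc j))))" for j
  have T0: "0 \<in> {0..T}" "T \<in> {0..T}" using T by auto
  have \<delta>: "0 \<le> T / real (Suc j)" for j using T by simp
  have uc: "continuous_on {0..T} (u j)" for j using all by blast
  have vc: "continuous_on {0..T} (v j)" for j
    unfolding v_def by (rule continuous_on_delay[OF uc \<delta>])
  have Lip: "\<bar>u j t - u j t'\<bar> \<le> L * \<bar>t - t'\<bar>" if "t \<in> {0..T}" "t' \<in> {0..T}" for j t t'
    using all that by blast
  have ueq: "u j t = p j + V F q (c j) (s j) (v j) t" if "t \<in> {0..T}" for j t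
    using all that unfolding v_def by blast
  have uT: "u j T = p j" and WT: "W q (c j) (s j) (v j) T = c j"
    and clamp: "sg * mx (\<lambda>t. u j t - u0 t) = max 0 (min X (sg * mx (\<lambda>t. u j t - u0 t) - (s j - s0)))" for j
    using all unfolding v_def by blast+
  have delay: "max 0 (t - \<delta>) \<in> {0..T}" "\<bar>max 0 (t - \<delta>) - t\<bar> \<le> \<delta>" if "t \<in> {0..T}" "0 \<le> \<delta>" for t \<delta> :: real
    using that by auto
  have vu: "\<bar>v j t - u j t\<bar> \<le> \<bar>L\<bar> * (T / real (Suc j))" if t: "t \<in> {0..T}" for j t
  proof -
    have "\<bar>v j t - u j t\<bar> \<le> L * \<bar>max 0 (t - T / real (Suc j)) - t\<bar>"
      unfolding v_def by (rule Lip[OF delay(1)[OF t \<delta>] t])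
    also have "\<dots> \<le> \<bar>L\<bar> * \<bar>max 0 (t - T / real (Suc j)) - t\<bar>" by (intro mult_right_mono) auto
    also have "\<dots> \<le> \<bar>L\<bar> * (T / real (Suc j))"
      by (intro mult_left_mono delay(2)[OF t \<delta>]) simp
    finally show ?thesis .
  qed
  have "(\<lambda>j. \<bar>L\<bar> * (T * inverse (real (Suc j)))) \<longlonglongrightarrow> \<bar>L\<bar> * (T * 0)"
    by (intro tendsto_intros LIMSEQ_inverse_real_of_nat)
  then have \<epsilon>: "(\<lambda>j. \<bar>L\<bar> * (T / real (Suc j))) \<longlonglongrightarrow> 0" by (simp add: divide_inverse)
  have R: "\<bar>p j\<bar> \<le> R \<and> \<bar>c j\<bar> \<le> R \<and> \<bar>s j\<bar> \<le> R" for j using all by blast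
  obtain k p' c' s' w d where k: "strict_mono (k :: nat \<Rightarrow> nat)"
    and lims: "(\<lambda>j. p (k j)) \<longlonglongrightarrow> p'" "(\<lambda>j. c (k j)) \<longlonglongrightarrow> c'" "(\<lambda>j. s (k j)) \<longlonglongrightarrow> s'"
    and w: "continuous_on {0..T} w" and d: "d \<longlonglongrightarrow> 0" "\<forall>j. \<forall>t\<in>{0..T}. \<bar>u (k j) t - w t\<bar> \<le> d j"
    and weq: "\<forall>t\<in>{0..T}. w t = p' + V F q c' s' w t"
    and Wl: "\<forall>t\<in>{0..T}. (\<lambda>j. W q (c (k j)) (s (k j)) (v (k j)) t) \<longlonglongrightarrow> W q c' s' w t"
    by (rule compactness[OF F B q Q R Lip vc ueq vu \<epsilon>])
  have ulim: "(\<lambda>j. u (k j) t) \<longlonglongrightarrow> w t" if t: "t \<in> {0..T}" for t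
    by (rule LIM_zero_cancel, rule Lim_null_comparison[OF _ d(1)]) (use d(2) t in auto)
  have w0: "w 0 = p'" using weq T0 by simp
  have wT: "w T = p'"
    using LIMSEQ_unique[OF ulim[OF T0(2)]] lims(1) unfolding uT by blast
  have WTw: "W q c' s' w T = c'"
    using LIMSEQ_unique[OF Wl[rule_format, OF T0(2)]] lims(2) unfolding WT by blast
  have s: "sol F q s' c' w" unfolding sol_def w0 using w weq wT WTw by blast
  let ?m = "\<lambda>j. mx (\<lambda>t. u (k j) t - u0 t)"
  have "\<bar>?m j - mx (\<lambda>t. w t - u0 t)\<bar> \<le> d j" for j
  proof (rule mx_diff_le)
    show "\<bar>u (k j) t - u0 t - (w t - u0 t)\<bar> \<le> d j" if "t \<in> {0..T}" for t using d(2) that by simp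
  qed (intro continuous_intros uc u0 w)+
  then have mlim: "?m \<longlonglongrightarrow> mx (\<lambda>t. w t - u0 t)"
    by (intro LIM_zero_cancel[OF Lim_null_comparison[OF _ d(1)]]) auto
  have "(\<lambda>j. sg * ?m j) \<longlonglongrightarrow> max 0 (min X (sg * mx (\<lambda>t. w t - u0 t) - (s' - s0)))"
    by (subst clamp) (intro tendsto_intros mlim lims)
  then have eq: "sg * mx (\<lambda>t. w t - u0 t) = max 0 (min X (sg * mx (\<lambda>t. w t - u0 t) - (s' - s0)))"
    using LIMSEQ_unique[OF tendsto_mult_left[OF mlim]] by blast
  show thesis
  proof (rule that[OF s])
    show "0 \<le> sg * mx (\<lambda>t. w t - u0 t)" by (subst eq) simp
    show "sg * mx (\<lambda>t. w t - u0 t) \<le> X" by (subst eq) (use X in simp)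
    show "s' < s0 \<Longrightarrow> sg * mx (\<lambda>t. w t - u0 t) = X" using eq X by linarith
    have "s0 < s' \<Longrightarrow> sg * mx (\<lambda>t. w t - u0 t) = 0" using eq X by linarith
    then show "s0 < s' \<Longrightarrow> mx (\<lambda>t. w t - u0 t) = 0" using sg by auto
  qed
qed

end

section \<open>A priori bounds and comparison\<close>

text \<open>At the first time in \<open>[p, r]\<close> where \<open>u\<close> is at most
  \<open>l\<close>, continuity gives the value \<open>l\<close>; since \<open>u\<close> exceeds
  \<open>l\<close> just before, the derivative there cannot be positive.\<close>

lemma downward_crossing:
  fixes u u' :: "real \<Rightarrow> real"
  assumes u: "\<And>t. t \<in> {0..T} \<Longrightarrow> (u has_real_derivative u' t) (at t within {0..T})"
    and pr: "0 \<le> p" "p < r" "r \<le> T" and l: "l < u p" "u r \<le> l"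
  shows "\<exists>t\<in>{0..T}. u t = l \<and> u' t \<le> 0"
proof -
  have cont: "continuous_on {0..T} u" by (rule DERIV_continuous_on) (rule u)
  have cpr: "continuous_on {p..r} u" by (rule continuous_on_subset[OF cont]) (use pr in auto)
  define S where "S = {t\<in>{p..r}. u t \<le> l}"
  have "closed S" unfolding S_def
    by (rule continuous_on_closed_Collect_le[OF cpr]) (auto intro: continuous_intros)
  moreover have "S \<noteq> {}" "bdd_below S" using pr l unfolding S_def by auto
  ultimately have InfS: "Inf S \<in> S" by (intro closed_contains_Inf)
  define t where "t = Inf S"
  have t: "p \<le> t" "t \<le> r" "u t \<le> l" using InfS unfolding S_def t_def by auto
  have before: "l < u x" if "p \<le> x" "x < t" for x
  proof (rule ccontr)
    assume "\<not> l < u x"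
    then have "x \<in> S" using that t unfolding S_def by auto
    then have "t \<le> x" unfolding t_def using \<open>bdd_below S\<close> by (rule cInf_lower)
    then show False using that by simp
  qed
  have pt: "p < t" using t l by (metis less_eq_real_def not_less)
  have "u t = l"
  proof (rule ccontr)
    assume "u t \<noteq> l"
    then have "u t < l" using t by simp
    then obtain x where x: "p \<le> x" "x \<le> t" "u x = l"
      using IVT2'[of u t l p] l pt continuous_on_subset[OF cpr, of "{p..t}"] t by auto
    then have "x \<noteq> t" using \<open>u t \<noteq> l\<close> by auto
    then show False using before[of x] x by simp
  qed
  moreover have "u' t \<le> 0"
  proof (rule ccontr)
    assume "\<not> u' t \<le> 0"
    moreover have tT: "t \<in> {0..T}" using t pr by auto
    ultimately obtain d where d: "d > 0" "\<And>h. 0 < h \<Longrightarrow> t - h \<in> {0..T} \<Longrightarrow> h < d \<Longrightarrow> u (t - h) < u t"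
      using has_real_derivative_pos_inc_left[OF u[OF tT]] by auto
    define h where "h = min (d / 2) (t - p)"
    have h: "0 < h" "h < d" "p \<le> t - h" using d(1) pt by (auto simp: h_def)
    then have "u (t - h) < u t" by (intro d(2)) (use tT pr in auto)
    then show False using before[of "t - h"] h \<open>u t = l\<close> by simp
  qed
  ultimately show ?thesis using t pr by (intro bexI[of _ t]) auto
qed

text \<open>A periodic function that rises through a level has to come down through it
  again.\<close>

lemma periodic_level_derivative_nonpos:
  fixes u u' :: "real \<Rightarrow> real"
  assumes u: "\<And>t. t \<in> {0..T} \<Longrightarrow> (u has_real_derivative u' t) (at t within {0..T})"
    and per: "u 0 = u T" "u' 0 = u' T" and T: "0 < T" and t1: "t1 \<in> {0..T}"
  shows "\<exists>t\<in>{0..T}. u t = u t1 \<and> u' t \<le> 0"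
proof (cases "u' t1 \<le> 0")
  case False
  \<comment> \<open>Exchanging \<open>T\<close> for 0 leaves room on the right, where
    \<open>u\<close> climbs above the level.\<close>
  define t0 where "t0 = (if t1 = T then 0 else t1)"
  have t0: "0 \<le> t0" "t0 < T" "u t0 = u t1" "0 < u' t0"
    using t1 T per False by (auto simp: t0_def)
  then have "t0 \<in> {0..T}" by auto
  then obtain d where d: "d > 0" "\<And>h. 0 < h \<Longrightarrow> t0 + h \<in> {0..T} \<Longrightarrow> h < d \<Longrightarrow> u t0 < u (t0 + h)"
    using has_real_derivative_pos_inc_right[OF u t0(4)] by auto
  \<comment> \<open>The descent happens after \<open>t0\<close> if \<open>u T\<close> is not above
    the level, and otherwise between 0 and \<open>t0\<close>, because then \<open>u 0 = u T\<close>
    is above it.\<close>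
  show ?thesis
  proof (cases "u T \<le> u t0")
    case True
    define h where "h = min (d / 2) ((T - t0) / 2)"
    have h: "0 < h" "h < d" "t0 + h < T" using d(1) t0 by (auto simp: h_def min_def field_simps)
    have "u t0 < u (t0 + h)" by (intro d(2)) (use h t0 in auto)
    then show ?thesis using downward_crossing[OF u, of "t0 + h" T "u t0"] h t0 True by auto
  next
    case False
    then have "u t0 < u 0" using per by simp
    moreover from this have "0 < t0" using t0 by (metis less_eq_real_def less_irrefl)
    ultimately show ?thesis using downward_crossing[OF u, of 0 t0 "u t0"] t0 by auto
  qed
qed (use t1 in auto)

context wave_equation
begin

definition A :: real where "A = integral {0..T} a"

definition abar :: real where "abar = A / T"

lemma A_pos: "A > 0" using a_pos by (simp add: A_def)

lemma abar_pos: "abar > 0" using A_pos T by (simp add: abar_def)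

lemma T_mem: "0 \<in> {0..T}" "T \<in> {0..T}" using T by auto

lemma E_nonneg: "0 \<le> E"
  unfolding E_def by (rule integral_nonneg[OF abs_e_integrable]) simp

lemma W_0 [simp]: "W q c s v 0 = c" by (simp add: W_def)

lemma sol_mean:
  assumes "sol F q s c u"
  shows "integral {0..T} (\<lambda>r. a r * q (u r)) = s * T"
  using assms unfolding sol_def W_def e_mean by simp

lemma sol_cont: "sol F q s c u \<Longrightarrow> continuous_on {0..T} u"
  by (simp add: sol_def)

lemma sol_eq: "sol F q s c u \<Longrightarrow> t \<in> {0..T} \<Longrightarrow> u t = u 0 + V F q c s u t"
  unfolding sol_def by blast

lemma sol_deriv:
  assumes F: "continuous_on UNIV F" and q: "continuous_on UNIV q" and s: "sol F q s c u" and t: "t \<in> {0..T}"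
  shows "(u has_real_derivative \<psi> (W q c s u t - F (u t))) (at t within {0..T})"
proof -
  have "((\<lambda>t. u 0 + V F q c s u t) has_real_derivative 0 + \<psi> (W q c s u t - F (u t))) (at t within {0..T})"
    by (rule DERIV_add[OF DERIV_const V_deriv[OF F q sol_cont[OF s] t]])
  then have "((\<lambda>t. u 0 + V F q c s u t) has_real_derivative \<psi> (W q c s u t - F (u t))) (at t within {0..T})"
    by (simp only: add_0_left)
  then show ?thesis
    by (rule has_field_derivative_transform_within[OF _ zero_less_one t]) (rule sol_eq[OF s, symmetric])
qed

lemma sol_periodic:
  assumes "sol F q s c u"
  shows "u T = u 0" "W q c s u T = W q c s u 0"
  using assms by (simp_all add: sol_def)

lemma sol_ge:
  assumes q: "continuous_on UNIV q" and s: "sol F q s c u" and r: "\<And>t. t \<in> {0..T} \<Longrightarrow> r \<le> q (u t)"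
  shows "abar * r \<le> s"
proof -
  have "integral {0..T} (\<lambda>t. a t * r) \<le> integral {0..T} (\<lambda>t. a t * q (u t))"
    by (rule integral_le[OF _ aq_integrable[OF q sol_cont[OF s]]])
      (use r a_nonneg a_integrable in \<open>auto intro!: mult_left_mono integrable_on_mult_left\<close>)
  then have "A * r \<le> s * T" unfolding sol_mean[OF s] A_def by simp
  then show ?thesis using T unfolding abar_def by (simp add: field_simps)
qed

lemma sol_le:
  assumes q: "continuous_on UNIV q" and s: "sol F q s c u" and r: "\<And>t. t \<in> {0..T} \<Longrightarrow> q (u t) \<le> r"
  shows "s \<le> abar * r"
proof -
  have "integral {0..T} (\<lambda>t. a t * q (u t)) \<le> integral {0..T} (\<lambda>t. a t * r)"
    by (rule integral_le[OF aq_integrable[OF q sol_cont[OF s]]])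
      (use r a_nonneg a_integrable in \<open>auto intro!: mult_left_mono integrable_on_mult_left\<close>)
  then have "s * T \<le> A * r" unfolding sol_mean[OF s] A_def by simp
  then show ?thesis using T unfolding abar_def by (simp add: field_simps)
qed

text \<open>Strictness survives averaging because \<open>q (u t)\<close> attains its maximum, and
  that maximum is below \<open>r\<close>.\<close>

lemma sol_less:
  assumes q: "continuous_on UNIV q" and s: "sol F q s c u" and r: "\<And>t. t \<in> {0..T} \<Longrightarrow> q (u t) < r"
  shows "s < abar * r"
proof -
  have "continuous_on {0..T} (\<lambda>t. q (u t))"
    by (rule continuous_on_compose2[OF q sol_cont[OF s]]) auto
  then obtain t where t: "t \<in> {0..T}" "\<forall>y\<in>{0..T}. q (u y) \<le> q (u t)"
    using continuous_attains_sup[of "{0..T}" "\<lambda>t. q (u t)"] T by auto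
  have "s \<le> abar * q (u t)" by (rule sol_le[OF q s]) (use t in auto)
  also have "\<dots> < abar * r" using abar_pos r[OF t(1)] by simp
  finally show ?thesis .
qed

text \<open>Being a solution involves \<open>F\<close> and \<open>q\<close> only on the range of
  \<open>u\<close>; this is the passage between truncated and original equations.\<close>

lemma sol_transfer:
  assumes s: "sol F q s c u" and eq: "\<And>t. t \<in> {0..T} \<Longrightarrow> F (u t) = F' (u t) \<and> q (u t) = q' (u t)"
  shows "sol F' q' s c u"
proof -
  have Weq: "W q c s u t = W q' c s u t" if t: "t \<in> {0..T}" for t
  proof -
    have "integral {0..t} (\<lambda>r. a r * q (u r)) = integral {0..t} (\<lambda>r. a r * q' (u r))"
      by (rule Henstock_Kurzweil_Integration.integral_cong) (use t eq in auto)
    then show ?thesis unfolding W_def by simp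
  qed
  have Veq: "V F q c s u t = V F' q' c s u t" if t: "t \<in> {0..T}" for t
    unfolding V_def
  proof (rule Henstock_Kurzweil_Integration.integral_cong)
    fix r assume "r \<in> {0..t}"
    then have r: "r \<in> {0..T}" using t by simp
    show "\<psi> (W q c s u r - F (u r)) = \<psi> (W q' c s u r - F' (u r))"
      using Weq[OF r] eq[OF r] by simp
  qed
  show ?thesis
    unfolding sol_def
  proof (intro conjI ballI)
    show "u t = u 0 + V F' q' c s u t" if "t \<in> {0..T}" for t
      using sol_eq[OF s that] unfolding Veq[OF that] .
    show "W q' c s u T = c" using sol_periodic(2)[OF s] unfolding Weq[OF T_mem(2)] W_0 .
  qed (rule sol_cont[OF s], rule sol_periodic(1)[OF s])
qed

text \<open>Bound for the oscillation of \<open>W\<close>, with \<open>s\<close> an upper bound for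
  the parameter: the linear term contributes \<open>\<bar>s\<bar> * T + m * A\<close>, the forcing
  \<open>2 * E\<close>, and the integral of the \<open>q\<close> term the remaining
  \<open>\<bar>s\<bar> * T + 2 * m * A\<close>.\<close>

definition Kb :: "real \<Rightarrow> real \<Rightarrow> real" where
  "Kb m s = 2 * \<bar>s\<bar> * T + 2 * E + 3 * m * A"

definition Lb :: "real \<Rightarrow> real \<Rightarrow> real" where
  "Lb m s = max (\<psi> (Kb m s)) (- \<psi> (- Kb m s))"

lemma Kb_nonneg: "0 \<le> m \<Longrightarrow> 0 \<le> Kb m s"
  unfolding Kb_def using T E_nonneg A_pos by simp

lemma Lb_nonneg: "0 \<le> m \<Longrightarrow> 0 \<le> Lb m s"
  using psi_abs_le[of 0 "Kb m s"] Kb_nonneg[of m s] unfolding Lb_def psi0 by simp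

text \<open>One-sided control of \<open>q\<close> is enough because the mean is known:
  \<open>a r * (q (u r) + m)\<close> is nonnegative with total integral
  \<open>s * T + m * A\<close>, so its integrals over initial intervals lie between 0 and that
  number.\<close>

lemma W_oscillation:
  assumes q: "continuous_on UNIV q" and s: "sol F q s c u"
    and m: "0 \<le> m" "\<And>z. - m \<le> q z" and s1: "s \<le> s1" and t: "t \<in> {0..T}" "t' \<in> {0..T}"
  shows "W q c s u t - W q c s u t' \<le> Kb m s1"
proof -
  note uc = sol_cont[OF s]
  have I: "- (m * A) \<le> integral {0..x} (\<lambda>r. a r * q (u r)) \<and>
      integral {0..x} (\<lambda>r. a r * q (u r)) \<le> s * T + m * A" if x: "x \<in> {0..T}" for x
  proof -
    let ?g = "\<lambda>r. a r * q (u r) + m * a r"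
    have aqx: "(\<lambda>r. a r * q (u r)) integrable_on {0..x}" and ax: "(\<lambda>r. m * a r) integrable_on {0..x}"
      using integrable_initial[OF aq_integrable[OF q uc]] integrable_initial[OF a_integrable] x
      by (auto intro: integrable_on_mult_right)
    have aqT: "(\<lambda>r. a r * q (u r)) integrable_on {0..T}" and aT: "(\<lambda>r. m * a r) integrable_on {0..T}"
      using aq_integrable[OF q uc] a_integrable by (auto intro: integrable_on_mult_right)
    have g0: "0 \<le> ?g r" for r
    proof -
      have "0 \<le> a r * (q (u r) + m)" using a_nonneg[of r] m(2)[of "u r"] by (intro mult_nonneg_nonneg) auto
      then show ?thesis by (simp add: algebra_simps)
    qed
    have 1: "0 \<le> integral {0..x} ?g"
      by (rule integral_nonneg[OF integrable_add[OF aqx ax]]) (rule g0)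
    have 2: "integral {0..x} ?g \<le> integral {0..T} ?g"
      by (rule integral_subset_le[OF _ integrable_add[OF aqx ax] integrable_add[OF aqT aT]])
        (use x g0 in auto)
    have 3: "0 \<le> integral {0..x} (\<lambda>r. m * a r)"
      by (rule integral_nonneg[OF ax]) (use m a_nonneg in auto)
    have 4: "integral {0..x} (\<lambda>r. m * a r) \<le> integral {0..T} (\<lambda>r. m * a r)"
      by (rule integral_subset_le[OF _ ax aT]) (use x m a_nonneg in auto)
    have 5: "integral {0..T} (\<lambda>r. m * a r) = m * A" unfolding A_def by simp
    show ?thesis
      using 1 2 3 4 sol_mean[OF s]
      unfolding integral_add[OF aqx ax] integral_add[OF aqT aT] 5 by linarith
  qed
  \<comment> \<open>The mean bounds \<open>s\<close> from below too, so the upper bound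
    \<open>s1\<close> controls its absolute value.\<close>
  have low: "- (m * A) \<le> s * T" using I[OF T_mem(2)] sol_mean[OF s] by simp
  have up: "s * T \<le> \<bar>s1\<bar> * T" using s1 T by (intro mult_right_mono) auto
  have "\<bar>s * (t - t')\<bar> \<le> \<bar>s\<bar> * T" using t unfolding abs_mult by (intro mult_left_mono) auto
  also have "\<bar>s\<bar> * T = \<bar>s * T\<bar>" using T by (simp add: abs_mult)
  also have "\<dots> \<le> \<bar>s1\<bar> * T + m * A"
  proof -
    have "0 \<le> m * A" "0 \<le> \<bar>s1\<bar> * T" using m A_pos T by simp_all
    then show ?thesis using low up by linarith
  qed
  finally have st: "\<bar>s * (t - t')\<bar> \<le> \<bar>s1\<bar> * T + m * A" .
  have "W q c s u t - W q c s u t' = s * (t - t') + (integral {0..t} e - integral {0..t'} e)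
     - (integral {0..t} (\<lambda>r. a r * q (u r)) - integral {0..t'} (\<lambda>r. a r * q (u r)))"
    unfolding W_def by (simp add: algebra_simps)
  then show ?thesis
    using st abs_integral_e_le[OF t(1)] abs_integral_e_le[OF t(2)] I[OF t(1)] I[OF t(2)] up
    unfolding Kb_def by linarith
qed

text \<open>At two times where \<open>u\<close> takes the same value the terms \<open>F (u t)\<close> cancel, so the bound on the
  slope does not depend on \<open>F\<close> and survives truncation.\<close>

lemma slope_bound:
  assumes F: "continuous_on UNIV F" and q: "continuous_on UNIV q" and s: "sol F q s c u"
    and m: "0 \<le> m" "\<And>z. - m \<le> q z" and s1: "s \<le> s1" and t: "t \<in> {0..T}"
  shows "\<bar>W q c s u t - F (u t)\<bar> \<le> Kb m s1"
proof -
  let ?u' = "\<lambda>t. \<psi> (W q c s u t - F (u t))"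
  note der = sol_deriv[OF F q s]
  note osc = W_oscillation[OF q s m s1]
  have per: "u 0 = u T" "?u' 0 = ?u' T" using sol_periodic[OF s] by simp_all
  have "\<exists>r\<in>{0..T}. u r = u t \<and> ?u' r \<le> 0"
    by (rule periodic_level_derivative_nonpos[of T u ?u', OF der per T t])
  then obtain r where r: "r \<in> {0..T}" "u r = u t" "?u' r \<le> \<psi> 0" unfolding psi0 by blast
  then have "W q c s u r - F (u t) \<le> 0" using strict_mono_less_eq[OF psi_mono] by simp
  then have 1: "W q c s u t - F (u t) \<le> Kb m s1" using osc[OF t r(1)] by linarith
  have der': "((\<lambda>t. - u t) has_real_derivative - ?u' t) (at t within {0..T})" if "t \<in> {0..T}" for t
    by (rule DERIV_minus[OF der[OF that]])
  have "\<exists>r\<in>{0..T}. - u r = - u t \<and> - ?u' r \<le> 0"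
    by (rule periodic_level_derivative_nonpos[of T "\<lambda>t. - u t" "\<lambda>t. - ?u' t", OF der' _ _ T t])
      (use per in simp_all)
  then obtain r where r: "r \<in> {0..T}" "u r = u t" "\<psi> 0 \<le> ?u' r" unfolding psi0 by auto
  then have "0 \<le> W q c s u r - F (u t)" using strict_mono_less_eq[OF psi_mono] by simp
  then have 2: "- (W q c s u t - F (u t)) \<le> Kb m s1" using osc[OF r(1) t] by linarith
  show ?thesis using 1 2 by linarith
qed

lemma sol_lipschitz:
  assumes F: "continuous_on UNIV F" and q: "continuous_on UNIV q" and s: "sol F q s c u"
    and m: "0 \<le> m" "\<And>z. - m \<le> q z" and s1: "s \<le> s1" and t: "t \<in> {0..T}" "t' \<in> {0..T}"
  shows "\<bar>u t - u t'\<bar> \<le> Lb m s1 * \<bar>t - t'\<bar>"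
proof -
  have "norm (u t - u t') \<le> Lb m s1 * norm (t - t')"
  proof (rule field_differentiable_bound[of "{0..T}"])
    show "norm (\<psi> (W q c s u z - F (u z))) \<le> Lb m s1" if "z \<in> {0..T}" for z
      using psi_abs_le[OF slope_bound[OF F q s m s1 that]] unfolding Lb_def by simp
  qed (use sol_deriv[OF F q s] t in auto)
  then show ?thesis by simp
qed

lemma sol_oscillation:
  assumes F: "continuous_on UNIV F" and q: "continuous_on UNIV q" and s: "sol F q s c u"
    and m: "0 \<le> m" "\<And>z. - m \<le> q z" and s1: "s \<le> s1" and t: "t \<in> {0..T}" "t' \<in> {0..T}"
  shows "\<bar>u t - u t'\<bar> \<le> Lb m s1 * T"
proof -
  have "Lb m s1 * \<bar>t - t'\<bar> \<le> Lb m s1 * T"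
    by (rule mult_left_mono) (use t Lb_nonneg[OF m(1)] in auto)
  then show ?thesis using sol_lipschitz[OF F q s m s1 t] by linarith
qed

text \<open>If the maximum were 0, \<open>d = u0 - u\<close> would be nonnegative with a zero, where
  the slopes and hence the values of \<open>W\<close> agree. To the right, \<open>s > s0\<close>
  separates the two \<open>W\<close> linearly, while the \<open>F\<close> terms differ by at most a
  Lipschitz constant times \<open>d\<close>, which is small compared with the elapsed time. So
  \<open>u\<close> grows faster than \<open>u0\<close> and \<open>d\<close> turns negative.
  \<open>F'\<close> and \<open>q'\<close> will be truncations of \<open>F\<close> and
  \<open>q\<close>.\<close>

lemma no_touching:
  assumes F: "continuous_on UNIV F" and q: "continuous_on UNIV q"
    and F': "continuous_on UNIV F'" and q': "continuous_on UNIV q'"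
    and s0: "sol F q s0 c0 u0" and s: "sol F' q' s c u" and less: "s0 < s"
    and R: "\<And>t. t \<in> {0..T} \<Longrightarrow> \<bar>u0 t\<bar> < R"
    and agree: "\<And>z. \<bar>z\<bar> \<le> R \<Longrightarrow> F' z = F z \<and> q' z = q z"
    and C: "\<And>x y. \<bar>x\<bar> \<le> R \<Longrightarrow> \<bar>y\<bar> \<le> R \<Longrightarrow> \<bar>F x - F y\<bar> \<le> C * \<bar>x - y\<bar>"
  shows "mx (\<lambda>t. u t - u0 t) \<noteq> 0"
proof
  assume mx0: "mx (\<lambda>t. u t - u0 t) = 0"
  note uc = sol_cont[OF s] and u0c = sol_cont[OF s0]
  have uuc: "continuous_on {0..T} (\<lambda>t. u t - u0 t)" by (intro continuous_intros uc u0c)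
  obtain t1 where t1: "t1 \<in> {0..T}" "u t1 - u0 t1 = 0" using mx_attained[OF uuc] mx0 by metis
  \<comment> \<open>By periodicity a touching at \<open>T\<close> is also one at 0, and there is
    time to the right of it.\<close>
  define t0 where "t0 = (if t1 = T then 0 else t1)"
  have t0: "0 \<le> t0" "t0 < T" and tu: "u t0 = u0 t0"
    using t1 T sol_periodic(1)[OF s] sol_periodic(1)[OF s0] by (auto simp: t0_def)
  have t0m: "t0 \<in> {0..T}" using t0 by auto
  define d where "d t = u0 t - u t" for t
  define g where "g t = \<psi> (W q c0 s0 u0 t - F (u0 t)) - \<psi> (W q' c s u t - F' (u t))" for t
  have d0: "0 \<le> d t" if "t \<in> {0..T}" for t
    using mx_upper[OF uuc that] mx0 unfolding d_def by simp
  have dt0: "d t0 = 0" unfolding d_def tu by simp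
  have dd: "(d has_real_derivative g t) (at t within {0..T})" if "t \<in> {0..T}" for t
    unfolding d_def[abs_def] g_def
    by (intro DERIV_diff sol_deriv[OF F q s0 that] sol_deriv[OF F' q' s that])
  have dc: "continuous_on {0..T} d" by (rule DERIV_continuous_on) (rule dd)
  have "g t0 \<ge> 0"
  proof (rule ccontr)
    assume "\<not> g t0 \<ge> 0"
    then have neg: "g t0 < 0" by simp
    obtain h0 where h0: "h0 > 0" "\<And>h. 0 < h \<Longrightarrow> t0 + h \<in> {0..T} \<Longrightarrow> h < h0 \<Longrightarrow> d (t0 + h) < d t0"
      using has_real_derivative_neg_dec_right[OF dd[OF t0m] neg] by blast
    define h where "h = min (h0 / 2) (T - t0)"
    have h: "0 < h" "h < h0" "t0 + h \<in> {0..T}" using h0(1) t0 by (auto simp: h_def)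
    show False using h0(2)[OF h(1,3,2)] d0[OF h(3)] dt0 by simp
  qed
  moreover have left: "g t \<le> 0" if t: "0 < t" "t \<le> T" and dt: "d t = 0" for t
  proof (rule ccontr)
    assume "\<not> g t \<le> 0"
    then have pos: "g t > 0" by simp
    have tm: "t \<in> {0..T}" using t by auto
    obtain h0 where h0: "h0 > 0" "\<And>h. 0 < h \<Longrightarrow> t - h \<in> {0..T} \<Longrightarrow> h < h0 \<Longrightarrow> d (t - h) < d t"
      using has_real_derivative_pos_inc_left[OF dd[OF tm] pos] by blast
    define h where "h = min (h0 / 2) t"
    have h: "0 < h" "h < h0" "t - h \<in> {0..T}" using h0(1) t by (auto simp: h_def min_def)
    show False using h0(2)[OF h(1,3,2)] d0[OF h(3)] dt by simp
  qed
  \<comment> \<open>Time 0 has no left neighbourhood in the period; the sign is taken from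
    \<open>T\<close>, where both slopes are the same as at 0.\<close>
  have "g t0 \<le> 0"
  proof (cases "t0 = 0")
    case True
    have "d T = 0" using dt0 sol_periodic(1)[OF s] sol_periodic(1)[OF s0] unfolding True d_def by simp
    then have "g T \<le> 0" using left[of T] T by simp
    then show ?thesis using sol_periodic[OF s] sol_periodic[OF s0] unfolding True g_def by simp
  next
    case False
    then show ?thesis using left[of t0] t0 dt0 by simp
  qed
  ultimately have g0: "g t0 = 0" by simp
  then have "W q c0 s0 u0 t0 - F (u0 t0) = W q' c s u t0 - F' (u t0)"
    using strict_mono_eq[OF psi_mono] unfolding g_def by simp
  moreover have "F' (u t0) = F (u0 t0)" using agree[of "u t0"] R[OF t0m] tu by simp
  ultimately have W0: "W q' c s u t0 = W q c0 s0 u0 t0" by simp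
  define \<sigma> where "\<sigma> = s - s0"
  have \<sigma>: "\<sigma> > 0" using less by (simp add: \<sigma>_def)
  \<comment> \<open>Of the separation rate \<sigma>, at most half is lost to the difference of the
    \<open>q\<close> terms. Keeping \<open>d\<close> below \<rho> times the elapsed time limits the
    loss through \<open>F\<close> to a further quarter.\<close>
  define \<rho> where "\<rho> = \<sigma> / (4 * (\<bar>C\<bar> + 1))"
  have \<rho>: "\<rho> > 0" using \<sigma> by (simp add: \<rho>_def)
  have C\<rho>: "\<bar>C\<bar> * \<rho> \<le> \<sigma> / 4"
  proof -
    have "\<bar>C\<bar> * \<rho> \<le> (\<bar>C\<bar> + 1) * \<rho>" using \<rho> by (intro mult_right_mono) auto
    also have "\<dots> = \<sigma> / 4" by (simp add: \<rho>_def field_simps)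
    finally show ?thesis .
  qed
  let ?F = "at t0 within {0..T}"
  have ulim: "(u \<longlongrightarrow> u t0) ?F" using uc t0m by (simp add: continuous_on_def)
  have u0lim: "(u0 \<longlongrightarrow> u0 t0) ?F" using u0c t0m by (simp add: continuous_on_def)
  have "\<bar>u t0\<bar> < R" using R[OF t0m] tu by simp
  then have ev1: "\<forall>\<^sub>F t in ?F. \<bar>u t\<bar> < R" by (rule order_tendstoD[OF tendsto_rabs[OF ulim]])
  have "((\<lambda>t. M * \<bar>q (u t) - q (u0 t)\<bar>) \<longlongrightarrow> M * \<bar>q (u t0) - q (u0 t0)\<bar>) ?F"
  proof -
    have "((\<lambda>t. q (u t)) \<longlongrightarrow> q (u t0)) ?F" "((\<lambda>t. q (u0 t)) \<longlongrightarrow> q (u0 t0)) ?F"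
      using continuous_on_tendsto_compose[OF q ulim] continuous_on_tendsto_compose[OF q u0lim] by auto
    then show ?thesis by (intro tendsto_intros)
  qed
  then have ev2: "\<forall>\<^sub>F t in ?F. M * \<bar>q (u t) - q (u0 t)\<bar> < \<sigma> / 2"
    by (rule order_tendstoD) (use \<sigma> tu in simp)
  have "((\<lambda>t. (d t - d t0) / (t - t0)) \<longlongrightarrow> 0) ?F"
    using dd[OF t0m] unfolding has_field_derivative_iff g0 .
  then have ev3: "\<forall>\<^sub>F t in ?F. (d t - d t0) / (t - t0) < \<rho>"
    by (rule order_tendstoD) (use \<rho> in simp)
  have "\<forall>\<^sub>F t in ?F. \<bar>u t\<bar> < R \<and> M * \<bar>q (u t) - q (u0 t)\<bar> < \<sigma> / 2 \<and> (d t - d t0) / (t - t0) < \<rho>"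
    using ev1 ev2 ev3 by (intro eventually_conj)
  then obtain \<eta> where \<eta>: "\<eta> > 0" and near: "\<And>t. t \<in> {0..T} \<Longrightarrow> t \<noteq> t0 \<Longrightarrow> dist t t0 < \<eta> \<Longrightarrow>
      \<bar>u t\<bar> < R \<and> M * \<bar>q (u t) - q (u0 t)\<bar> < \<sigma> / 2 \<and> (d t - d t0) / (t - t0) < \<rho>"
    unfolding eventually_at by blast
  define t2 where "t2 = min (t0 + \<eta> / 2) T"
  have t2: "t0 < t2" "t2 \<le> T" "t2 < t0 + \<eta>" using t0 \<eta> by (auto simp: t2_def)
  have near': "\<bar>u t\<bar> < R \<and> M * \<bar>q (u t) - q (u0 t)\<bar> < \<sigma> / 2 \<and> d t < \<rho> * (t - t0)"
    if "t0 < t" "t \<le> t2" for t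
    using near[of t] that t0 t2 dt0 by (auto simp: dist_real_def pos_divide_less_eq)
  have gneg: "g t < 0" if t: "t0 < t" "t < t2" for t
  proof -
    have tm: "t \<in> {0..T}" using t t0 t2 by auto
    have "\<bar>u t\<bar> < R" and dt: "d t < \<rho> * (t - t0)" using near'[of t] t by auto
    have ut: "F' (u t) = F (u t)" using agree[of "u t"] \<open>\<bar>u t\<bar> < R\<close> by simp
    let ?h1 = "\<lambda>r. a r * q' (u r)" and ?h0 = "\<lambda>r. a r * q (u0 r)"
    have i1: "?h1 integrable_on {0..T}" and i0: "?h0 integrable_on {0..T}"
      by (rule aq_integrable[OF q' uc], rule aq_integrable[OF q u0c])
    have sub: "{t0..t} \<subseteq> {0..T}" using t0 tm by auto
    have j1: "?h1 integrable_on {t0..t}" and j0: "?h0 integrable_on {t0..t}"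
      by (rule integrable_subinterval_real[OF i1 sub], rule integrable_subinterval_real[OF i0 sub])
    have "integral {t0..t} ?h1 \<le> integral {t0..t} (\<lambda>r. ?h0 r + \<sigma> / 2)"
    proof (rule integral_le[OF j1 integrable_add[OF j0 integrable_const_ivl]])
      fix r assume r: "r \<in> {t0..t}"
      have rm: "r \<in> {0..T}" using r sub by auto
      show "?h1 r \<le> ?h0 r + \<sigma> / 2"
      proof (cases "r = t0")
        case True
        then show ?thesis using agree[of "u t0"] R[OF t0m] tu \<sigma> by simp
      next
        case False
        then have n: "\<bar>u r\<bar> < R" "M * \<bar>q (u r) - q (u0 r)\<bar> < \<sigma> / 2" using near'[of r] r t by auto
        have "a r * (q (u r) - q (u0 r)) \<le> a r * \<bar>q (u r) - q (u0 r)\<bar>"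
          using a_nonneg[of r] by (intro mult_left_mono) auto
        also have "\<dots> \<le> M * \<bar>q (u r) - q (u0 r)\<bar>" using a_le[of r] by (intro mult_right_mono) auto
        finally have "a r * (q (u r) - q (u0 r)) < \<sigma> / 2" using n(2) by linarith
        moreover have "q' (u r) = q (u r)" using agree[of "u r"] n(1) by simp
        ultimately show ?thesis by (simp add: algebra_simps)
      qed
    qed
    moreover have "integral {t0..t} (\<lambda>r. ?h0 r + \<sigma> / 2) = integral {t0..t} ?h0 + (t - t0) * (\<sigma> / 2)"
      unfolding integral_add[OF j0 integrable_const_ivl] using t by simp
    ultimately have I: "integral {t0..t} ?h1 - integral {t0..t} ?h0 \<le> (t - t0) * (\<sigma> / 2)" by linarith
    have e1: "integral {0..t} ?h1 - integral {0..t0} ?h1 = integral {t0..t} ?h1"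
      and e0: "integral {0..t} ?h0 - integral {0..t0} ?h0 = integral {t0..t} ?h0"
      using integral_increment[OF i1, of t0 t] integral_increment[OF i0, of t0 t] t t0 tm by auto
    have "W q' c s u t - W q c0 s0 u0 t = (W q' c s u t - W q' c s u t0) - (W q c0 s0 u0 t - W q c0 s0 u0 t0)"
      using W0 by simp
    also have "\<dots> = \<sigma> * (t - t0) - (integral {t0..t} ?h1 - integral {t0..t} ?h0)"
      unfolding e1[symmetric] e0[symmetric] W_def \<sigma>_def by (simp add: algebra_simps)
    finally have "W q' c s u t - W q c0 s0 u0 t = \<sigma> * (t - t0) - (integral {t0..t} ?h1 - integral {t0..t} ?h0)" .
    moreover have "\<sigma> * (t - t0) = (t - t0) * (\<sigma> / 2) + (t - t0) * (\<sigma> / 2)" by (simp add: field_simps)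
    ultimately have Wd: "W q' c s u t - W q c0 s0 u0 t \<ge> (t - t0) * (\<sigma> / 2)"
      using I by linarith
    have "F (u t) - F (u0 t) \<le> C * \<bar>u t - u0 t\<bar>"
      using C[of "u t" "u0 t"] \<open>\<bar>u t\<bar> < R\<close> R[OF tm] by linarith
    also have "\<dots> \<le> \<bar>C\<bar> * d t"
      using d0[OF tm] unfolding d_def by (simp add: abs_minus_commute mult_right_mono)
    also have "\<dots> \<le> \<bar>C\<bar> * (\<rho> * (t - t0))" using dt by (intro mult_left_mono) auto
    also have "\<dots> = (\<bar>C\<bar> * \<rho>) * (t - t0)" by simp
    also have "\<dots> \<le> \<sigma> / 4 * (t - t0)" using C\<rho> t by (intro mult_right_mono) auto
    also have "\<dots> < (t - t0) * (\<sigma> / 2)" using t \<sigma> by simp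
    finally have "W q c0 s0 u0 t - F (u0 t) < W q' c s u t - F' (u t)" using Wd unfolding ut by linarith
    then show ?thesis unfolding g_def using strict_mono_less[OF psi_mono] by simp
  qed
  have "d t2 < d t0"
  proof (rule DERIV_neg_imp_decreasing_open[OF t2(1)])
    fix x assume x: "t0 < x" "x < t2"
    have "x \<in> {0..T}" using x t0 t2 by auto
    moreover have "at x within {0..T} = at x" by (rule at_within_Icc_at) (use x t0 t2 in auto)
    ultimately have "(d has_real_derivative g x) (at x)" using dd[of x] by simp
    then show "\<exists>y. (d has_real_derivative y) (at x) \<and> y < 0" using gneg[OF x] by blast
  qed (rule continuous_on_subset[OF dc], use t0 t2 in auto)
  then show False using d0[of t2] dt0 t0 t2 by auto
qed

end

section \<open>Solutions on either side of a given one\<close>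

definition clip :: "real \<Rightarrow> real \<Rightarrow> real" where
  "clip R z = max (- R) (min R z)"

lemma clip_eq: "\<bar>z\<bar> \<le> R \<Longrightarrow> clip R z = z"
  by (auto simp: clip_def)

lemma continuous_on_clip:
  assumes "continuous_on UNIV (g :: real \<Rightarrow> real)"
  shows "continuous_on UNIV (\<lambda>z. g (clip R z))"
  by (rule continuous_on_compose2[OF assms]) (auto simp: clip_def intro!: continuous_intros)

lemma clip_bounded:
  assumes g: "continuous_on UNIV (g :: real \<Rightarrow> real)" and R: "0 \<le> R"
  obtains B where "\<And>z. \<bar>g (clip R z)\<bar> \<le> B"
proof -
  have "compact (g ` {- R..R})"
    by (rule compact_continuous_image[OF continuous_on_subset[OF g]]) auto
  then have "bounded (g ` {- R..R})" by (rule compact_imp_bounded)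
  then obtain B where "\<forall>y\<in>g ` {- R..R}. norm y \<le> B" unfolding bounded_iff by blast
  moreover have "clip R z \<in> {- R..R}" for z using R by (auto simp: clip_def)
  ultimately show thesis by (intro that[of B]) simp
qed

text \<open>Comparisons with \<open>abar\<close> times a limit become comparisons with the limit
  itself, infinite limits included.\<close>

lemma scaled_less_ereal_iff:
  assumes "0 < b"
  shows "ereal s < ereal b * w \<longleftrightarrow> ereal (s / b) < w"
  using assms by (cases w) (auto simp: field_simps)

lemma continuous_bounded_below:
  fixes q :: "real \<Rightarrow> real"
  assumes q: "continuous_on UNIV q"
    and m: "\<forall>\<^sub>F z in at_bot. r \<le> q z" and p: "\<forall>\<^sub>F z in at_top. r' \<le> q z"
  obtains b where "0 \<le> b" "\<And>z. - b \<le> q z"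
proof -
  obtain N1 where N1: "\<And>z. z \<le> N1 \<Longrightarrow> r \<le> q z" using m unfolding eventually_at_bot_linorder by blast
  obtain N2 where N2: "\<And>z. N2 \<le> z \<Longrightarrow> r' \<le> q z" using p unfolding eventually_at_top_linorder by blast
  define R where "R = max \<bar>N1\<bar> \<bar>N2\<bar>"
  have R0: "0 \<le> R" by (simp add: R_def)
  obtain B where B: "\<And>z. \<bar>q (clip R z)\<bar> \<le> B" using clip_bounded[OF q R0] by blast
  define b where "b = max B (max \<bar>r\<bar> \<bar>r'\<bar>)"
  have "- b \<le> q z" for z
  proof -
    consider "z \<le> N1" | "N2 \<le> z" | "\<bar>z\<bar> \<le> R" unfolding R_def by linarith
    then show ?thesis
    proof cases
      case 1
      then show ?thesis using N1[of z] unfolding b_def by linarith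
    next
      case 2
      then show ?thesis using N2[of z] unfolding b_def by linarith
    next
      case 3
      then show ?thesis using B[of z] unfolding clip_eq[OF 3] b_def by linarith
    qed
  qed
  then show thesis by (intro that[of b]) (auto simp: b_def)
qed

context wave_equation
begin

text \<open>With \<open>X = 0\<close> the clamp interval is a single point, so the maximum of
  \<open>u\<close> is exactly \<open>l\<close> and the parameter \<open>s\<close> is an output. This
  supplies a first solvable parameter.\<close>

lemma existence_level:
  assumes F: "continuous_on UNIV F" and q: "continuous_on UNIV q" and Q: "\<And>z. \<bar>q z\<bar> \<le> Q"
  obtains c s u where "sol F q s c u"
    "\<forall>t\<in>{0..T}. l - Lb Q (abar * Q) * T \<le> u t \<and> u t \<le> l"
proof -
  have Q0: "0 \<le> Q" and Ql: "- Q \<le> q z" and Qu: "q z \<le> Q" for z using Q[of 0] Q[of z] by linarith+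
  define L where "L = Lb Q (abar * Q) * T"
  have L0: "0 \<le> L" using Lb_nonneg[OF Q0] T by (simp add: L_def)
  \<comment> \<open>\<open>L\<close> depends on the bound for \<open>q\<close> and not on
    \<open>F\<close>, so the truncation radius for \<open>F\<close> can be built from it without
    circularity.\<close>
  define R where "R = \<bar>l\<bar> + L"
  have R0: "0 \<le> R" using L0 by (simp add: R_def)
  obtain B where B: "\<And>z. \<bar>F (clip R z)\<bar> \<le> B" using clip_bounded[OF F R0] by blast
  have Fc: "continuous_on UNIV (\<lambda>z. F (clip R z))" by (rule continuous_on_clip[OF F])
  obtain c s u where s: "sol (\<lambda>z. F (clip R z)) q s c u"
    and mu: "0 \<le> 1 * mx (\<lambda>t. u t - l)" "1 * mx (\<lambda>t. u t - l) \<le> 0"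
    by (rule existence[OF Fc B q Q, of 0 1 "\<lambda>_. l"]) auto
  have uc: "continuous_on {0..T} (\<lambda>t. u t - l)" by (intro continuous_intros sol_cont[OF s])
  obtain t1 where t1: "t1 \<in> {0..T}" "u t1 = l"
    using mx_attained[OF uc] mu by (metis eq_iff_diff_eq_0 mult_1 order_antisym)
  have up: "u t \<le> l" if "t \<in> {0..T}" for t using mx_upper[OF uc that] mu by simp
  have "s \<le> abar * Q" by (rule sol_le[OF q s]) (rule Qu)
  from sol_oscillation[OF Fc q s Q0 Ql this]
  have low: "l - L \<le> u t" if "t \<in> {0..T}" for t
    using that t1 unfolding L_def by (smt (verit))
  show thesis
  proof (rule that)
    show "sol F q s c u"
    proof (rule sol_transfer[OF s])
      fix t assume t: "t \<in> {0..T}"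
      have "\<bar>u t\<bar> \<le> R" using up[OF t] low[OF t] L0 unfolding R_def by linarith
      then show "F (clip R (u t)) = F (u t) \<and> q (u t) = q (u t)" by (simp add: clip_eq)
    qed
    show "\<forall>t\<in>{0..T}. l - Lb Q (abar * Q) * T \<le> u t \<and> u t \<le> l"
      using up low unfolding L_def by simp
  qed
qed

text \<open>Here \<open>s0\<close> belongs to the known solution and \<open>s\<close> is the target.
  The sign selects the side: 1 gives a solution exceeding \<open>u0\<close> somewhere, -1 one below
  \<open>u0\<close> everywhere.\<close>

lemma solution_beside:
  assumes F: "continuous_on UNIV F" and q: "continuous_on UNIV q"
    and lip: "\<And>R. \<exists>C. \<forall>x y. \<bar>x\<bar> \<le> R \<longrightarrow> \<bar>y\<bar> \<le> R \<longrightarrow> \<bar>F x - F y\<bar> \<le> C * \<bar>x - y\<bar>"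
    and m: "0 \<le> m" "\<And>z. - m \<le> q z"
    and s0: "sol F q s0 c0 u0" and less: "s0 < s" and sg: "sg \<in> {1,-1}"
    and r: "s < abar * r" and N: "\<And>z. N \<le> sg * z \<Longrightarrow> r \<le> q z"
  obtains c u where "sol F q s c u" "0 < sg * mx (\<lambda>t. u t - u0 t)"
proof -
  note u0c = sol_cont[OF s0]
  define L where "L = Lb m s * T"
  have L0: "0 \<le> L" using Lb_nonneg[OF m(1)] T by (simp add: L_def)
  obtain B0 where B0: "0 < B0" "\<And>t. t \<in> {0..T} \<Longrightarrow> \<bar>u0 t\<bar> < B0"
  proof -
    have "bounded (u0 ` {0..T})" using compact_continuous_image[OF u0c] by (intro compact_imp_bounded) auto
    then obtain b where b: "\<forall>y\<in>u0 ` {0..T}. norm y \<le> b" unfolding bounded_iff by blast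
    have "\<bar>u0 t\<bar> < \<bar>b\<bar> + 1" if "t \<in> {0..T}" for t
    proof -
      have "norm (u0 t) \<le> b" using b that by blast
      then show ?thesis by simp
    qed
    then show thesis by (intro that[of "\<bar>b\<bar> + 1"]) auto
  qed
  \<comment> \<open>Reaching the upper end \<open>X\<close> must force \<open>sg * u\<close> past
    \<open>N\<close> at all times: \<open>B0\<close> absorbs \<open>u0\<close>, and \<open>L\<close>
    absorbs the oscillation of \<open>u\<close>.\<close>
  define X where "X = max 0 N + B0 + L"
  have X0: "0 \<le> X" using B0 L0 by (simp add: X_def)
  define R where "R = X + B0 + L"
  have R0: "0 \<le> R" using X0 B0 L0 by (simp add: R_def)
  define F' where "F' = (\<lambda>z. F (clip R z))"
  define q' where "q' = (\<lambda>z. q (clip R z))"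
  have Fc: "continuous_on UNIV F'" and qc: "continuous_on UNIV q'"
    unfolding F'_def q'_def by (rule continuous_on_clip[OF F], rule continuous_on_clip[OF q])
  have agree: "F' z = F z \<and> q' z = q z" if "\<bar>z\<bar> \<le> R" for z
    using that by (simp add: F'_def q'_def clip_eq)
  obtain B where B: "\<And>z. \<bar>F' z\<bar> \<le> B" using clip_bounded[OF F R0] unfolding F'_def by blast
  obtain Q where Q: "\<And>z. \<bar>q' z\<bar> \<le> Q" using clip_bounded[OF q R0] unfolding q'_def by blast
  have m': "- m \<le> q' z" for z unfolding q'_def by (rule m(2))
  obtain C where C: "\<And>x y. \<bar>x\<bar> \<le> R \<Longrightarrow> \<bar>y\<bar> \<le> R \<Longrightarrow> \<bar>F x - F y\<bar> \<le> C * \<bar>x - y\<bar>"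
    using lip[of R] by blast
  have u0R: "\<bar>u0 t\<bar> < R" if "t \<in> {0..T}" for t using B0(2)[OF that] X0 L0 unfolding R_def by linarith
  obtain c s' u where su: "sol F' q' s' c u"
    and mu: "0 \<le> sg * mx (\<lambda>t. u t - u0 t)" "sg * mx (\<lambda>t. u t - u0 t) \<le> X"
      "s < s' \<Longrightarrow> mx (\<lambda>t. u t - u0 t) = 0" "s' < s \<Longrightarrow> sg * mx (\<lambda>t. u t - u0 t) = X"
    by (rule existence[OF Fc B qc Q X0 sg u0c, where ?s0.0 = s]) blast
  let ?\<mu> = "mx (\<lambda>t. u t - u0 t)"
  have touch: "?\<mu> \<noteq> 0" if "s0 < s'"
    by (rule no_touching[OF F q Fc qc s0 su that u0R agree C])
  \<comment> \<open>This has to precede the estimates of \<open>u\<close>, because the oscillation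
    bound \<open>L\<close> is valid for parameters up to \<open>s\<close>.\<close>
  have s's: "s' \<le> s"
  proof (rule ccontr)
    assume "\<not> s' \<le> s"
    then show False using mu(3) touch less by simp
  qed
  have uc: "continuous_on {0..T} (\<lambda>t. u t - u0 t)" by (intro continuous_intros sol_cont[OF su] u0c)
  obtain t1 where t1: "t1 \<in> {0..T}" "?\<mu> = u t1 - u0 t1" using mx_attained[OF uc] by metis
  have osc: "\<bar>u t - u t1\<bar> \<le> L" if "t \<in> {0..T}" for t
    unfolding L_def by (rule sol_oscillation[OF Fc qc su m(1) m' s's that t1(1)])
  have \<mu>X: "\<bar>?\<mu>\<bar> \<le> X" using sg mu(1,2) by auto
  have uR: "\<bar>u t\<bar> \<le> R" if "t \<in> {0..T}" for t
    using osc[OF that] \<mu>X t1(2) B0(2)[OF t1(1)] unfolding R_def by linarith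
  have "\<not> s' < s"
  proof
    assume l: "s' < s"
    \<comment> \<open>For \<open>sg = 1\<close> the maximum locates \<open>u\<close> at one point
      and the oscillation bound carries the estimate to the others; for \<open>sg = - 1\<close> the
      maximum controls every point at once.\<close>
    have far: "N \<le> sg * u t" if t: "t \<in> {0..T}" for t
    proof (cases "sg = 1")
      case True
      then have "u t1 - u0 t1 = X" using mu(4)[OF l] t1(2) by simp
      then show ?thesis using True osc[OF t] B0(2)[OF t1(1)] unfolding X_def by (simp add: abs_le_iff) linarith
    next
      case False
      then have sg1: "sg = - 1" using sg by auto
      then have "?\<mu> = - X" using mu(4)[OF l] by simp
      then have "u t - u0 t \<le> - X" using mx_upper[OF uc t] by simp
      then show ?thesis using sg1 B0(2)[OF t] L0 unfolding X_def by (simp add: abs_less_iff) linarith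
    qed
    have "abar * r \<le> s'"
    proof (rule sol_ge[OF qc su])
      fix t assume t: "t \<in> {0..T}"
      show "r \<le> q' (u t)" using N[OF far[OF t]] agree[OF uR[OF t]] by simp
    qed
    then show False using r l by simp
  qed
  then have eq: "s' = s" using s's by simp
  show thesis
  proof (rule that)
    show "sol F q s c u"
      by (rule sol_transfer[OF su[unfolded eq]]) (use agree uR in blast)
    have "?\<mu> \<noteq> 0" using touch less eq by simp
    then have "sg * ?\<mu> \<noteq> 0" using sg by auto
    then show "0 < sg * ?\<mu>" using mu(1) by linarith
  qed
qed

text \<open>Truncation at \<open>R\<close> supplies the bounds on \<open>F\<close> and
  \<open>q\<close> for the compactness argument. The constants \<gamma> stay bounded because the
  slope bound at time 0 controls their distance from the truncated \<open>F (u 0)\<close>.\<close>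

lemma solutions_closed:
  assumes F: "continuous_on UNIV F" and q: "continuous_on UNIV q"
    and m: "0 \<le> m" "\<And>z. - m \<le> q z"
    and s: "\<And>j. sol F q (\<sigma> j) (\<gamma> j) (u j)" and lim: "\<sigma> \<longlonglongrightarrow> s0"
    and bound: "\<And>j t. t \<in> {0..T} \<Longrightarrow> \<bar>u j t\<bar> \<le> R"
  shows "\<exists>c w. sol F q s0 c w"
proof -
  have R0: "0 \<le> R" using bound[OF T_mem(1), of 0] by linarith
  define F' where "F' = (\<lambda>z. F (clip R z))"
  define q' where "q' = (\<lambda>z. q (clip R z))"
  have Fc: "continuous_on UNIV F'" and qc: "continuous_on UNIV q'"
    unfolding F'_def q'_def by (rule continuous_on_clip[OF F], rule continuous_on_clip[OF q])
  have agree: "F' z = F z \<and> q' z = q z" if "\<bar>z\<bar> \<le> R" for z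
    using that by (simp add: F'_def q'_def clip_eq)
  obtain B where B: "\<And>z. \<bar>F' z\<bar> \<le> B" using clip_bounded[OF F R0] unfolding F'_def by blast
  obtain Q where Q: "\<And>z. \<bar>q' z\<bar> \<le> Q" using clip_bounded[OF q R0] unfolding q'_def by blast
  have m': "- m \<le> q' z" for z unfolding q'_def by (rule m(2))
  have s': "sol F' q' (\<sigma> j) (\<gamma> j) (u j)" for j
    by (rule sol_transfer[OF s]) (use agree bound in simp)
  obtain S where S: "\<And>j. \<bar>\<sigma> j\<bar> \<le> S"
    using convergent_imp_Bseq[of \<sigma>] lim by (auto simp: convergent_def Bseq_def)
  have \<sigma>S: "\<sigma> j \<le> S" for j using S[of j] by linarith
  define P where "P = max R (max (Kb m S + B) S)"
  have bd: "\<bar>u j 0\<bar> \<le> P \<and> \<bar>\<gamma> j\<bar> \<le> P \<and> \<bar>\<sigma> j\<bar> \<le> P" for j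
  proof -
    have "\<bar>\<gamma> j - F' (u j 0)\<bar> \<le> Kb m S"
      using slope_bound[OF Fc qc s' m(1) m' \<sigma>S T_mem(1), of j] by simp
    then have "\<bar>\<gamma> j\<bar> \<le> Kb m S + B" using B[of "u j 0"] by linarith
    then show ?thesis using bound[OF T_mem(1), of j] S[of j] unfolding P_def by linarith
  qed
  have Lip: "\<bar>u j t - u j t'\<bar> \<le> Lb m S * \<bar>t - t'\<bar>" if "t \<in> {0..T}" "t' \<in> {0..T}" for j t t'
    by (rule sol_lipschitz[OF Fc qc s' m(1) m' \<sigma>S that])
  have ueq: "u j t = u j 0 + V F' q' (\<gamma> j) (\<sigma> j) (u j) t" if "t \<in> {0..T}" for j t
    by (rule sol_eq[OF s' that])
  have zero: "\<bar>u j t - u j t\<bar> \<le> (\<lambda>_. 0) j" for j t by simp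
  obtain k p' c' s' w d where k: "strict_mono (k :: nat \<Rightarrow> nat)"
    and lims: "(\<lambda>j. u (k j) 0) \<longlonglongrightarrow> p'" "(\<lambda>j. \<gamma> (k j)) \<longlonglongrightarrow> c'" "(\<lambda>j. \<sigma> (k j)) \<longlonglongrightarrow> s'"
    and w: "continuous_on {0..T} w" and d: "d \<longlonglongrightarrow> 0" "\<forall>j. \<forall>t\<in>{0..T}. \<bar>u (k j) t - w t\<bar> \<le> d j"
    and weq: "\<forall>t\<in>{0..T}. w t = p' + V F' q' c' s' w t"
    and Wl: "\<forall>t\<in>{0..T}. (\<lambda>j. W q' (\<gamma> (k j)) (\<sigma> (k j)) (u (k j)) t) \<longlonglongrightarrow> W q' c' s' w t"
    by (rule compactness[OF Fc B qc Q bd Lip sol_cont[OF s] ueq zero tendsto_const])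
  have "s' = s0" using LIMSEQ_unique[OF lims(3)] LIMSEQ_subseq_LIMSEQ[OF lim k] by (simp add: comp_def)
  have ulim: "(\<lambda>j. u (k j) t) \<longlonglongrightarrow> w t" if t: "t \<in> {0..T}" for t
    by (rule LIM_zero_cancel, rule Lim_null_comparison[OF _ d(1)]) (use d(2) t in auto)
  have w0: "w 0 = p'" using weq T_mem by simp
  have wT: "w T = p'"
    using LIMSEQ_unique[OF ulim[OF T_mem(2)]] lims(1) unfolding sol_periodic(1)[OF s] by blast
  have "W q' (\<gamma> (k j)) (\<sigma> (k j)) (u (k j)) T = \<gamma> (k j)" for j
    using sol_periodic(2)[OF s'] by simp
  then have WTw: "W q' c' s' w T = c'"
    using LIMSEQ_unique[OF Wl[rule_format, OF T_mem(2)]] lims(2) by simp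
  have sw: "sol F' q' s' c' w" unfolding sol_def w0 using w weq wT WTw by blast
  have wR: "\<bar>w t\<bar> \<le> R" if t: "t \<in> {0..T}" for t
    by (rule LIMSEQ_le_const2[OF tendsto_rabs[OF ulim[OF t]]]) (use bound[OF t] in auto)
  have "sol F q s' c' w" by (rule sol_transfer[OF sw]) (use agree wR in simp)
  then show ?thesis unfolding \<open>s' = s0\<close> by blast
qed

end

section \<open>The threshold parameter and multiplicity\<close>

lemma ereal_less_real_between:
  assumes "ereal x < w"
  obtains r :: real where "x < r" "ereal r < w"
  using ereal_dense2[OF assms] by auto

lemma eventually_at_bot_greater:
  fixes q :: "real \<Rightarrow> real"
  assumes "((\<lambda>u. ereal (q u)) \<longlongrightarrow> w) at_bot" "ereal r < w"
  obtains N where "\<forall>z\<le>N. r \<le> q z"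
proof -
  have "\<forall>\<^sub>F z in at_bot. ereal r < ereal (q z)" by (rule order_tendstoD(1)[OF assms])
  then obtain N where "\<forall>z\<le>N. ereal r < ereal (q z)" unfolding eventually_at_bot_linorder by blast
  then show thesis by (intro that[of N]) (simp add: less_imp_le)
qed

lemma eventually_at_top_greater:
  fixes q :: "real \<Rightarrow> real"
  assumes "((\<lambda>u. ereal (q u)) \<longlongrightarrow> w) at_top" "ereal r < w"
  obtains N where "\<forall>z\<ge>N. r \<le> q z"
proof -
  have "\<forall>\<^sub>F z in at_top. ereal r < ereal (q z)" by (rule order_tendstoD(1)[OF assms])
  then obtain N where "\<forall>z\<ge>N. ereal r < ereal (q z)" unfolding eventually_at_top_linorder by blast
  then show thesis by (intro that[of N]) (simp add: less_imp_le)
qed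

context wave_equation
begin

text \<open>Existence and multiplicity rest on one reference solution \<open>u0\<close> at the
  infimum \<open>s0\<close> of the solvable parameters. Two solutions obtained beside it are
  distinct because one lies under \<open>u0\<close> everywhere and the other exceeds it
  somewhere.\<close>

theorem ambrosetti_prodi:
  fixes \<omega>m \<omega>p :: ereal
  assumes F: "continuous_on UNIV F" and q: "continuous_on UNIV q"
    and lip: "\<And>R. \<exists>C. \<forall>x y. \<bar>x\<bar> \<le> R \<longrightarrow> \<bar>y\<bar> \<le> R \<longrightarrow> \<bar>F x - F y\<bar> \<le> C * \<bar>x - y\<bar>"
    and lim_m: "((\<lambda>u. ereal (q u)) \<longlongrightarrow> \<omega>m) at_bot"
    and lim_p: "((\<lambda>u. ereal (q u)) \<longlongrightarrow> \<omega>p) at_top"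
    and below_m: "\<forall>u\<le>-D. ereal (q u) < \<omega>m"
    and below_p: "\<forall>u\<ge>D. ereal (q u) < \<omega>p"
    and min_fin: "min \<omega>m \<omega>p < \<infinity>"
  shows "\<exists>s0. ereal s0 < ereal abar * \<omega>m \<and>
     (\<forall>s<s0. \<not> (\<exists>c u. sol F q s c u)) \<and>
     (\<exists>c u. sol F q s0 c u) \<and>
     (\<forall>s. s0 < s \<and> ereal s < ereal abar * \<omega>m \<longrightarrow> (\<exists>c u. sol F q s c u)) \<and>
     (\<forall>s. s0 < s \<and> ereal s < ereal abar * min \<omega>m \<omega>p \<longrightarrow>
        (\<exists>c1 u1 c2 u2. sol F q s c1 u1 \<and> sol F q s c2 u2 \<and> (\<exists>t\<in>{0..T}. u1 t \<noteq> u2 t)))"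
proof -
  note scaled = scaled_less_ereal_iff[OF abar_pos]
  have qD: "ereal (q (- D)) < \<omega>m" "ereal (q D) < \<omega>p" using below_m below_p by auto
  \<comment> \<open>Each limit exceeds some value of \<open>q\<close>, so \<open>q\<close> is
    bounded below near both infinities and, by compactness, everywhere.\<close>
  obtain m where m: "0 \<le> m" "\<And>z. - m \<le> q z"
  proof -
    obtain N1 where "\<forall>z\<le>N1. q (- D) \<le> q z" by (rule eventually_at_bot_greater[OF lim_m qD(1)])
    then have 1: "\<forall>\<^sub>F z in at_bot. q (- D) \<le> q z" unfolding eventually_at_bot_linorder by blast
    obtain N2 where "\<forall>z\<ge>N2. q D \<le> q z" by (rule eventually_at_top_greater[OF lim_p qD(2)])
    then have 2: "\<forall>\<^sub>F z in at_top. q D \<le> q z" unfolding eventually_at_top_linorder by blast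
    show thesis using continuous_bounded_below[OF q 1 2] that by blast
  qed
  define S where "S = {s. \<exists>c u. sol F q s c u}"
  have bdd: "bdd_below S"
  proof (rule bdd_belowI)
    fix s assume "s \<in> S"
    then obtain c u where "sol F q s c u" unfolding S_def by blast
    then show "abar * (- m) \<le> s" by (rule sol_ge[OF q]) (rule m(2))
  qed
  have nonempty: "\<exists>s\<in>S. ereal s < ereal abar * \<omega>m"
  proof (cases "\<omega>m = \<infinity>")
    case False
    then obtain w where w: "\<omega>m = ereal w" using qD(1) by (cases \<omega>m) auto
    \<comment> \<open>Freezing \<open>q\<close> to the right of \<open>- D\<close> makes it smaller
      than \<open>w\<close> everywhere, so the mean gives \<open>s < abar * w\<close>; a solution
      with values at most \<open>- D\<close> does not see the change.\<close>
    define q1 where "q1 z = q (min z (- D))" for z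
    have q1c: "continuous_on UNIV q1" unfolding q1_def
      by (rule continuous_on_compose2[OF q]) (auto intro!: continuous_intros)
    have up: "q1 z < w" for z using below_m unfolding q1_def w by simp
    have Q: "\<bar>q1 z\<bar> \<le> max m \<bar>w\<bar>" for z using up[of z] m(2)[of "min z (- D)"] unfolding q1_def by linarith
    let ?Q = "max m \<bar>w\<bar>"
    obtain c s u where s: "sol F q1 s c u"
      and u: "\<forall>t\<in>{0..T}. - D - Lb ?Q (abar * ?Q) * T \<le> u t \<and> u t \<le> - D"
      by (rule existence_level[OF F q1c Q, of "- D"])
    have "sol F q s c u" by (rule sol_transfer[OF s]) (use u in \<open>simp add: q1_def min_absorb1\<close>)
    moreover have "s < abar * w" by (rule sol_less[OF q1c s]) (rule up)
    ultimately show ?thesis unfolding S_def w by auto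
  next
    case True
    then obtain w where w: "\<omega>p = ereal w" using min_fin qD(2) by (cases \<omega>p) auto
    \<comment> \<open>Now the finite limit is at the other end, and every real parameter lies below
      \<open>abar * \<infinity>\<close>. The level is raised by the oscillation bound, so that the
      solution stays at or above \<open>D\<close>, where \<open>q1\<close> and \<open>q\<close>
      agree.\<close>
    define q1 where "q1 z = q (max z D)" for z
    have q1c: "continuous_on UNIV q1" unfolding q1_def
      by (rule continuous_on_compose2[OF q]) (auto intro!: continuous_intros)
    have up: "q1 z < w" for z using below_p unfolding q1_def w by simp
    have Q: "\<bar>q1 z\<bar> \<le> max m \<bar>w\<bar>" for z using up[of z] m(2)[of "max z D"] unfolding q1_def by linarith
    let ?Q = "max m \<bar>w\<bar>"
    obtain c s u where s: "sol F q1 s c u"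
      and u: "\<forall>t\<in>{0..T}. D + Lb ?Q (abar * ?Q) * T - Lb ?Q (abar * ?Q) * T \<le> u t \<and>
        u t \<le> D + Lb ?Q (abar * ?Q) * T"
      by (rule existence_level[OF F q1c Q])
    have "sol F q s c u"
    proof (rule sol_transfer[OF s])
      fix t assume "t \<in> {0..T}"
      then have "D \<le> u t" using u by simp
      then show "F (u t) = F (u t) \<and> q1 (u t) = q (u t)" by (simp add: q1_def max_absorb1)
    qed
    then show ?thesis unfolding S_def True using abar_pos by auto
  qed
  define s0 where "s0 = Inf S"
  have s0_le: "s0 \<le> s" if "s \<in> S" for s unfolding s0_def using cInf_lower[OF that bdd] .
  have s0m: "ereal s0 < ereal abar * \<omega>m"
  proof -
    obtain s where s: "s \<in> S" "ereal s < ereal abar * \<omega>m" using nonempty by blast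
    then show ?thesis using s0_le[OF s(1)] by (meson ereal_less_eq(3) le_less_trans)
  qed
  have "\<exists>c u. sol F q s0 c u"
  proof -
    \<comment> \<open>For parameters close to \<open>s0\<close> a solution cannot lie entirely at or
      below \<open>N\<close>: the mean would then give \<open>s \<ge> abar * r\<close>.\<close>
    obtain r where r: "s0 / abar < r" "ereal r < \<omega>m"
      using ereal_less_real_between s0m unfolding scaled by metis
    obtain N where N: "\<forall>z\<le>N. r \<le> q z" by (rule eventually_at_bot_greater[OF lim_m r(2)])
    have s0r: "s0 < abar * r" using r(1) abar_pos by (simp add: field_simps)
    \<comment> \<open>The counterpart above. If \<open>\<omega>p\<close> exceeds
      \<open>s0 / abar\<close>, the mean excludes large solutions as before. Otherwise a solution
      staying at or above \<open>D\<close> would have a parameter below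
      \<open>abar * \<omega>p\<close>, hence below \<open>s0\<close>, contradicting
      \<open>s0 \<le> s\<close>.\<close>
    obtain N' s1 where N': "s0 < s1"
      "\<And>s c u. sol F q s c u \<Longrightarrow> s0 \<le> s \<Longrightarrow> s < s1 \<Longrightarrow> \<exists>t\<in>{0..T}. u t < N'"
    proof (cases "ereal (s0 / abar) < \<omega>p")
      case True
      then obtain r' where r': "s0 / abar < r'" "ereal r' < \<omega>p" using ereal_less_real_between by metis
      obtain N2 where N2: "\<forall>z\<ge>N2. r' \<le> q z" by (rule eventually_at_top_greater[OF lim_p r'(2)])
      show thesis
      proof (rule that[of "abar * r'" N2])
        show "s0 < abar * r'" using r'(1) abar_pos by (simp add: field_simps)
        fix s c u assume s: "sol F q s c u" "s < abar * r'"
        show "\<exists>t\<in>{0..T}. u t < N2"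
        proof (rule ccontr)
          assume "\<not> (\<exists>t\<in>{0..T}. u t < N2)"
          then have "N2 \<le> u t" if "t \<in> {0..T}" for t using that by force
          then have "abar * r' \<le> s" by (intro sol_ge[OF q s(1)] N2[rule_format])
          then show False using s(2) by simp
        qed
      qed
    next
      case False
      then obtain w where w: "\<omega>p = ereal w" using qD(2) by (cases \<omega>p) auto
      show thesis
      proof (rule that[of "s0 + 1" D])
        fix s c u assume s: "sol F q s c u" "s0 \<le> s"
        show "\<exists>t\<in>{0..T}. u t < D"
        proof (rule ccontr)
          assume "\<not> (\<exists>t\<in>{0..T}. u t < D)"
          then have "D \<le> u t" if "t \<in> {0..T}" for t using that by force
          then have "q (u t) < w" if "t \<in> {0..T}" for t using below_p that unfolding w by simp
          then have "s < abar * w" by (rule sol_less[OF q s(1)])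
          moreover have "abar * w \<le> s0" using False abar_pos unfolding w by (simp add: field_simps)
          ultimately show False using s(2) by simp
        qed
      qed simp
    qed
    \<comment> \<open>Keeps the parameters below both thresholds, \<open>abar * r\<close> and
      \<open>s1\<close>, while forcing them to converge to \<open>s0\<close>.\<close>
    define \<epsilon> where "\<epsilon> j = min (abar * r - s0) (min (s1 - s0) (inverse (real (Suc j))))" for j
    have "\<exists>s c u. sol F q s c u \<and> s < s0 + \<epsilon> j" for j
    proof -
      have "Inf S < s0 + \<epsilon> j" using s0r N'(1) by (simp add: s0_def[symmetric] \<epsilon>_def)
      then obtain s where "s \<in> S" "s < s0 + \<epsilon> j" using cInf_lessD nonempty by (metis empty_iff)
      then show ?thesis unfolding S_def by blast
    qed
    then obtain \<sigma> \<gamma> u where s: "\<And>j. sol F q (\<sigma> j) (\<gamma> j) (u j)" and \<sigma>: "\<And>j. \<sigma> j < s0 + \<epsilon> j"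
      by metis
    have \<sigma>0: "s0 \<le> \<sigma> j" for j by (rule s0_le) (use s in \<open>auto simp: S_def\<close>)
    have \<sigma>r: "\<sigma> j < abar * r" and \<sigma>1: "\<sigma> j < s1" and \<sigma>l: "\<sigma> j - s0 \<le> inverse (real (Suc j))" for j
      using \<sigma>[of j] unfolding \<epsilon>_def by linarith+
    have lim: "\<sigma> \<longlonglongrightarrow> s0"
      by (rule LIM_zero_cancel, rule Lim_null_comparison[OF _ LIMSEQ_inverse_real_of_nat])
        (use \<sigma>l \<sigma>0 in auto)
    define L where "L = Lb m (abar * r) * T"
    have osc: "\<bar>u j t - u j t'\<bar> \<le> L" if "t \<in> {0..T}" "t' \<in> {0..T}" for j t t'
      unfolding L_def by (rule sol_oscillation[OF F q s m less_imp_le[OF \<sigma>r] that])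
    show ?thesis
    proof (rule solutions_closed[OF F q m s lim])
      fix j t assume t: "t \<in> {0..T}"
      have "\<exists>t'\<in>{0..T}. N < u j t'"
      proof (rule ccontr)
        assume "\<not> (\<exists>t'\<in>{0..T}. N < u j t')"
        then have "u j t' \<le> N" if "t' \<in> {0..T}" for t' using that by force
        then have "abar * r \<le> \<sigma> j" by (intro sol_ge[OF q s] N[rule_format])
        then show False using \<sigma>r[of j] by simp
      qed
      then obtain t1 where t1: "t1 \<in> {0..T}" "N < u j t1" by blast
      obtain t2 where t2: "t2 \<in> {0..T}" "u j t2 < N'" using N'(2)[OF s \<sigma>0 \<sigma>1] by blast
      show "\<bar>u j t\<bar> \<le> \<bar>N\<bar> + \<bar>N'\<bar> + L"
        using osc[OF t t1(1), of j] osc[OF t t2(1), of j] t1(2) t2(2) by linarith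
    qed
  qed
  then obtain c0 u0 where u0: "sol F q s0 c0 u0" by blast
  have lower: "\<exists>c u. sol F q s c u \<and> (\<forall>t\<in>{0..T}. u t < u0 t)"
    if s: "s0 < s" "ereal s < ereal abar * \<omega>m" for s
  proof -
    obtain r where r: "s / abar < r" "ereal r < \<omega>m"
      using ereal_less_real_between s(2) unfolding scaled by metis
    obtain N where N: "\<forall>z\<le>N. r \<le> q z" by (rule eventually_at_bot_greater[OF lim_m r(2)])
    have sr: "s < abar * r" using r(1) abar_pos by (simp add: field_simps)
    have sg: "- 1 \<in> {1, - 1 :: real}" by simp
    have N': "r \<le> q z" if "- N \<le> - 1 * z" for z using N that by simp
    obtain c u where u: "sol F q s c u" "0 < - 1 * mx (\<lambda>t. u t - u0 t)"
      by (rule solution_beside[OF F q lip m u0 s(1) sg sr N'])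
    have "continuous_on {0..T} (\<lambda>t. u t - u0 t)"
      by (intro continuous_intros sol_cont[OF u(1)] sol_cont[OF u0])
    then have "u t < u0 t" if "t \<in> {0..T}" for t using mx_upper[of "\<lambda>t. u t - u0 t" t] u(2) that by simp
    then show ?thesis using u(1) by blast
  qed
  have upper: "\<exists>c u. sol F q s c u \<and> (\<exists>t\<in>{0..T}. u0 t < u t)"
    if s: "s0 < s" "ereal s < ereal abar * \<omega>p" for s
  proof -
    obtain r where r: "s / abar < r" "ereal r < \<omega>p"
      using ereal_less_real_between s(2) unfolding scaled by metis
    obtain N where N: "\<forall>z\<ge>N. r \<le> q z" by (rule eventually_at_top_greater[OF lim_p r(2)])
    have sr: "s < abar * r" using r(1) abar_pos by (simp add: field_simps)
    have sg: "1 \<in> {1, - 1 :: real}" by simp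
    have N': "r \<le> q z" if "N \<le> 1 * z" for z using N that by simp
    obtain c u where u: "sol F q s c u" "0 < 1 * mx (\<lambda>t. u t - u0 t)"
      by (rule solution_beside[OF F q lip m u0 s(1) sg sr N'])
    have "continuous_on {0..T} (\<lambda>t. u t - u0 t)"
      by (intro continuous_intros sol_cont[OF u(1)] sol_cont[OF u0])
    then obtain t where "t \<in> {0..T}" "mx (\<lambda>t. u t - u0 t) = u t - u0 t" by (rule mx_attained)
    then show ?thesis using u by (intro exI[of _ c] exI[of _ u] conjI bexI[of _ t]) auto
  qed
  show ?thesis
  proof (rule exI[of _ s0], intro conjI allI impI)
    show "ereal s0 < ereal abar * \<omega>m" by (rule s0m)
    show "\<exists>c u. sol F q s0 c u" using u0 by blast
    show "\<not> (\<exists>c u. sol F q s c u)" if "s < s0" for s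
      using s0_le[of s] that unfolding S_def by force
    show "\<exists>c u. sol F q s c u" if "s0 < s \<and> ereal s < ereal abar * \<omega>m" for s
      using lower[of s] that by blast
    show "\<exists>c1 u1 c2 u2. sol F q s c1 u1 \<and> sol F q s c2 u2 \<and> (\<exists>t\<in>{0..T}. u1 t \<noteq> u2 t)"
      if s: "s0 < s \<and> ereal s < ereal abar * min \<omega>m \<omega>p" for s
    proof -
      have "ereal s < ereal abar * \<omega>m" "ereal s < ereal abar * \<omega>p"
        using s unfolding scaled by auto
      then obtain c1 u1 c2 u2 t where *: "sol F q s c1 u1" "\<forall>t\<in>{0..T}. u1 t < u0 t"
          "sol F q s c2 u2" "t \<in> {0..T}" "u0 t < u2 t"
        using lower[of s] upper[of s] s by blast
      then have "u1 t \<noteq> u2 t" by force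
      then show ?thesis using * by blast
    qed
  qed
qed

end

section \<open>Absolutely continuous solutions\<close>

lemma abs_cont_on_shift:
  assumes g: "abs_cont_on a b g" and eq: "\<And>t. t \<in> {a..b} \<Longrightarrow> g' t = k + g t"
  shows "abs_cont_on a b g'"
  unfolding abs_cont_on_def
proof (intro allI impI)
  fix \<epsilon> :: real assume e: "\<epsilon> > 0"
  obtain \<delta> where \<delta>: "\<delta> > 0" and ac: "\<And>(n::nat) x y. (\<forall>i<n. a \<le> x i \<and> x i \<le> y i \<and> y i \<le> b) \<and>
        (\<forall>i<n. \<forall>j<n. i \<noteq> j \<longrightarrow> y i \<le> x j \<or> y j \<le> x i) \<and> (\<Sum>i<n. y i - x i) < \<delta>
        \<Longrightarrow> (\<Sum>i<n. \<bar>g (y i) - g (x i)\<bar>) < \<epsilon>"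
    using g[unfolded abs_cont_on_def, rule_format, of \<epsilon>] e by auto
  show "\<exists>\<delta>>0. \<forall>(n::nat) (x::nat \<Rightarrow> real) (y::nat \<Rightarrow> real).
        (\<forall>i<n. a \<le> x i \<and> x i \<le> y i \<and> y i \<le> b) \<and>
        (\<forall>i<n. \<forall>j<n. i \<noteq> j \<longrightarrow> y i \<le> x j \<or> y j \<le> x i) \<and> (\<Sum>i<n. y i - x i) < \<delta>
        \<longrightarrow> (\<Sum>i<n. \<bar>g' (y i) - g' (x i)\<bar>) < \<epsilon>"
  proof (rule exI[of _ \<delta>], intro conjI allI impI)
    fix n :: nat and x y :: "nat \<Rightarrow> real"
    assume xy: "(\<forall>i<n. a \<le> x i \<and> x i \<le> y i \<and> y i \<le> b) \<and>
        (\<forall>i<n. \<forall>j<n. i \<noteq> j \<longrightarrow> y i \<le> x j \<or> y j \<le> x i) \<and> (\<Sum>i<n. y i - x i) < \<delta>"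
    have "(\<Sum>i<n. \<bar>g' (y i) - g' (x i)\<bar>) = (\<Sum>i<n. \<bar>g (y i) - g (x i)\<bar>)"
    proof (rule sum.cong)
      fix i assume "i \<in> {..<n}"
      then have "a \<le> x i" "x i \<le> y i" "y i \<le> b" using xy by auto
      then show "\<bar>g' (y i) - g' (x i)\<bar> = \<bar>g (y i) - g (x i)\<bar>" using eq[of "y i"] eq[of "x i"] by simp
    qed simp
    then show "(\<Sum>i<n. \<bar>g' (y i) - g' (x i)\<bar>) < \<epsilon>" using ac[OF xy] by simp
  qed (rule \<delta>)
qed

lemma abs_cont_on_subinterval:
  assumes g: "abs_cont_on a b g" and "a \<le> c" "d \<le> b"
  shows "abs_cont_on c d g"
  unfolding abs_cont_on_def
proof (intro allI impI)
  fix \<epsilon> :: real assume e: "\<epsilon> > 0"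
  obtain \<delta> where \<delta>: "\<delta> > 0" and ac: "\<And>(n::nat) x y. (\<forall>i<n. a \<le> x i \<and> x i \<le> y i \<and> y i \<le> b) \<and>
        (\<forall>i<n. \<forall>j<n. i \<noteq> j \<longrightarrow> y i \<le> x j \<or> y j \<le> x i) \<and> (\<Sum>i<n. y i - x i) < \<delta>
        \<Longrightarrow> (\<Sum>i<n. \<bar>g (y i) - g (x i)\<bar>) < \<epsilon>"
    using g[unfolded abs_cont_on_def, rule_format, of \<epsilon>] e by auto
  show "\<exists>\<delta>>0. \<forall>(n::nat) (x::nat \<Rightarrow> real) (y::nat \<Rightarrow> real).
        (\<forall>i<n. c \<le> x i \<and> x i \<le> y i \<and> y i \<le> d) \<and>
        (\<forall>i<n. \<forall>j<n. i \<noteq> j \<longrightarrow> y i \<le> x j \<or> y j \<le> x i) \<and> (\<Sum>i<n. y i - x i) < \<delta>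
        \<longrightarrow> (\<Sum>i<n. \<bar>g (y i) - g (x i)\<bar>) < \<epsilon>"
  proof (rule exI[of _ \<delta>], intro conjI allI impI)
    fix n :: nat and x y :: "nat \<Rightarrow> real"
    assume xy: "(\<forall>i<n. c \<le> x i \<and> x i \<le> y i \<and> y i \<le> d) \<and>
        (\<forall>i<n. \<forall>j<n. i \<noteq> j \<longrightarrow> y i \<le> x j \<or> y j \<le> x i) \<and> (\<Sum>i<n. y i - x i) < \<delta>"
    have "\<forall>i<n. a \<le> x i \<and> x i \<le> y i \<and> y i \<le> b"
    proof (intro allI impI)
      fix i assume "i < n"
      then have "c \<le> x i \<and> x i \<le> y i \<and> y i \<le> d" using xy by blast
      then show "a \<le> x i \<and> x i \<le> y i \<and> y i \<le> b" using assms(2,3) by linarith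
    qed
    then show "(\<Sum>i<n. \<bar>g (y i) - g (x i)\<bar>) < \<epsilon>" using xy by (intro ac) blast
  qed (rule \<delta>)
qed

lemma AE_lebesgue_on_iff_negligible:
  fixes S :: "'a::euclidean_space set"
  assumes "S \<in> sets lebesgue"
  shows "(AE t in lebesgue_on S. P t) \<longleftrightarrow> (\<exists>N. negligible N \<and> (\<forall>t\<in>S - N. P t))"
proof -
  have "(AE t in lebesgue_on S. P t) \<longleftrightarrow> (AE t in lebesgue. t \<in> S \<longrightarrow> P t)"
    by (rule AE_restrict_space_iff) (use assms in simp)
  also have "\<dots> \<longleftrightarrow> (\<exists>N. negligible N \<and> {t. \<not> (t \<in> S \<longrightarrow> P t)} \<subseteq> N)"
    unfolding eventually_ae_filter_negligible by blast
  also have "\<dots> \<longleftrightarrow> (\<exists>N. negligible N \<and> (\<forall>t\<in>S - N. P t))" by blast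
  finally show ?thesis .
qed

lemma Icc_lebesgue: "{a..b :: real} \<in> sets lebesgue"
  by simp

lemma periodic_sol_cong_AE:
  assumes "AE t in lebesgue_on {0..T}. a t = b t"
  shows "periodic_sol \<phi> f a q e T s u \<longleftrightarrow> periodic_sol \<phi> f b q e T s u"
proof -
  have "(AE t in lebesgue_on {0..T}. \<exists>w. ((\<lambda>\<tau>. \<phi> (u' \<tau>)) has_real_derivative w) (at t within {0..T}) \<and>
                  w + f (u t) * u' t + a t * q (u t) = s + e t) \<longleftrightarrow>
     (AE t in lebesgue_on {0..T}. \<exists>w. ((\<lambda>\<tau>. \<phi> (u' \<tau>)) has_real_derivative w) (at t within {0..T}) \<and>
                  w + f (u t) * u' t + b t * q (u t) = s + e t)" for u'
    by (rule eventually_subst) (use assms in eventually_elim, simp)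
  then show ?thesis unfolding periodic_sol_def by simp
qed

context wave_equation
begin

context
  fixes \<phi> f F q :: "real \<Rightarrow> real"
  assumes inv: "\<And>x. \<psi> (\<phi> x) = x" "\<And>y. \<phi> (\<psi> y) = y"
    and f: "continuous_on UNIV f" and F: "\<And>x. (F has_real_derivative f x) (at x)"
    and q: "continuous_on UNIV q"
begin

lemma F_cont: "continuous_on UNIV F"
  by (rule DERIV_continuous_on[of _ _ f]) (use F in simp)

lemma W_eq:
  assumes u: "continuous_on {0..T} u" and t: "t \<in> {0..T}"
  shows "W q c s u t = c + integral {0..t} (\<lambda>r. s + e r - a r * q (u r))"
proof -
  have 1: "e integrable_on {0..t}" "(\<lambda>r. a r * q (u r)) integrable_on {0..t}"
    using integrable_initial[OF e_integrable] integrable_initial[OF aq_integrable[OF q u]] t by auto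
  have 2: "(\<lambda>r. s + e r) integrable_on {0..t}" by (rule integrable_add[OF integrable_const_ivl 1(1)])
  show ?thesis
    unfolding W_def Henstock_Kurzweil_Integration.integral_diff[OF 2 1(2)]
      integral_add[OF integrable_const_ivl 1(1)] using t by simp
qed

lemma friction_integral:
  assumes u: "\<And>t. t \<in> {0..T} \<Longrightarrow> (u has_real_derivative u' t) (at t within {0..T})" and t: "t \<in> {0..T}"
  shows "((\<lambda>r. f (u r) * u' r) has_integral F (u t) - F (u 0)) {0..t}"
proof (rule fundamental_theorem_of_calculus)
  show "0 \<le> t" using t by simp
  fix x assume x: "x \<in> {0..t}"
  have "(u has_real_derivative u' x) (at x within {0..t})"
    by (rule DERIV_subset[OF u]) (use x t in auto)
  from DERIV_chain2[OF F this]
  show "((\<lambda>x. F (u x)) has_vector_derivative f (u x) * u' x) (at x within {0..t})"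
    by (simp only: has_real_derivative_iff_has_vector_derivative)
qed

lemma friction_abs_integrable:
  assumes u: "continuous_on {0..T} u" and u': "continuous_on {0..T} u'"
  shows "(\<lambda>r. f (u r) * u' r) absolutely_integrable_on {0..T}"
  by (intro absolutely_integrable_continuous_real continuous_on_mult u' continuous_on_compose2[OF f u]) auto

lemma rhs_abs_integrable:
  assumes u: "continuous_on {0..T} u"
  shows "(\<lambda>r. s + e r - a r * q (u r)) absolutely_integrable_on {0..T}"
  by (intro set_integral_diff(1) set_integral_add(1) e_int aq_abs_integrable[OF q u])
    (simp add: absolutely_integrable_on_const)

text \<open>\<open>\<phi> (u')\<close> equals a constant plus the indefinite integral of
  \<open>h\<close>, since the friction term integrates to the increment of \<open>F (u t)\<close>.
  Absolute continuity and the derivative almost everywhere are then properties of indefinite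
  integrals.\<close>

lemma sol_imp_periodic_sol:
  assumes s: "sol F q s c u"
  shows "periodic_sol \<phi> f a q e T s u"
proof -
  note uc = sol_cont[OF s]
  define u' where "u' t = \<psi> (W q c s u t - F (u t))" for t
  define h where "h r = s + e r - a r * q (u r) - f (u r) * u' r" for r
  have du: "(u has_real_derivative u' t) (at t within {0..T})" if "t \<in> {0..T}" for t
    unfolding u'_def by (rule sol_deriv[OF F_cont q s that])
  have u'c: "continuous_on {0..T} u'" unfolding u'_def by (rule rhs_cont[OF F_cont q uc])
  note ir = rhs_abs_integrable[OF uc, of s] and jf = friction_abs_integrable[OF uc u'c]
  have hi: "h absolutely_integrable_on {0..T}" unfolding h_def by (rule set_integral_diff(1)[OF ir jf])
  have hint: "h integrable_on {0..T}" using hi set_lebesgue_integral_eq_integral(1) by blast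
  have phi_eq: "\<phi> (u' t) = (c - F (u 0)) + integral {0..t} h" if t: "t \<in> {0..T}" for t
  proof -
    have 1: "(\<lambda>r. s + e r - a r * q (u r)) integrable_on {0..t}"
      using integrable_initial[OF set_lebesgue_integral_eq_integral(1)[OF ir]] t by auto
    have "(h has_integral integral {0..t} (\<lambda>r. s + e r - a r * q (u r)) - (F (u t) - F (u 0))) {0..t}"
      unfolding h_def by (rule has_integral_diff[OF integrable_integral[OF 1] friction_integral[OF du t]])
    then have "integral {0..t} h = integral {0..t} (\<lambda>r. s + e r - a r * q (u r)) - (F (u t) - F (u 0))"
      by (rule integral_unique)
    then show ?thesis unfolding u'_def inv W_eq[OF uc t] by simp
  qed
  obtain N where N: "negligible N"
    "\<And>t. t \<in> {0..T} - N \<Longrightarrow> ((\<lambda>x. integral {0..x} h) has_real_derivative h t) (at t within {0..T})"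
    using indefinite_integral_has_derivative_AE[OF hint] by metis
  have dphi: "((\<lambda>\<tau>. \<phi> (u' \<tau>)) has_real_derivative h t) (at t within {0..T})" if t: "t \<in> {0..T} - N" for t
  proof -
    have "((\<lambda>x. (c - F (u 0)) + integral {0..x} h) has_real_derivative 0 + h t) (at t within {0..T})"
      by (rule DERIV_add[OF DERIV_const N(2)[OF t]])
    then have d: "((\<lambda>x. (c - F (u 0)) + integral {0..x} h) has_real_derivative h t) (at t within {0..T})"
      by (simp only: add_0_left)
    have tm: "t \<in> {0..T}" using t by blast
    show ?thesis
      by (rule has_field_derivative_transform_within[OF d zero_less_one tm]) (rule phi_eq[symmetric])
  qed
  show ?thesis
    unfolding periodic_sol_def
  proof (intro exI[of _ u'] conjI ballI)
    show "(u has_real_derivative u' t) (at t within {0..T})" if "t \<in> {0..T}" for t by (rule du[OF that])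
    show "continuous_on {0..T} u'" by (rule u'c)
    show "u 0 = u T" "u' 0 = u' T" using sol_periodic[OF s] unfolding u'_def by simp_all
    show "abs_cont_on 0 T (\<lambda>t. \<phi> (u' t))"
      by (rule abs_cont_on_shift[OF abs_cont_on_indefinite_integral[OF hi] phi_eq])
    show "AE t in lebesgue_on {0..T}. \<exists>w. ((\<lambda>\<tau>. \<phi> (u' \<tau>)) has_real_derivative w) (at t within {0..T}) \<and>
        w + f (u t) * u' t + a t * q (u t) = s + e t"
      unfolding AE_lebesgue_on_iff_negligible[OF Icc_lebesgue]
    proof (intro exI[of _ N] conjI ballI)
      show "negligible N" by (rule N(1))
      fix t assume t: "t \<in> {0..T} - N"
      show "\<exists>w. ((\<lambda>\<tau>. \<phi> (u' \<tau>)) has_real_derivative w) (at t within {0..T}) \<and>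
        w + f (u t) * u' t + a t * q (u t) = s + e t"
        by (rule exI[of _ "h t"]) (use dphi[OF t] in \<open>simp add: h_def\<close>)
    qed
  qed
qed

text \<open>Absolute continuity is what allows an equation known only almost everywhere to be
  integrated. Adding the friction integral turns \<open>\<phi> (u')\<close> into
  \<open>W - F u\<close>, with \<open>c\<close> read off at time 0; the end conditions on
  \<open>u\<close> and \<open>u'\<close> make \<open>W\<close> periodic.\<close>

lemma periodic_sol_imp_sol:
  assumes "periodic_sol \<phi> f a q e T s u"
  shows "\<exists>c. sol F q s c u"
proof -
  obtain u' where du: "\<And>t. t \<in> {0..T} \<Longrightarrow> (u has_real_derivative u' t) (at t within {0..T})"
    and u'c: "continuous_on {0..T} u'" and per: "u 0 = u T" "u' 0 = u' T"
    and ac: "abs_cont_on 0 T (\<lambda>t. \<phi> (u' t))"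
    and ae: "AE t in lebesgue_on {0..T}. \<exists>w. ((\<lambda>\<tau>. \<phi> (u' \<tau>)) has_real_derivative w) (at t within {0..T}) \<and>
        w + f (u t) * u' t + a t * q (u t) = s + e t"
    using assms unfolding periodic_sol_def by blast
  have uc: "continuous_on {0..T} u" by (rule DERIV_continuous_on) (rule du)
  define h where "h r = s + e r - a r * q (u r) - f (u r) * u' r" for r
  obtain N where N: "negligible N" "\<forall>t\<in>{0..T} - N. \<exists>w.
        ((\<lambda>\<tau>. \<phi> (u' \<tau>)) has_real_derivative w) (at t within {0..T}) \<and>
        w + f (u t) * u' t + a t * q (u t) = s + e t"
    using ae unfolding AE_lebesgue_on_iff_negligible[OF Icc_lebesgue] by blast
  have dphi: "((\<lambda>\<tau>. \<phi> (u' \<tau>)) has_real_derivative h t) (at t within {0..T})" if t: "t \<in> {0..T} - N" for t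
  proof -
    obtain w where w: "((\<lambda>\<tau>. \<phi> (u' \<tau>)) has_real_derivative w) (at t within {0..T})"
        "w + f (u t) * u' t + a t * q (u t) = s + e t"
      using N(2) t by blast
    have "w = h t" using w(2) unfolding h_def by linarith
    then show ?thesis using w(1) by simp
  qed
  define c where "c = \<phi> (u' 0) + F (u 0)"
  have phi_eq: "\<phi> (u' t) = W q c s u t - F (u t)" if t: "t \<in> {0..T}" for t
  proof -
    have t0: "0 \<le> t" "t \<le> T" using t by auto
    have act: "abs_cont_on 0 t (\<lambda>t. \<phi> (u' t))" by (rule abs_cont_on_subinterval[OF ac order_refl t0(2)])
    have hh: "(h has_integral \<phi> (u' t) - \<phi> (u' 0)) {0..t}"
    proof (rule abs_cont_on_has_integral[OF act t0(1) N(1)])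
      fix x assume x: "x \<in> {0..t} - N"
      show "((\<lambda>t. \<phi> (u' t)) has_real_derivative h x) (at x within {0..t})"
        by (rule DERIV_subset[OF dphi]) (use x t in auto)
    qed
    have "((\<lambda>r. h r + f (u r) * u' r) has_integral (\<phi> (u' t) - \<phi> (u' 0)) + (F (u t) - F (u 0))) {0..t}"
      by (rule has_integral_add[OF hh friction_integral[OF du t]])
    then have "((\<lambda>r. s + e r - a r * q (u r)) has_integral (\<phi> (u' t) - \<phi> (u' 0)) + (F (u t) - F (u 0))) {0..t}"
      unfolding h_def by simp
    then show ?thesis unfolding W_eq[OF uc t] c_def by (simp add: integral_unique)
  qed
  have u'_eq: "u' t = \<psi> (W q c s u t - F (u t))" if "t \<in> {0..T}" for t
    using phi_eq[OF that] inv(1)[of "u' t"] by simp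
  have u_eq: "u t = u 0 + V F q c s u t" if t: "t \<in> {0..T}" for t
  proof -
    have "(u' has_integral u t - u 0) {0..t}"
    proof (rule fundamental_theorem_of_calculus)
      show "0 \<le> t" using t by simp
      fix x assume x: "x \<in> {0..t}"
      have "(u has_real_derivative u' x) (at x within {0..t})"
        by (rule DERIV_subset[OF du]) (use x t in auto)
      then show "(u has_vector_derivative u' x) (at x within {0..t})"
        by (simp only: has_real_derivative_iff_has_vector_derivative)
    qed
    then have "integral {0..t} u' = u t - u 0" by (rule integral_unique)
    moreover have "V F q c s u t = integral {0..t} u'"
      unfolding V_def by (rule Henstock_Kurzweil_Integration.integral_cong) (use u'_eq t in auto)
    ultimately show ?thesis by simp
  qed
  have WT: "W q c s u T = c"
    using phi_eq[OF T_mem(2)] per unfolding c_def by simp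
  show ?thesis
    unfolding sol_def by (intro exI[of _ c] conjI ballI uc u_eq per(1)[symmetric] WT)
qed

lemma periodic_sol_iff: "periodic_sol \<phi> f a q e T s u \<longleftrightarrow> (\<exists>c. sol F q s c u)"
  using sol_imp_periodic_sol periodic_sol_imp_sol by blast

end

end

section \<open>Return to the original data\<close>

theorem theorem4p2:
  fixes \<phi> f q a e :: "real \<Rightarrow> real" and T :: real
    and \<omega>m \<omega>p :: ereal and D :: real
  assumes T: "T > 0"
    and phi_mono: "mono \<phi>"
    and phi_homeo: "\<exists>\<psi>. homeomorphism UNIV UNIV \<phi> \<psi>"
    and phi0: "\<phi> 0 = 0"
    and f_cont: "continuous_on UNIV f"
    and q_cont: "continuous_on UNIV q"
    and a_meas: "a \<in> borel_measurable (lebesgue_on {0..T})"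
    and a_bdd: "\<exists>M. AE t in lebesgue_on {0..T}. \<bar>a t\<bar> \<le> M"
    and a_nonneg: "AE t in lebesgue_on {0..T}. a t \<ge> 0"
    and a_mean: "avg T a > 0"
    and e_int: "integrable (lebesgue_on {0..T}) e"
    and e_mean: "avg T e = 0"
    and lim_m: "((\<lambda>u. ereal (q u)) \<longlongrightarrow> \<omega>m) at_bot"
    and lim_p: "((\<lambda>u. ereal (q u)) \<longlongrightarrow> \<omega>p) at_top"
    and D: "D > 0"
    and below_m: "\<forall>u\<le>-D. ereal (q u) < \<omega>m"
    and below_p: "\<forall>u\<ge>D. ereal (q u) < \<omega>p"
    and min_fin: "min \<omega>m \<omega>p < \<infinity>"
  shows "\<exists>s0::real. ereal s0 < ereal (avg T a) * \<omega>m \<and>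
     (\<forall>s<s0. \<not> (\<exists>u. periodic_sol \<phi> f a q e T s u)) \<and>
     (\<exists>u. periodic_sol \<phi> f a q e T s0 u) \<and>
     (\<forall>s. s0 < s \<and> ereal s < ereal (avg T a) * \<omega>m \<longrightarrow>
          (\<exists>u. periodic_sol \<phi> f a q e T s u)) \<and>
     (\<forall>s. s0 < s \<and> ereal s < ereal (avg T a) * min \<omega>m \<omega>p \<longrightarrow>
          (\<exists>u1 u2. periodic_sol \<phi> f a q e T s u1 \<and> periodic_sol \<phi> f a q e T s u2 \<and>
                   (\<exists>t\<in>{0..T}. u1 t \<noteq> u2 t)))"
proof -
  obtain \<psi> where "homeomorphism UNIV UNIV \<phi> \<psi>" using phi_homeo by blast
  then have inv: "\<And>x. \<psi> (\<phi> x) = x" "\<And>y. \<phi> (\<psi> y) = y" and psi_cont: "continuous_on UNIV \<psi>"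
    unfolding homeomorphism_def by auto
  have psi_mono: "strict_mono \<psi>"
  proof (rule strict_monoI, rule ccontr)
    fix x y :: real assume "x < y" "\<not> \<psi> x < \<psi> y"
    then have "\<phi> (\<psi> y) \<le> \<phi> (\<psi> x)" using phi_mono by (simp add: monoD)
    then show False using \<open>x < y\<close> unfolding inv by simp
  qed
  have psi0: "\<psi> 0 = 0" using inv(1)[of 0] phi0 by simp
  obtain M0 where M0: "AE t in lebesgue_on {0..T}. \<bar>a t\<bar> \<le> M0" using a_bdd by blast
  define M where "M = max 0 M0"
  \<comment> \<open>Cutting the weight to \<open>[0, M]\<close> gives the bounds at every point and
    alters it only on a null set, which affects neither the solutions nor the mean.\<close>
  define b where "b t = min M (max 0 (a t))" for t
  have ab: "AE t in lebesgue_on {0..T}. a t = b t"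
    using M0 a_nonneg by eventually_elim (auto simp: b_def M_def)
  have b_meas: "b \<in> borel_measurable (lebesgue_on {0..T})"
    unfolding b_def[abs_def] using a_meas by measurable
  have b: "0 \<le> b t" "b t \<le> M" for t by (auto simp: b_def M_def)
  have "b absolutely_integrable_on {0..T}"
    by (rule measurable_bounded_by_integrable_imp_absolutely_integrable[OF b_meas, of "\<lambda>_. M"])
      (use b in \<open>auto intro: integrable_const_ivl\<close>)
  then have b_int: "integrable (lebesgue_on {0..T}) b"
    by (simp add: integrable_restrict_space set_integrable_def)
  have "integral\<^sup>L (lebesgue_on {0..T}) a = integral\<^sup>L (lebesgue_on {0..T}) b"
    by (rule integral_cong_AE[OF a_meas b_meas ab])
  also have "\<dots> = integral {0..T} b" by (rule lebesgue_integral_eq_integral[OF b_int]) simp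
  finally have avg: "avg T a = integral {0..T} b / T" unfolding avg_def by simp
  have e_abs: "e absolutely_integrable_on {0..T}"
    using e_int by (simp add: integrable_restrict_space set_integrable_def)
  have "integral\<^sup>L (lebesgue_on {0..T}) e = integral {0..T} e"
    by (rule lebesgue_integral_eq_integral[OF e_int]) simp
  then have e0: "integral {0..T} e = 0" using e_mean T unfolding avg_def by simp
  interpret wave_equation \<psi> b e T M
  proof
    show "0 < integral {0..T} b" using a_mean T unfolding avg by (simp add: zero_less_divide_iff)
  qed (fact T psi_cont psi_mono psi0 b_meas b e_abs e0)+
  have avg_abar: "avg T a = abar" unfolding avg abar_def A_def ..
  \<comment> \<open>The antiderivative theorem for extended intervals, with endpoints minus and plus
    infinity, gives \<open>F\<close> on the whole line.\<close>
  obtain F where F: "\<And>x. (F has_real_derivative f x) (at x)"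
  proof -
    have "\<exists>F. \<forall>x::real. - \<infinity> < ereal x \<longrightarrow> ereal x < \<infinity> \<longrightarrow> (F has_vector_derivative f x) (at x)"
      by (rule einterval_antiderivative) (use f_cont in \<open>auto simp: continuous_on_eq_continuous_at\<close>)
    then show thesis using that by (auto simp: has_real_derivative_iff_has_vector_derivative)
  qed
  have F_cont: "continuous_on UNIV F"
    by (rule DERIV_continuous_on[of _ _ f]) (use F in simp)
  \<comment> \<open>A bound for \<open>f\<close> on \<open>{- R..R}\<close> serves as Lipschitz
    constant of \<open>F\<close> there; the comparison argument depends on it.\<close>
  have lip: "\<exists>C. \<forall>x y. \<bar>x\<bar> \<le> R \<longrightarrow> \<bar>y\<bar> \<le> R \<longrightarrow> \<bar>F x - F y\<bar> \<le> C * \<bar>x - y\<bar>" for R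
  proof -
    have "compact (f ` {- R..R})"
      by (rule compact_continuous_image[OF continuous_on_subset[OF f_cont]]) auto
    then have "bounded (f ` {- R..R})" by (rule compact_imp_bounded)
    then obtain C where C: "\<forall>y\<in>f ` {- R..R}. norm y \<le> C" unfolding bounded_iff by blast
    have "norm (F x - F y) \<le> C * norm (x - y)" if "\<bar>x\<bar> \<le> R" "\<bar>y\<bar> \<le> R" for x y
    proof (rule field_differentiable_bound[of "{- R..R}"])
      show "(F has_real_derivative f z) (at z within {- R..R})" for z
        using F by (rule has_field_derivative_at_within)
    qed (use C that in auto)
    then show ?thesis by auto
  qed
  have iff: "periodic_sol \<phi> f a q e T s u \<longleftrightarrow> (\<exists>c. sol F q s c u)" for s u
    unfolding periodic_sol_cong_AE[OF ab] by (rule periodic_sol_iff[OF inv f_cont F q_cont])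
  obtain s0 c0 u0 where s0: "ereal s0 < ereal abar * \<omega>m"
    and none: "\<forall>s<s0. \<not> (\<exists>c u. sol F q s c u)"
    and at_s0: "sol F q s0 c0 u0"
    and one: "\<forall>s. s0 < s \<and> ereal s < ereal abar * \<omega>m \<longrightarrow> (\<exists>c u. sol F q s c u)"
    and two: "\<forall>s. s0 < s \<and> ereal s < ereal abar * min \<omega>m \<omega>p \<longrightarrow>
        (\<exists>c1 u1 c2 u2. sol F q s c1 u1 \<and> sol F q s c2 u2 \<and> (\<exists>t\<in>{0..T}. u1 t \<noteq> u2 t))"
    using ambrosetti_prodi[OF F_cont q_cont lip lim_m lim_p below_m below_p min_fin]
    by (elim exE conjE) (rule that)
  show ?thesis
    unfolding iff avg_abar
  proof (rule exI[of _ s0], intro conjI)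
    show "ereal s0 < ereal abar * \<omega>m" by (rule s0)
    show "\<forall>s<s0. \<not> (\<exists>u c. sol F q s c u)" using none by blast
    show "\<exists>u c. sol F q s0 c u" using at_s0 by blast
    show "\<forall>s. s0 < s \<and> ereal s < ereal abar * \<omega>m \<longrightarrow> (\<exists>u c. sol F q s c u)" using one by blast
    show "\<forall>s. s0 < s \<and> ereal s < ereal abar * min \<omega>m \<omega>p \<longrightarrow>
        (\<exists>u1 u2. (\<exists>c. sol F q s c u1) \<and> (\<exists>c. sol F q s c u2) \<and> (\<exists>t\<in>{0..T}. u1 t \<noteq> u2 t))"
    proof (intro allI impI)
      fix s assume "s0 < s \<and> ereal s < ereal abar * min \<omega>m \<omega>p"
      then obtain c1 u1 c2 u2 where "sol F q s c1 u1" "sol F q s c2 u2" "\<exists>t\<in>{0..T}. u1 t \<noteq> u2 t"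
        using two by blast
      then show "\<exists>u1 u2. (\<exists>c. sol F q s c u1) \<and> (\<exists>c. sol F q s c u2) \<and> (\<exists>t\<in>{0..T}. u1 t \<noteq> u2 t)"
        by (intro exI[of _ u1] exI[of _ u2] conjI exI[of _ c1] exI[of _ c2])
    qed
  qed
qed

end
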